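(* There exist constants $c_3,c_5,c_7>0$ depending only on $n$ such that the following holds. Let $\epsilon\in(0,1)$ and $M\ge1$. Let $V_0\in V_d(\mathbb{R}^n)$ with $\|V_0\|(\mathbb{R}^n)\le M$, and let $\mathcal{T}_1=\{t_i\}_{i=0}^m$, $\mathcal{T}_2=\{s_j\}_{j=0}^{m'}$ be two subdivisions of $[0,1]$ satisfying $c_3\,\delta(\mathcal{T}_k)\le(M+1)^{-3}\epsilon^8$, $k=1,2$. Let $V_{\epsilon,\mathcal{T}_1}(t)$ (resp. $V_{\epsilon,\mathcal{T}_2}(t)$) be the time-discrete approximate mean curvature flow with respect to $\mathcal{T}_1$ (resp. $\mathcal{T}_2$) starting from $V_0$, and set $\delta=\max\{\delta(\mathcal{T}_1),\delta(\mathcal{T}_2)\}$. Then, for all $t\in[0,1]$, $$\Delta\big(V_{\epsilon,\mathcal{T}_1}(t),V_{\epsilon,\mathcal{T}_2}(t)\big)\le c_{7,M}\,t\,\delta\,\epsilon^{-n-11}\exp\big(c_{5,M}\,t\,\epsilon^{-n-7}\big),$$ where $c_{7,M}=c_7(M+1)^5$ and $c_{5,M}=c_5(M+1)^2$.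
   Context: Let $n\ge 2$, $1\le d\le n$. $G_{d,n}$ is the Grassmannian of $d$-dimensional linear subspaces of $\mathbb{R}^n$; $S\in G_{d,n}$ is identified with the orthogonal projection matrix onto $S$, the distance on $G_{d,n}$ is $\|S-T\|$ (operator norm), and $\mathbb{R}^n\times G_{d,n}$ carries the metric $|x-y|+\|S-T\|$. A $d$-varifold is a nonnegative Radon measure on $\mathbb{R}^n\times G_{d,n}$; $V_d(\mathbb{R}^n)$ is the set of $d$-varifolds; $\|V\|(A)=V(A\times G_{d,n})$. The bounded Lipschitz distance of finite Radon measures on a metric space $X$ is $\Delta(\mu,\nu)=\sup\{|\int\varphi\,d\mu-\int\varphi\,d\nu|:\varphi\in C^0(X,\mathbb{R}_+),\ \max(\|\varphi\|_\infty,\mathrm{Lip}(\varphi))\le 1\}$. Push-forward: for a $C^1$ diffeomorphism $f$ of $\mathbb{R}^n$, $f_\#V(\varphi)=\int\varphi(f(x),Df(x)(S))\,J_Sf(x)\,dV(x,S)$, where $J_Sf(x)=\det(Y^tY)^{1/2}$, $Y=Df(x)(s_1|\dots|s_d)$ with $(s_i)$ an orthonormal basis of $S$. Kernel: $\psi\in C^\infty(\mathbb{R}^n)$ is a fixed radially symmetric function (depending only on $n$) with $0\le\psi\le1$, $\psi=1$ on $\{|x|\le 1/2\}$, $\psi=0$ on $\{|x|\ge1\}$, $|\nabla\psi|\le3$; $\Phi_\epsilon(x)=c(\epsilon)\psi(x)(2\pi\epsilon^2)^{-n/2}\exp(-|x|^2/(2\epsilon^2))$ with $c(\epsilon)$ such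 that $\int\Phi_\epsilon=1$. Approximate mean curvature: $h_\epsilon(\cdot,V)=\Phi_\epsilon*\tilde h_\epsilon(\cdot,V)$, $\tilde h_\epsilon(y,V)=-\dfrac{(\delta V*\Phi_\epsilon)(y)}{(\|V\|*\Phi_\epsilon)(y)+\epsilon}$, where $(\|V\|*\Phi_\epsilon)(y)=\int\Phi_\epsilon(x-y)\,d\|V\|(x)$, $(\delta V*\Phi_\epsilon)(y)=\int S(\nabla\Phi_\epsilon(x-y))\,dV(x,S)$. A subdivision $\mathcal{T}=\{t_i\}_{i=0}^m$ of $[0,1]$ satisfies $0=t_0<\dots<t_m=1$; $\delta(\mathcal{T})=\max_i(t_i-t_{i-1})$. The time-discrete approximate mean curvature flow with respect to $\mathcal{T}$ starting from $V_0$ is defined by $V_{\epsilon,\mathcal{T}}(0)=V_0$ and, recursively, $V_{\epsilon,\mathcal{T}}(t)=[\mathrm{id}+(t-t_i)h_\epsilon(\cdot,V_{\epsilon,\mathcal{T}}(t_i))]_\#V_{\epsilon,\mathcal{T}}(t_i)$ for $t\in[t_i,t_{i+1}]$; the constant $c_3$ is such that the step-size condition makes all these maps $C^1$ diffeomorphisms and keeps all masses $\le M+1$. *)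

theory Defs
  imports "Jordan_Normal_Form.Determinant" "HOL-Analysis.Analysis"
begin

hide_const (open) Determinant.det Matrix.mat Matrix.vec Matrix.row Matrix.col
no_notation Matrix.vec_index (infixl \<open>$\<close> 100)
no_notation Matrix.scalar_prod (infix \<open>\<bullet>\<close> 70)

section \<open>Smooth maps\<close>

primrec C_k :: "nat \<Rightarrow> ('a::euclidean_space \<Rightarrow> 'b::real_normed_vector) \<Rightarrow> bool" where
  "C_k 0 f \<longleftrightarrow> continuous_on UNIV f"
| "C_k (Suc k) f \<longleftrightarrow> (\<forall>x. f differentiable (at x)) \<and>
     (\<forall>v. C_k k (\<lambda>x. frechet_derivative f (at x) v))"

definition smooth :: "('a::euclidean_space \<Rightarrow> 'b::real_normed_vector) \<Rightarrow> bool" where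
  "smooth f \<longleftrightarrow> (\<forall>k. C_k k f)"

definition C1_diffeo :: "('a::euclidean_space \<Rightarrow> 'a) \<Rightarrow> bool" where
  "C1_diffeo f \<longleftrightarrow> bij f \<and> C_k 1 f \<and> C_k 1 (inv_into UNIV f)"

definition gradient :: "('a::real_inner \<Rightarrow> real) \<Rightarrow> 'a \<Rightarrow> 'a" where
  "gradient f x = (THE D. GDERIV f x :> D)"

section \<open>Grassmannian and varifolds\<close>

text \<open>A subspace is represented by its orthogonal projection, so that the norm of the type of
  bounded linear maps gives the operator-norm distance on the Grassmannian.\<close>

type_synonym 'n endo = "(real^'n) \<Rightarrow>\<^sub>L (real^'n)"

definition is_orth_proj :: "'n::finite endo \<Rightarrow> (real^'n) set \<Rightarrow> bool" where
  "is_orth_proj P W \<longleftrightarrow>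
     (\<forall>x. blinfun_apply P x \<in> W \<and> (\<forall>w\<in>W. orthogonal (x - blinfun_apply P x) w))"

definition orth_proj :: "(real^'n::finite) set \<Rightarrow> 'n endo" where
  "orth_proj W = (THE P. is_orth_proj P W)"

definition grassmannian :: "nat \<Rightarrow> 'n::finite endo set" where
  "grassmannian d = {P. \<exists>W. subspace W \<and> dim W = d \<and> is_orth_proj P W}"

definition subspace_of :: "'n::finite endo \<Rightarrow> (real^'n) set" where
  "subspace_of S = range (blinfun_apply S)"

definition grass_bundle :: "nat \<Rightarrow> ((real^'n::finite) \<times> 'n endo) set" where
  "grass_bundle d = UNIV \<times> grassmannian d"

text \<open>The product metric of the library is the Euclidean combination of the two distances; the
  metric used here is their sum. Both induce the same topology.\<close>

definition bundle_dist :: "(real^'n::finite) \<times> 'n endo \<Rightarrow> (real^'n) \<times> 'n endo \<Rightarrow> real" where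
  "bundle_dist p q = norm (fst p - fst q) + norm (snd p - snd q)"

definition bundle_algebra :: "nat \<Rightarrow> ((real^'n::finite) \<times> 'n endo) measure" where
  "bundle_algebra d = restrict_space borel (grass_bundle d)"

text \<open>The bundle is a locally compact separable metric space, so Radon measures are exactly the
  Borel measures that are finite on compact sets; regularity is automatic.\<close>

definition varifold :: "nat \<Rightarrow> ((real^'n::finite) \<times> 'n endo) measure \<Rightarrow> bool" where
  "varifold d V \<longleftrightarrow> sets V = sets (bundle_algebra d) \<and>
     (\<forall>K. compact K \<and> K \<subseteq> grass_bundle d \<longrightarrow> emeasure V K < \<infinity>)"

definition weight :: "((real^'n::finite) \<times> 'n endo) measure \<Rightarrow> (real^'n) measure" where
  "weight V = distr V borel fst"

text \<open>Bounded Lipschitz distance of two finite Borel measures on a set carrying the distance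
  \<open>\<rho>\<close>, which induces the topology of the ambient type.\<close>

definition bl_dist ::
    "'a::topological_space set \<Rightarrow> ('a \<Rightarrow> 'a \<Rightarrow> real) \<Rightarrow> 'a measure \<Rightarrow> 'a measure \<Rightarrow> real" where
  "bl_dist X \<rho> \<mu> \<nu> =
     (SUP \<phi>\<in>{\<phi>. continuous_on X \<phi> \<and> (\<forall>x\<in>X. 0 \<le> \<phi> x \<and> \<phi> x \<le> 1) \<and>
                 (\<forall>x\<in>X. \<forall>y\<in>X. \<bar>\<phi> x - \<phi> y\<bar> \<le> \<rho> x y)}.
        \<bar>integral\<^sup>L \<mu> \<phi> - integral\<^sup>L \<nu> \<phi>\<bar>)"

definition varifold_dist :: "nat \<Rightarrow> ((real^'n::finite) \<times> 'n endo) measure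
    \<Rightarrow> ((real^'n) \<times> 'n endo) measure \<Rightarrow> real" where
  "varifold_dist d = bl_dist (grass_bundle d) bundle_dist"

section \<open>Push-forward\<close>

definition is_onb :: "nat \<Rightarrow> (nat \<Rightarrow> real^'n::finite) \<Rightarrow> (real^'n) set \<Rightarrow> bool" where
  "is_onb d s W \<longleftrightarrow>
     (\<forall>i<d. \<forall>j<d. inner (s i) (s j) = (if i = j then 1 else 0)) \<and> span (s ` {..<d}) = W"

text \<open>The \<open>d\<close>-by-\<open>d\<close> matrix below is \<open>Y\<^sup>t Y\<close>, where \<open>Y\<close> has the columns \<open>Df(x) s\<^sub>i\<close>. Its determinant
  does not depend on the orthonormal basis that is chosen.\<close>

definition tangential_jacobian ::
    "nat \<Rightarrow> (real^'n::finite \<Rightarrow> real^'n) \<Rightarrow> real^'n \<Rightarrow> 'n endo \<Rightarrow> real" where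
  "tangential_jacobian d f x S =
     (let s = (SOME s. is_onb d s (subspace_of S));
          Y = (\<lambda>i. frechet_derivative f (at x) (s i))
      in sqrt (Determinant.det (Matrix.mat d d (\<lambda>(i, j). inner (Y i) (Y j)))))"

definition pushforward :: "nat \<Rightarrow> (real^'n::finite \<Rightarrow> real^'n) \<Rightarrow>
    ((real^'n) \<times> 'n endo) measure \<Rightarrow> ((real^'n) \<times> 'n endo) measure" where
  "pushforward d f V =
     distr (density V (\<lambda>(x, S). ennreal (tangential_jacobian d f x S))) (bundle_algebra d)
       (\<lambda>(x, S). (f x, orth_proj (frechet_derivative f (at x) ` subspace_of S)))"

section \<open>Kernel and approximate mean curvature\<close>

definition admissible_cutoff :: "(real^'n::finite \<Rightarrow> real) \<Rightarrow> bool" where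
  "admissible_cutoff \<psi> \<longleftrightarrow> smooth \<psi> \<and>
     (\<forall>x y. norm x = norm y \<longrightarrow> \<psi> x = \<psi> y) \<and>
     (\<forall>x. 0 \<le> \<psi> x \<and> \<psi> x \<le> 1) \<and>
     (\<forall>x. norm x \<le> 1/2 \<longrightarrow> \<psi> x = 1) \<and>
     (\<forall>x. norm x \<ge> 1 \<longrightarrow> \<psi> x = 0) \<and>
     (\<forall>x. norm (gradient \<psi> x) \<le> 3)"

definition truncated_gaussian :: "(real^'n::finite \<Rightarrow> real) \<Rightarrow> real \<Rightarrow> real^'n \<Rightarrow> real" where
  "truncated_gaussian \<psi> \<epsilon> x =
     \<psi> x * ((2 * pi * \<epsilon>\<^sup>2) powr (- real CARD('n) / 2) * exp (- (norm x)\<^sup>2 / (2 * \<epsilon>\<^sup>2)))"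

definition kernel :: "(real^'n::finite \<Rightarrow> real) \<Rightarrow> real \<Rightarrow> real^'n \<Rightarrow> real" where
  "kernel \<psi> \<epsilon> x =
     inverse (\<integral>z. truncated_gaussian \<psi> \<epsilon> z \<partial>lborel) * truncated_gaussian \<psi> \<epsilon> x"

definition smoothed_weight :: "(real^'n::finite \<Rightarrow> real) \<Rightarrow> real \<Rightarrow>
    ((real^'n) \<times> 'n endo) measure \<Rightarrow> real^'n \<Rightarrow> real" where
  "smoothed_weight \<psi> \<epsilon> V y = (\<integral>x. kernel \<psi> \<epsilon> (x - y) \<partial>weight V)"

definition smoothed_variation :: "(real^'n::finite \<Rightarrow> real) \<Rightarrow> real \<Rightarrow>
    ((real^'n) \<times> 'n endo) measure \<Rightarrow> real^'n \<Rightarrow> real^'n" where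
  "smoothed_variation \<psi> \<epsilon> V y =
     (\<integral>(x, S). blinfun_apply S (gradient (kernel \<psi> \<epsilon>) (x - y)) \<partial>V)"

definition curvature_quotient :: "(real^'n::finite \<Rightarrow> real) \<Rightarrow> real \<Rightarrow>
    ((real^'n) \<times> 'n endo) measure \<Rightarrow> real^'n \<Rightarrow> real^'n" where
  "curvature_quotient \<psi> \<epsilon> V y =
     - (smoothed_variation \<psi> \<epsilon> V y /\<^sub>R (smoothed_weight \<psi> \<epsilon> V y + \<epsilon>))"

definition approx_mean_curvature :: "(real^'n::finite \<Rightarrow> real) \<Rightarrow> real \<Rightarrow>
    ((real^'n) \<times> 'n endo) measure \<Rightarrow> real^'n \<Rightarrow> real^'n" where
  "approx_mean_curvature \<psi> \<epsilon> V x =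
     (\<integral>y. kernel \<psi> \<epsilon> (x - y) *\<^sub>R curvature_quotient \<psi> \<epsilon> V y \<partial>lborel)"

section \<open>Time-discrete flow\<close>

definition subdivision :: "nat \<Rightarrow> (nat \<Rightarrow> real) \<Rightarrow> bool" where
  "subdivision m \<tau> \<longleftrightarrow> \<tau> 0 = 0 \<and> \<tau> m = 1 \<and> (\<forall>i<m. \<tau> i < \<tau> (Suc i))"

definition mesh :: "nat \<Rightarrow> (nat \<Rightarrow> real) \<Rightarrow> real" where
  "mesh m \<tau> = Max ((\<lambda>i. \<tau> (Suc i) - \<tau> i) ` {..<m})"

definition euler_step :: "(real^'n::finite \<Rightarrow> real) \<Rightarrow> real \<Rightarrow> real \<Rightarrow>
    ((real^'n) \<times> 'n endo) measure \<Rightarrow> real^'n \<Rightarrow> real^'n" where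
  "euler_step \<psi> \<epsilon> h V x = x + h *\<^sub>R approx_mean_curvature \<psi> \<epsilon> V x"

text \<open>\<open>flow_upto d \<psi> \<epsilon> V0 \<tau> i\<close> is the flow on the first \<open>i\<close> intervals, to be used for times up to
  \<open>\<tau> i\<close>. Lemma \<open>amcf_step\<close> below gives the recursion on closed intervals.\<close>

primrec flow_upto :: "nat \<Rightarrow> (real^'n::finite \<Rightarrow> real) \<Rightarrow> real \<Rightarrow>
    ((real^'n) \<times> 'n endo) measure \<Rightarrow> (nat \<Rightarrow> real) \<Rightarrow> nat \<Rightarrow> real \<Rightarrow>
    ((real^'n) \<times> 'n endo) measure" where
  "flow_upto d \<psi> \<epsilon> V0 \<tau> 0 t = V0"
| "flow_upto d \<psi> \<epsilon> V0 \<tau> (Suc i) t =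
     (if t \<le> \<tau> i then flow_upto d \<psi> \<epsilon> V0 \<tau> i t
      else (let V = flow_upto d \<psi> \<epsilon> V0 \<tau> i (\<tau> i)
            in pushforward d (euler_step \<psi> \<epsilon> (t - \<tau> i) V) V))"

definition amcf :: "nat \<Rightarrow> (real^'n::finite \<Rightarrow> real) \<Rightarrow> real \<Rightarrow>
    ((real^'n) \<times> 'n endo) measure \<Rightarrow> nat \<Rightarrow> (nat \<Rightarrow> real) \<Rightarrow> real \<Rightarrow>
    ((real^'n) \<times> 'n endo) measure" where
  "amcf d \<psi> \<epsilon> V0 m \<tau> t = flow_upto d \<psi> \<epsilon> V0 \<tau> m t"

definition step_condition :: "real \<Rightarrow> real \<Rightarrow> real \<Rightarrow> nat \<Rightarrow> (nat \<Rightarrow> real) \<Rightarrow> bool" where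
  "step_condition c M \<epsilon> m \<tau> \<longleftrightarrow> c * mesh m \<tau> \<le> (M + 1) powi (-3) * \<epsilon> ^ 8"

definition flow_well_defined :: "nat \<Rightarrow> (real^'n::finite \<Rightarrow> real) \<Rightarrow> real \<Rightarrow> real \<Rightarrow>
    ((real^'n) \<times> 'n endo) measure \<Rightarrow> nat \<Rightarrow> (nat \<Rightarrow> real) \<Rightarrow> bool" where
  "flow_well_defined d \<psi> \<epsilon> M V0 m \<tau> \<longleftrightarrow>
     (\<forall>i<m. \<forall>t\<in>{\<tau> i..\<tau> (Suc i)}.
        C1_diffeo (euler_step \<psi> \<epsilon> (t - \<tau> i) (amcf d \<psi> \<epsilon> V0 m \<tau> (\<tau> i)))) \<and>
     (\<forall>t\<in>{0..1}. emeasure (weight (amcf d \<psi> \<epsilon> V0 m \<tau> t)) UNIV \<le> ennreal (M + 1))"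

section \<open>The flow satisfies its defining recursion\<close>

lemma is_orth_proj_unique:
  assumes "subspace W" "is_orth_proj P W" "is_orth_proj Q W"
  shows "P = Q"
proof (rule blinfun_eqI)
  fix x
  let ?z = "blinfun_apply P x - blinfun_apply Q x"
  have z: "?z \<in> W"
    using assms by (auto simp: is_orth_proj_def intro: subspace_diff)
  have "inner (x - blinfun_apply P x) ?z = 0" "inner (x - blinfun_apply Q x) ?z = 0"
    using assms z unfolding is_orth_proj_def orthogonal_def by blast+
  then have "inner ?z ?z = 0"
    by (simp add: inner_diff_left)
  then show "blinfun_apply P x = blinfun_apply Q x" by simp
qed

lemma orth_proj_eq: "subspace W \<Longrightarrow> is_orth_proj P W \<Longrightarrow> orth_proj W = P"
  unfolding orth_proj_def using is_orth_proj_unique by blast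

lemma is_orth_proj_range:
  assumes "subspace W" "is_orth_proj P W"
  shows "subspace_of P = W"
proof -
  have "blinfun_apply P w = w" if "w \<in> W" for w
  proof -
    have "w - blinfun_apply P w \<in> W"
      using assms that by (auto simp: is_orth_proj_def intro: subspace_diff)
    then have "inner (w - blinfun_apply P w) (w - blinfun_apply P w) = 0"
      using assms unfolding is_orth_proj_def orthogonal_def by blast
    then show ?thesis by simp
  qed
  then have "W \<subseteq> subspace_of P"
    unfolding subspace_of_def by (metis rangeI subsetI)
  moreover have "subspace_of P \<subseteq> W"
    using assms(2) by (auto simp: subspace_of_def is_orth_proj_def)
  ultimately show ?thesis by blast
qed

lemma is_onb_exists:
  fixes W :: "(real^'n::finite) set"
  assumes "subspace W" "dim W = d"
  shows "\<exists>s. is_onb d s W"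
proof -
  obtain B where B: "B \<subseteq> W" "pairwise orthogonal B" "\<And>x. x \<in> B \<Longrightarrow> norm x = 1"
    "independent B" "card B = dim W" "span B = W"
    using orthonormal_basis_subspace[OF assms(1)] by metis
  have "finite B" using B(4) independent_imp_finite by blast
  then obtain s where s: "bij_betw s {..<d} B"
    using B(5) assms(2) by (metis ex_bij_betw_nat_finite atLeast0LessThan)
  have "inner (s i) (s j) = (if i = j then 1 else 0)" if "i < d" "j < d" for i j
  proof (cases "i = j")
    case True
    have "s i \<in> B" using s that by (auto simp: bij_betw_def)
    then show ?thesis using True B(3)[of "s i"] by (simp add: norm_eq_1)
  next
    case False
    then have "s i \<noteq> s j" "s i \<in> B" "s j \<in> B"
      using s that by (auto simp: bij_betw_def inj_on_def)
    then show ?thesis using False B(2) by (auto simp: pairwise_def orthogonal_def)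
  qed
  then have "is_onb d s W"
    using s B(6) by (auto simp: is_onb_def bij_betw_def)
  then show ?thesis by blast
qed

lemma tangential_jacobian_id:
  assumes "S \<in> grassmannian d"
  shows "tangential_jacobian d (\<lambda>x. x) x S = 1"
proof -
  obtain W where W: "subspace W" "dim W = d" "is_orth_proj S W"
    using assms by (auto simp: grassmannian_def)
  define s where "s = (SOME s. is_onb d s (subspace_of S))"
  have "is_onb d s (subspace_of S)"
    unfolding s_def is_orth_proj_range[OF W(1,3)] using is_onb_exists[OF W(1,2)] by (rule someI_ex)
  then have "Matrix.mat d d (\<lambda>(i, j). inner (s i) (s j)) = 1\<^sub>m d"
    by (intro eq_matI) (auto simp: is_onb_def)
  then show ?thesis
    by (simp add: tangential_jacobian_def Let_def flip: s_def)
qed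

lemma pushforward_id:
  assumes "sets V = sets (bundle_algebra d)"
  shows "pushforward d (\<lambda>x. x) V = V"
proof -
  have sp: "space V = grass_bundle d"
    using sets_eq_imp_space_eq[OF assms] by (simp add: bundle_algebra_def space_restrict_space)
  have J: "tangential_jacobian d (\<lambda>x. x) x S = 1" if "(x, S) \<in> space V" for x S
    using that by (auto simp: sp grass_bundle_def tangential_jacobian_id)
  have P: "orth_proj (subspace_of S) = S"
    if xS: "(x, S) \<in> space V" for x S
  proof -
    obtain W where W: "subspace W" "is_orth_proj S W"
      using xS by (auto simp: sp grass_bundle_def grassmannian_def)
    show ?thesis
      using orth_proj_eq[OF W] by (simp add: is_orth_proj_range[OF W])
  qed
  have D: "density V (\<lambda>(x, S). ennreal (tangential_jacobian d (\<lambda>x. x) x S)) = V"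
  proof -
    have "density V (\<lambda>(x, S). ennreal (tangential_jacobian d (\<lambda>x. x) x S)) = density V (\<lambda>_. 1)"
    proof -
      have "(\<integral>\<^sup>+p. (case p of (x, S) \<Rightarrow> ennreal (tangential_jacobian d (\<lambda>x. x) x S))
                * indicator A p \<partial>V) = (\<integral>\<^sup>+p. 1 * indicator A p \<partial>V)" for A
        by (rule nn_integral_cong) (auto simp: J)
      then show ?thesis unfolding density_def by (auto intro!: arg_cong[where f="measure_of _ _"])
    qed
    then show ?thesis by (simp add: density_1)
  qed
  have "pushforward d (\<lambda>x. x) V = distr V V (\<lambda>p. p)"
    unfolding pushforward_def D
    by (rule distr_cong) (auto simp: assms P)
  then show ?thesis by simp
qed

lemma sets_flow_upto:
  "sets V0 = sets (bundle_algebra d) \<Longrightarrow> sets (flow_upto d \<psi> \<epsilon> V0 \<tau> i t) = sets (bundle_algebra d)"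
  by (induction i arbitrary: t) (auto simp: pushforward_def Let_def)

lemma subdivision_mono:
  assumes "subdivision m \<tau>" "i \<le> j" "j \<le> m"
  shows "\<tau> i \<le> \<tau> j"
  using assms(2,3)
proof (induction j rule: dec_induct)
  case (step k)
  then have "\<tau> k < \<tau> (Suc k)" using assms(1) by (auto simp: subdivision_def)
  then show ?case using step by simp
qed simp

lemma flow_upto_stable:
  assumes "subdivision m \<tau>" "i \<le> k" "k \<le> m" "t \<le> \<tau> i"
  shows "flow_upto d \<psi> \<epsilon> V0 \<tau> k t = flow_upto d \<psi> \<epsilon> V0 \<tau> i t"
  using assms(2,3)
proof (induction k rule: dec_induct)
  case (step k)
  then have "t \<le> \<tau> k" using subdivision_mono[OF assms(1), of i k] assms(4) by simp
  then show ?case using step by simp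
qed simp

lemma amcf_0:
  assumes "subdivision m \<tau>"
  shows "amcf d \<psi> \<epsilon> V0 m \<tau> 0 = V0"
proof -
  have "amcf d \<psi> \<epsilon> V0 m \<tau> 0 = flow_upto d \<psi> \<epsilon> V0 \<tau> 0 0"
    unfolding amcf_def
    by (rule flow_upto_stable[OF assms]) (use assms in \<open>auto simp: subdivision_def\<close>)
  then show ?thesis by simp
qed

lemma amcf_step:
  fixes \<psi> :: "real^'n::finite \<Rightarrow> real" and \<epsilon> t :: real
    and V0 :: "((real^'n) \<times> 'n endo) measure"
  assumes "subdivision m \<tau>" "sets V0 = sets (bundle_algebra d)" "i < m" "t \<in> {\<tau> i..\<tau> (Suc i)}"
  defines "V \<equiv> amcf d \<psi> \<epsilon> V0 m \<tau> (\<tau> i)"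
  shows "amcf d \<psi> \<epsilon> V0 m \<tau> t = pushforward d (euler_step \<psi> \<epsilon> (t - \<tau> i) V) V"
proof -
  have V: "V = flow_upto d \<psi> \<epsilon> V0 \<tau> i (\<tau> i)"
    unfolding V_def amcf_def by (rule flow_upto_stable[OF assms(1)]) (use assms(3) in auto)
  show ?thesis
  proof (cases "t = \<tau> i")
    case True
    have "euler_step \<psi> \<epsilon> (t - \<tau> i) V = (\<lambda>x. x)"
      by (simp add: fun_eq_iff euler_step_def True)
    moreover have "sets V = sets (bundle_algebra d)"
      unfolding V by (rule sets_flow_upto[OF assms(2)])
    ultimately show ?thesis
      using True by (simp add: pushforward_id V_def)
  next
    case False
    have "amcf d \<psi> \<epsilon> V0 m \<tau> t = flow_upto d \<psi> \<epsilon> V0 \<tau> (Suc i) t"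
      unfolding amcf_def by (rule flow_upto_stable[OF assms(1)]) (use assms(3,4) in auto)
    then show ?thesis using False assms(4) by (simp add: V Let_def)
  qed
qed

end

theory Submission
  imports Defs
begin

text \<open>
  Both flows are described by trajectories: a point \<open>(x, S)\<close> of the bundle carries its position, its
  plane and the logarithm of the accumulated tangential Jacobian, and the varifold at time \<open>t\<close> is the
  image of the initial one under this map, weighted by the Jacobian. The uniform distance \<open>r\<close> between
  the trajectories of the two flows, with the Jacobians compared multiplicatively, bounds the bounded
  Lipschitz distance of the varifolds by \<open>2 (M + 1) r\<close>. The same coupling bounds the difference of
  the two curvature fields and of their derivatives by \<open>C (M + 1)\<^sup>2 \<epsilon>\<^bsup>-n-7\<^esup> r\<close>, so that \<open>r\<close> grows at most
  at the rate \<open>G r + \<delta> q\<close> and a discrete Gronwall inequality on the union of the two grids concludes.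
  The growth of \<open>r\<close> does not involve the size of the Jacobians because only the mass, which stays below
  \<open>M + 1\<close>, enters: the first variation of \<open>V\<close> along its own curvature field is nonpositive, hence an
  Euler step increases mass only to second order in the step size.
\<close>

section \<open>Projections and tangential Jacobians\<close>

text \<open>The exponents come from a few balances, with \<kappa> = 1/\<epsilon>. The gradient of
  the kernel is bounded by \<open>\<kappa>\<^sup>2\<close> times the kernel plus a constant. Hence
  division by the smoothed weight costs only \<open>\<kappa>\<^sup>2\<close>, the derivative of the
  outer convolution another \<open>\<kappa>\<^sup>2\<close>, and a field has size H ~ (M+1)
  \<kappa>^4 with no n in the exponent. Comparing two fields allows no such cancellation: it pays
  the Lipschitz constant \<kappa>^(n+4) of the gradient, one \<kappa> for the denominator and
  \<open>\<kappa>\<^sup>2\<close> for the outer derivative, which is the \<kappa>^(n+7) of the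
  exponential. Each field is frozen at the last node of its own grid, and since then trajectories
  have moved by about \<delta> H; times the growth rate this gives \<kappa>^(n+11). A step of length
  s gains mass of order (M+1) H^2 s^2, and keeping this below s makes \<delta> (M+1)^3 \<kappa>^8
  the quantity to be small. The obstacle is that id + t B is no flow in t. Its expansion from the
  node has an error that does not shrink with the interval of the common grid, so Gronwall needs
  increments based at the current plane.\<close>

lemma vector_eq_rdotI: "(\<And>z. inner x z = inner y z) \<Longrightarrow> x = y"
  using vector_eq_rdot[of x y] by simp

lemma is_orth_proj_fixes:
  assumes "subspace W" "is_orth_proj P W" "w \<in> W"
  shows "blinfun_apply P w = w"
proof -
  have "w - blinfun_apply P w \<in> W"
    using assms by (auto simp: is_orth_proj_def intro: subspace_diff)
  then have "inner (w - blinfun_apply P w) (w - blinfun_apply P w) = 0"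
    using assms unfolding is_orth_proj_def orthogonal_def by blast
  then show ?thesis by simp
qed

lemma grassmannianD:
  assumes "S \<in> grassmannian d"
  shows "subspace (subspace_of S)" "dim (subspace_of S) = d" "is_orth_proj S (subspace_of S)"
proof -
  obtain W where W: "subspace W" "dim W = d" "is_orth_proj S W"
    using assms by (auto simp: grassmannian_def)
  with is_orth_proj_range[OF W(1,3)]
  show "subspace (subspace_of S)" "dim (subspace_of S) = d" "is_orth_proj S (subspace_of S)"
    by auto
qed

lemma subspace_of_fixes: "S \<in> grassmannian d \<Longrightarrow> w \<in> subspace_of S \<Longrightarrow> blinfun_apply S w = w"
  using grassmannianD is_orth_proj_fixes by blast

lemma grassmannian_orth:
  "S \<in> grassmannian d \<Longrightarrow> inner (x - blinfun_apply S x) (blinfun_apply S y) = 0"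
  using grassmannianD(3)[of S d] unfolding is_orth_proj_def orthogonal_def by blast

lemma grassmannian_sym:
  assumes "S \<in> grassmannian d"
  shows "inner (blinfun_apply S x) y = inner x (blinfun_apply S y)"
  using grassmannian_orth[OF assms, of x y] grassmannian_orth[OF assms, of y x]
  by (simp add: inner_diff_left inner_commute[of "blinfun_apply S x"])

lemma grassmannian_pythagoras:
  assumes "S \<in> grassmannian d"
  shows "(norm x)\<^sup>2 = (norm (blinfun_apply S x))\<^sup>2 + (norm (x - blinfun_apply S x))\<^sup>2"
  using grassmannian_orth[OF assms, of x x]
  unfolding power2_norm_eq_inner by (simp add: inner_diff_left inner_diff_right inner_commute)

lemma grassmannian_contract:
  assumes "S \<in> grassmannian d"
  shows "norm (blinfun_apply S x) \<le> norm x" "norm (x - blinfun_apply S x) \<le> norm x"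
  using grassmannian_pythagoras[OF assms, of x] by (auto intro: power2_le_imp_le)

lemma norm_grassmannian: "S \<in> grassmannian d \<Longrightarrow> norm S \<le> 1"
  by (rule norm_blinfun_bound) (auto simp: grassmannian_contract)

lemma is_onb_proj:
  fixes W :: "(real^'n::finite) set"
  assumes "is_onb d s W"
  shows "is_orth_proj (Blinfun (\<lambda>x. \<Sum>i<d. inner x (s i) *\<^sub>R s i)) W"
proof -
  have bl: "bounded_linear (\<lambda>x. \<Sum>i<d. inner x (s i) *\<^sub>R s i)"
    by (intro bounded_linear_sum bounded_linear_scaleR_const bounded_linear_inner_left)
  have W: "W = span (s ` {..<d})" using assms by (simp add: is_onb_def)
  show ?thesis
    unfolding is_orth_proj_def bounded_linear_Blinfun_apply[OF bl]
  proof (intro allI conjI ballI)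
    fix x w assume w: "w \<in> W"
    have "orthogonal (x - (\<Sum>i<d. inner x (s i) *\<^sub>R s i)) y" if y: "y \<in> s ` {..<d}" for y
    proof -
      obtain j where j: "j < d" "y = s j" using y by auto
      have "inner (\<Sum>i<d. inner x (s i) *\<^sub>R s i) (s j) = (\<Sum>i<d. inner x (s i) * (if i = j then 1 else 0))"
        unfolding inner_sum_left inner_scaleR_left
        by (rule sum.cong) (use assms j in \<open>auto simp: is_onb_def\<close>)
      also have "\<dots> = inner x (s j)" using j by (simp add: if_distrib cong: if_cong)
      finally show ?thesis using j by (simp add: orthogonal_def inner_diff_left)
    qed
    then show "orthogonal (x - (\<Sum>i<d. inner x (s i) *\<^sub>R s i)) w"
      using w unfolding W by (rule orthogonal_to_span[rotated])
  qed (unfold W, intro span_sum span_scale span_base, auto)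
qed

lemma is_onb_expand:
  fixes W :: "(real^'n::finite) set"
  assumes "is_onb d s W" "w \<in> W"
  shows "w = (\<Sum>i<d. inner w (s i) *\<^sub>R s i)"
proof -
  have bl: "bounded_linear (\<lambda>x. \<Sum>i<d. inner x (s i) *\<^sub>R s i)"
    by (intro bounded_linear_sum bounded_linear_scaleR_const bounded_linear_inner_left)
  have "subspace W" using assms by (auto simp: is_onb_def)
  from is_orth_proj_fixes[OF this is_onb_proj[OF assms(1)] assms(2)]
  show ?thesis unfolding bounded_linear_Blinfun_apply[OF bl] by simp
qed

lemma is_onb_grassmannian:
  assumes "S \<in> grassmannian d" "is_onb d s (subspace_of S)"
  shows "blinfun_apply S x = (\<Sum>i<d. inner x (s i) *\<^sub>R s i)"
proof -
  have bl: "bounded_linear (\<lambda>x. \<Sum>i<d. inner x (s i) *\<^sub>R s i)"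
    by (intro bounded_linear_sum bounded_linear_scaleR_const bounded_linear_inner_left)
  have "S = Blinfun (\<lambda>x. \<Sum>i<d. inner x (s i) *\<^sub>R s i)"
    using is_orth_proj_unique[OF grassmannianD(1)[OF assms(1)] grassmannianD(3)[OF assms(1)] is_onb_proj[OF assms(2)]] .
  then show ?thesis by (metis bounded_linear_Blinfun_apply[OF bl])
qed

lemma orth_proj_grassmannian:
  fixes W :: "(real^'n::finite) set"
  assumes "subspace W" "dim W = d"
  shows "orth_proj W \<in> grassmannian d" "subspace_of (orth_proj W) = W"
proof -
  obtain s where "is_onb d s W" using is_onb_exists[OF assms] by blast
  from is_onb_proj[OF this] obtain P where P: "is_orth_proj P W" by blast
  then have "orth_proj W = P" using orth_proj_eq assms by blast
  then show "orth_proj W \<in> grassmannian d" "subspace_of (orth_proj W) = W"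
    using P assms is_orth_proj_range[OF assms(1) P] by (auto simp: grassmannian_def)
qed

lemma orth_proj_subspace_of: "S \<in> grassmannian d \<Longrightarrow> orth_proj (subspace_of S) = S"
  using grassmannianD orth_proj_eq by blast

text \<open>The action on planes by which \<open>pushforward\<close> moves the second component,
  with a linear map in place of the derivative. It is applied to injective \<open>A\<close>, which
  preserves the dimension.\<close>

definition tangent_map :: "'n::finite endo \<Rightarrow> 'n endo \<Rightarrow> 'n endo" where
  "tangent_map A S = orth_proj (blinfun_apply A ` subspace_of S)"

lemma tangent_map_grassmannian:
  assumes "S \<in> grassmannian d" "inj (blinfun_apply A)"
  shows "tangent_map A S \<in> grassmannian d"
    "subspace_of (tangent_map A S) = blinfun_apply A ` subspace_of S"
proof -
  have lin: "linear (blinfun_apply A)"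
    by (simp add: blinfun.bounded_linear_right bounded_linear.linear)
  have "subspace (blinfun_apply A ` subspace_of S)"
    using grassmannianD(1)[OF assms(1)] lin by (rule linear_subspace_image[rotated])
  moreover have "dim (blinfun_apply A ` subspace_of S) = d"
    using dim_image_eq[OF lin, of "subspace_of S"] assms(2) grassmannianD(2)[OF assms(1)]
    by (auto intro: inj_on_subset)
  ultimately show "tangent_map A S \<in> grassmannian d"
    "subspace_of (tangent_map A S) = blinfun_apply A ` subspace_of S"
    unfolding tangent_map_def by (auto simp: orth_proj_grassmannian)
qed

lemma tangent_map_compose:
  assumes "S \<in> grassmannian d" "inj (blinfun_apply A)"
  shows "tangent_map C (tangent_map A S) = tangent_map (C o\<^sub>L A) S"
  unfolding tangent_map_def[of C] tangent_map_grassmannian(2)[OF assms]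
  by (simp add: tangent_map_def image_image)

text \<open>From |E x| <= |x|/2 follows |x| <= 2 |x + E x|. This gives injectivity, hence an inverse
  in finite dimension, and the same inequality bounds the inverse by 2.\<close>

lemma near_id_inverse:
  fixes E :: "'n::finite endo"
  assumes "norm E \<le> 1/2"
  shows "\<exists>G :: 'n endo. norm G \<le> 2 \<and>
    (\<forall>x. blinfun_apply G x + blinfun_apply E (blinfun_apply G x) = x) \<and>
    (\<forall>x. blinfun_apply G (x + blinfun_apply E x) = x)"
proof -
  define f where "f = blinfun_apply (id_blinfun + E)"
  have f: "f x = x + E x" for x by (simp add: f_def blinfun.bilinear_simps)
  have lin: "linear f"
    unfolding f_def by (simp add: blinfun.bounded_linear_right bounded_linear.linear)
  have lower: "norm x \<le> 2 * norm (f x)" for x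
  proof -
    have "norm (E x) \<le> 1/2 * norm x"
      using norm_blinfun[of E x] mult_right_mono[OF assms, of "norm x"] by simp
    moreover have "norm x \<le> norm (f x) + norm (E x)"
      unfolding f using norm_triangle_ineq4[of "x + E x" "E x"] by simp
    ultimately show ?thesis by simp
  qed
  have inj: "inj f"
  proof (rule injI)
    fix x y assume "f x = f y"
    then have "f (x - y) = 0" using lin by (simp add: linear_diff)
    then show "x = y" using lower[of "x - y"] by simp
  qed
  then obtain g where g: "linear g" "\<And>x. g (f x) = x" "\<And>x. f (g x) = x"
    using linear_injective_isomorphism[OF lin] by blast
  have bl: "bounded_linear g" using g(1) linear_conv_bounded_linear by blast
  have ap: "blinfun_apply (Blinfun g) = g" by (rule bounded_linear_Blinfun_apply[OF bl])
  show ?thesis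
  proof (intro exI[of _ "Blinfun g"] conjI)
    show "norm (Blinfun g) \<le> 2"
      by (rule norm_blinfun_bound) (use lower[of "g _"] in \<open>auto simp: ap g\<close>)
  qed (use g in \<open>auto simp: ap f\<close>)
qed

lemma near_id_inj:
  fixes E :: "'n::finite endo"
  assumes "norm E \<le> 1/2"
  shows "inj (blinfun_apply (id_blinfun + E))"
proof -
  obtain G :: "'n endo" where "\<forall>x. blinfun_apply G (x + blinfun_apply E x) = x"
    using near_id_inverse[OF assms] by blast
  then have "blinfun_apply G (blinfun_apply (id_blinfun + E) x) = x" for x
    by (simp add: blinfun.add_left)
  then show ?thesis by (rule inj_on_inverseI)
qed

section \<open>First-order variation of a plane and of its area element\<close>

definition blinfun_adj :: "'n::finite endo \<Rightarrow> 'n endo" where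
  "blinfun_adj E = Blinfun (adjoint (blinfun_apply E))"

lemma blinfun_adj_works: "inner (blinfun_apply (blinfun_adj E) x) y = inner x (blinfun_apply E y)"
proof -
  have lin: "linear (blinfun_apply E)"
    by (simp add: blinfun.bounded_linear_right bounded_linear.linear)
  have "bounded_linear (adjoint (blinfun_apply E))"
    using adjoint_linear[OF lin] by (simp add: linear_conv_bounded_linear)
  then show ?thesis
    unfolding blinfun_adj_def
    by (simp add: bounded_linear_Blinfun_apply adjoint_works[OF lin] inner_commute)
qed

lemma norm_blinfun_adj: "norm (blinfun_adj E) \<le> norm E"
proof (rule norm_blinfun_bound)
  fix x
  let ?y = "blinfun_apply (blinfun_adj E) x"
  have "norm ?y * norm ?y = inner x (blinfun_apply E ?y)"
    using blinfun_adj_works[of E x ?y] by (simp add: dot_square_norm power2_eq_square)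
  also have "\<dots> \<le> norm x * norm (blinfun_apply E ?y)" by (rule norm_cauchy_schwarz)
  also have "\<dots> \<le> norm x * (norm E * norm ?y)"
    by (intro mult_left_mono norm_blinfun) auto
  finally have "norm ?y * norm ?y \<le> (norm E * norm x) * norm ?y" by (simp add: ac_simps)
  then show "norm ?y \<le> norm E * norm x"
    by (cases "?y = 0") auto
qed auto

lemma blinfun_adj_diff: "blinfun_adj (E - F) = blinfun_adj E - blinfun_adj F"
proof (rule blinfun_eqI)
  fix x
  have "inner (blinfun_apply (blinfun_adj (E - F)) x) y
      = inner (blinfun_apply (blinfun_adj E - blinfun_adj F) x) y" for y
    by (simp add: blinfun_adj_works blinfun.bilinear_simps inner_diff_left inner_diff_right)
  then show "blinfun_apply (blinfun_adj (E - F)) x = blinfun_apply (blinfun_adj E - blinfun_adj F) x"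
    by (rule vector_eq_rdotI)
qed

text \<open>The derivative at t = 0 of the projection onto (id + t E)(range S). In the usual form it
  is X + X^* with X = (1 - S) E S, a tangent vector of the Grassmannian at \<open>S\<close>.\<close>

definition grass_deriv :: "'n::finite endo \<Rightarrow> 'n endo \<Rightarrow> 'n endo" where
  "grass_deriv S E = (E o\<^sub>L S) - (S o\<^sub>L (E o\<^sub>L S)) + (S o\<^sub>L blinfun_adj E) - (S o\<^sub>L (blinfun_adj E o\<^sub>L S))"

lemma grass_deriv_apply:
  "blinfun_apply (grass_deriv S E) x =
    (blinfun_apply E (blinfun_apply S x) - blinfun_apply S (blinfun_apply E (blinfun_apply S x)))
    + blinfun_apply S (blinfun_apply (blinfun_adj E) (x - blinfun_apply S x))"
  by (simp add: grass_deriv_def blinfun.bilinear_simps)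

lemma norm_grass_deriv:
  assumes "S \<in> grassmannian d"
  shows "norm (grass_deriv S E) \<le> 2 * norm E"
proof (rule norm_blinfun_bound)
  fix x
  have "norm (grass_deriv S E x) \<le> norm (E (S x) - S (E (S x))) + norm (S (blinfun_adj E (x - S x)))"
    unfolding grass_deriv_apply by (rule norm_triangle_ineq)
  also have "\<dots> \<le> norm (E (S x)) + norm (blinfun_adj E (x - S x))"
    by (intro add_mono grassmannian_contract[OF assms])
  also have "\<dots> \<le> norm E * norm (S x) + norm E * norm (x - S x)"
    by (intro add_mono norm_blinfun order_trans[OF norm_blinfun[of "blinfun_adj E"]] mult_right_mono norm_blinfun_adj) auto
  also have "\<dots> \<le> norm E * norm x + norm E * norm x"
    by (intro add_mono mult_left_mono grassmannian_contract[OF assms]) auto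
  finally show "norm (grass_deriv S E x) \<le> 2 * norm E * norm x" by (simp only: mult_2 distrib_right)
qed simp

lemma norm_compose2: "norm (f o\<^sub>L (g o\<^sub>L h)) \<le> norm f * norm g * norm h"
  using norm_blinfun_compose[of f "g o\<^sub>L h"] mult_left_mono[OF norm_blinfun_compose[of g h], of "norm f"]
  by (simp add: mult.assoc)

text \<open>The difference splits into \<open>grass_deriv S (E - F)\<close> and six telescoping
  terms, each with one factor \<open>S - T\<close>, one factor \<open>F\<close> or its adjoint, and
  projections of norm at most 1; this is the 6.\<close>

lemma grass_deriv_diff:
  assumes S: "S \<in> grassmannian d" "T \<in> grassmannian d"
  shows "norm (grass_deriv S E - grass_deriv T F) \<le> 2 * norm (E - F) + 6 * norm F * norm (S - T)"
proof -
  let ?D = "S - T" and ?Fs = "blinfun_adj F"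
  have eq: "grass_deriv S E - grass_deriv T F = grass_deriv S (E - F) +
     ((F o\<^sub>L ?D) - (?D o\<^sub>L (F o\<^sub>L S)) - (T o\<^sub>L (F o\<^sub>L ?D)) + (?D o\<^sub>L ?Fs)
       - (?D o\<^sub>L (?Fs o\<^sub>L S)) - (T o\<^sub>L (?Fs o\<^sub>L ?D)))"
    by (rule blinfun_eqI)
      (simp add: grass_deriv_def blinfun_adj_diff blinfun.bilinear_simps)
  have a: "norm (F o\<^sub>L ?D) \<le> norm F * norm ?D" "norm (?D o\<^sub>L ?Fs) \<le> norm F * norm ?D"
    using norm_blinfun_compose[of F ?D] order_trans[OF norm_blinfun_compose[of ?D ?Fs]]
      mult_left_mono[OF norm_blinfun_adj[of F], of "norm ?D"] by (auto simp: mult.commute)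
  have b: "norm (?D o\<^sub>L (X o\<^sub>L S)) \<le> norm F * norm ?D" "norm (T o\<^sub>L (X o\<^sub>L ?D)) \<le> norm F * norm ?D"
    if X: "norm X \<le> norm F" for X
  proof -
    have "norm ?D * norm X * norm S \<le> norm ?D * norm F * 1"
      by (intro mult_mono X norm_grassmannian[OF S(1)]) auto
    then show "norm (?D o\<^sub>L (X o\<^sub>L S)) \<le> norm F * norm ?D"
      using norm_compose2[of ?D X S] by (simp add: mult.commute)
    have "norm T * norm X * norm ?D \<le> 1 * norm F * norm ?D"
      by (intro mult_mono X norm_grassmannian[OF S(2)]) auto
    then show "norm (T o\<^sub>L (X o\<^sub>L ?D)) \<le> norm F * norm ?D"
      using norm_compose2[of T X ?D] by simp
  qed
  have tri: "norm (u + (a1 - a2 - a3 + a4 - a5 - a6)) \<le> norm u + 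
      (norm a1 + norm a2 + norm a3 + norm a4 + norm a5 + norm a6)" for u a1 a2 a3 a4 a5 a6 :: "'a endo"
    by (intro order_trans[OF norm_triangle_ineq] add_mono order_trans[OF norm_triangle_ineq4] order_refl)
  show ?thesis
    unfolding eq
    by (rule order_trans[OF tri])
       (use norm_grass_deriv[OF S(1), of "E - F"] a b[of F] b[of ?Fs] norm_blinfun_adj[of F] in linarith)
qed

text \<open>No differentiation takes place: the new projection Q satisfies the exact identity
  \<open>key\<close>, obtained from the two facts that characterise it. Its range is the image of
  range S, and its kernel is orthogonal to that image. Replacing G Q by S and 1 - Q by 1 - S in
  \<open>key\<close> turns the right-hand side into \<open>grass_deriv S E\<close>.\<close>

lemma tangent_map_expand:
  fixes E S :: "'n::finite endo"
  assumes S: "S \<in> grassmannian d" and E: "norm E \<le> 1/2"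
  shows "norm (tangent_map (id_blinfun + E) S - S) \<le> 3 * norm E"
    and "norm (tangent_map (id_blinfun + E) S - S - grass_deriv S E) \<le> 8 * (norm E)\<^sup>2"
proof -
  obtain G :: "'n endo" where G0: "norm G \<le> 2" "\<forall>x. G x + E (G x) = x" "\<forall>x. G (x + E x) = x"
    using near_id_inverse[OF E] by blast
  note G = G0(1) G0(2)[rule_format] G0(3)[rule_format]
  define Q where "Q = tangent_map (id_blinfun + E) S"
  define Es where "Es = blinfun_adj E"
  note Q = tangent_map_grassmannian[OF S near_id_inj[OF E], folded Q_def]
  have Es: "norm (Es y) \<le> norm E * norm y" for y
    unfolding Es_def by (intro order_trans[OF norm_blinfun] mult_right_mono norm_blinfun_adj) auto
  have e1: "S (G (Q x)) = G (Q x)" for x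
  proof -
    have "Q x \<in> subspace_of Q" by (simp add: subspace_of_def)
    then have "Q x \<in> (id_blinfun + E) ` subspace_of S" by (simp only: Q(2))
    then obtain w where w: "w \<in> subspace_of S" "Q x = w + E w"
      by (auto simp: blinfun.bilinear_simps)
    then show ?thesis using G(3)[of w] subspace_of_fixes[OF S w(1)] by simp
  qed
  have e2: "S (x - Q x) = - S (Es (x - Q x))" for x
  proof -
    have "inner (S (x - Q x)) z = inner (- S (Es (x - Q x))) z" for z
    proof -
      have "S z + E (S z) \<in> (id_blinfun + E) ` subspace_of S"
        by (rule image_eqI[of _ _ "S z"]) (auto simp: blinfun.bilinear_simps subspace_of_def)
      then have "S z + E (S z) \<in> subspace_of Q" using Q(2) by simp
      then have "inner (x - Q x) (S z + E (S z)) = 0"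
        using grassmannian_orth[OF Q(1), of x] by (auto simp: subspace_of_def)
      then show ?thesis
        by (simp add: grassmannian_sym[OF S] Es_def blinfun_adj_works inner_add_right)
    qed
    then show ?thesis by (rule vector_eq_rdotI)
  qed
  have key: "Q x - S x = (E (G (Q x)) - S (E (G (Q x)))) + S (Es (x - Q x))" for x
  proof -
    have "Q x - S (Q x) = E (G (Q x)) - S (E (G (Q x)))"
      using arg_cong[OF G(2)[of "Q x"], of "\<lambda>u. u - S u"] by (simp add: blinfun.add_right e1)
    moreover have "Q x - S x = (Q x - S (Q x)) - S (x - Q x)" by (simp add: blinfun.diff_right)
    ultimately show ?thesis using e2[of x] by simp
  qed
  have GQ: "norm (G (Q x)) \<le> 2 * norm x" for x
    using norm_blinfun[of G "Q x"] mult_mono[OF G(1) grassmannian_contract(1)[OF Q(1), of x]] by simp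
  have b1: "norm (Q x - S x) \<le> 3 * norm E * norm x" for x
  proof -
    have "norm (Q x - S x) \<le> norm (E (G (Q x)) - S (E (G (Q x)))) + norm (S (Es (x - Q x)))"
      unfolding key by (rule norm_triangle_ineq)
    also have "\<dots> \<le> norm (E (G (Q x))) + norm (Es (x - Q x))"
      by (intro add_mono grassmannian_contract[OF S])
    also have "\<dots> \<le> norm E * norm (G (Q x)) + norm E * norm (x - Q x)"
      by (intro add_mono norm_blinfun Es)
    also have "\<dots> \<le> norm E * (2 * norm x) + norm E * norm x"
      by (intro add_mono mult_left_mono GQ grassmannian_contract[OF Q(1)]) auto
    finally show ?thesis by (simp add: algebra_simps)
  qed
  show "norm (tangent_map (id_blinfun + E) S - S) \<le> 3 * norm E"
    unfolding Q_def[symmetric]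
    by (rule norm_blinfun_bound) (use b1 in \<open>auto simp: blinfun.bilinear_simps\<close>)
  show "norm (tangent_map (id_blinfun + E) S - S - grass_deriv S E) \<le> 8 * (norm E)\<^sup>2"
    unfolding Q_def[symmetric]
  proof (rule norm_blinfun_bound)
    fix x
    \<comment> \<open>The error of replacing G Q x by S x, at most 5 |E| |x|; together with the 3
      |E| |x| for Q x against S x this makes the 8.\<close>
    define u where "u = G (Q x) - S x"
    have "G (Q x) - Q x = - E (G (Q x))" using G(2)[of "Q x"] by (simp add: algebra_simps)
    then have "u = (Q x - S x) - E (G (Q x))" unfolding u_def by (simp add: algebra_simps)
    then have "norm u \<le> norm (Q x - S x) + norm (E (G (Q x)))" by (simp only: norm_triangle_ineq4)
    also have "\<dots> \<le> 3 * norm E * norm x + norm E * (2 * norm x)"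
      by (intro add_mono b1 order_trans[OF norm_blinfun] mult_left_mono GQ) auto
    finally have u: "norm u \<le> 5 * norm E * norm x" by (simp add: algebra_simps)
    have "Q x - S x - grass_deriv S E x = (E u - S (E u)) + S (Es (S x - Q x))"
      using key[of x] unfolding grass_deriv_apply u_def Es_def
      by (simp add: blinfun.diff_left blinfun.diff_right)
    also have "norm \<dots> \<le> norm (E u) + norm (Es (S x - Q x))"
      by (intro order_trans[OF norm_triangle_ineq] add_mono grassmannian_contract[OF S])
    also have "\<dots> \<le> norm E * norm u + norm E * norm (Q x - S x)"
      unfolding norm_minus_commute[of "Q x" "S x"] by (intro add_mono norm_blinfun Es)
    also have "\<dots> \<le> norm E * (5 * norm E * norm x) + norm E * (3 * norm E * norm x)"
      by (intro add_mono mult_left_mono u b1) auto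
    finally show "norm (blinfun_apply (Q - S - grass_deriv S E) x) \<le> 8 * (norm E)\<^sup>2 * norm x"
      by (simp add: blinfun.diff_left power2_eq_square mult.commute mult.left_commute)
  qed simp
qed

text \<open>The trace of E S. For \<open>E\<close> the derivative of a vector field it is the
  divergence along the plane, that is, the integrand of the first variation and the logarithmic
  derivative of the tangential Jacobian.\<close>

definition grass_trace :: "'n::finite endo \<Rightarrow> 'n endo \<Rightarrow> real" where
  "grass_trace S E = (\<Sum>k\<in>Basis. inner (blinfun_apply E (blinfun_apply S k)) k)"

lemma grass_trace_diff:
  fixes S T E F :: "'n::finite endo"
  assumes "S \<in> grassmannian d"
  shows "\<bar>grass_trace S E - grass_trace T F\<bar> \<le> real CARD('n) * (norm (E - F) + norm F * norm (S - T))"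
proof -
  have "grass_trace S E - grass_trace T F = (\<Sum>k\<in>Basis. inner ((E - F) (S k) + F ((S - T) k)) k)"
    unfolding grass_trace_def sum_subtractf[symmetric]
    by (rule sum.cong) (auto simp: blinfun.bilinear_simps inner_diff_left inner_add_left)
  also have "\<bar>\<dots>\<bar> \<le> (\<Sum>k\<in>(Basis :: (real^'n) set). norm (E - F) + norm F * norm (S - T))"
  proof (intro order_trans[OF sum_abs] sum_mono)
    fix k :: "real^'n" assume k: "k \<in> Basis"
    have "\<bar>inner ((E - F) (S k) + F ((S - T) k)) k\<bar> \<le> norm ((E - F) (S k) + F ((S - T) k)) * norm k"
      by (rule Cauchy_Schwarz_ineq2)
    also have "\<dots> = norm ((E - F) (S k) + F ((S - T) k))" using k by simp
    also have "\<dots> \<le> norm ((E - F) (S k)) + norm (F ((S - T) k))" by (rule norm_triangle_ineq)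
    also have "\<dots> \<le> norm (E - F) * norm (S k) + norm F * norm ((S - T) k)"
      by (intro add_mono norm_blinfun)
    also have "\<dots> \<le> norm (E - F) * 1 + norm F * norm (S - T)"
      using grassmannian_contract(1)[OF assms, of k] norm_blinfun[of "S - T" k] k
      by (intro add_mono mult_left_mono) auto
    finally show "\<bar>inner ((E - F) (S k) + F ((S - T) k)) k\<bar> \<le> norm (E - F) + norm F * norm (S - T)" by simp
  qed
  finally show ?thesis by simp
qed

lemma grass_trace_onb:
  assumes "S \<in> grassmannian d" "is_onb d s (subspace_of S)"
  shows "grass_trace S E = (\<Sum>i<d. inner (blinfun_apply E (s i)) (s i))"
proof -
  have "grass_trace S E = (\<Sum>k\<in>Basis. \<Sum>i<d. inner k (s i) * inner (E (s i)) k)"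
    unfolding grass_trace_def is_onb_grassmannian[OF assms]
    by (simp add: blinfun.sum_right blinfun.scaleR_right inner_sum_left)
  also have "\<dots> = (\<Sum>i<d. \<Sum>k\<in>Basis. inner (E (s i)) k * inner (s i) k)"
    unfolding sum.swap[of _ Basis] by (simp add: inner_commute mult.commute)
  also have "\<dots> = (\<Sum>i<d. inner (E (s i)) (s i))"
    by (simp add: euclidean_inner[symmetric])
  finally show ?thesis .
qed

subsection \<open>Determinants near the identity\<close>

lemma prod_one_plus_expand:
  fixes e :: "'a \<Rightarrow> real"
  assumes "finite A" "0 \<le> \<eta>" "\<eta> \<le> 1" "\<And>i. i \<in> A \<Longrightarrow> \<bar>e i\<bar> \<le> \<eta>"
  shows "\<bar>(\<Prod>i\<in>A. 1 + e i) - 1 - (\<Sum>i\<in>A. e i)\<bar> \<le> 4 ^ card A * \<eta>\<^sup>2"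
  using assms(1,4)
proof (induction A rule: finite_induct)
  case (insert a A)
  define R where "R = (\<Prod>i\<in>A. 1 + e i) - 1 - (\<Sum>i\<in>A. e i)"
  define k where "k = (4::real) ^ card A"
  have R: "\<bar>R\<bar> \<le> k * \<eta>\<^sup>2" using insert unfolding R_def k_def by simp
  have "\<bar>\<Sum>i\<in>A. e i\<bar> \<le> (\<Sum>i\<in>A. \<eta>)"
    using insert by (intro order_trans[OF sum_abs] sum_mono) auto
  moreover have "real (card A) \<le> k"
    unfolding k_def using of_nat_less_two_power[of "card A", where 'a=real] power_mono[of "2::real" 4 "card A"]
    by simp
  ultimately have S: "\<bar>\<Sum>i\<in>A. e i\<bar> \<le> k * \<eta>"
    using assms(2) by (auto intro: order_trans[OF _ mult_right_mono])
  have k0: "0 \<le> k" unfolding k_def by simp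
  have "\<eta>\<^sup>2 \<le> \<eta>" using assms by (simp add: power2_eq_square mult_left_le)
  then have R': "\<bar>R\<bar> \<le> k * \<eta>" using R mult_left_mono[OF _ k0, of "\<eta>\<^sup>2" \<eta>] by simp
  have ea: "\<bar>e a\<bar> \<le> \<eta>" using insert by simp
  have "(\<Prod>i\<in>insert a A. 1 + e i) - 1 - (\<Sum>i\<in>insert a A. e i) = R + e a * ((\<Sum>i\<in>A. e i) + R)"
    using insert(1,2) by (simp add: R_def algebra_simps)
  also have "\<bar>\<dots>\<bar> \<le> \<bar>R\<bar> + \<bar>e a * ((\<Sum>i\<in>A. e i) + R)\<bar>" by (rule abs_triangle_ineq)
  also have "\<dots> \<le> \<bar>R\<bar> + \<bar>e a\<bar> * (\<bar>\<Sum>i\<in>A. e i\<bar> + \<bar>R\<bar>)"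
    unfolding abs_mult by (intro add_left_mono mult_left_mono abs_triangle_ineq) simp
  also have "\<dots> \<le> k * \<eta>\<^sup>2 + \<eta> * (k * \<eta> + k * \<eta>)"
    using assms(2) by (intro add_mono mult_mono R S R' ea) auto
  also have "\<dots> \<le> 4 * k * \<eta>\<^sup>2" using k0 assms(2) by (simp add: power2_eq_square)
  finally show ?case using insert(1,2) by (simp add: k_def)
qed simp

text \<open>In the Leibniz formula the identity permutation produces 1 plus the trace up to second
  order. Any other permutation moves some i and also p i, so it contributes two off-diagonal factors
  of size at most \<open>\<eta>\<close>, while the remaining factors are at most 2.\<close>

lemma det_near_one:
  fixes F :: "nat \<Rightarrow> nat \<Rightarrow> real"
  assumes "0 \<le> \<eta>" "\<eta> \<le> 1" "\<And>i j. i < d \<Longrightarrow> j < d \<Longrightarrow> \<bar>F i j\<bar> \<le> \<eta>"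
  shows "\<bar>Determinant.det (Matrix.mat d d (\<lambda>(i, j). (if i = j then 1 else 0) + F i j)) - 1 - (\<Sum>i<d. F i i)\<bar>
    \<le> (4 ^ d + fact d * 2 ^ d) * \<eta>\<^sup>2"
proof -
  define A where "A = Matrix.mat d d (\<lambda>(i, j). (if i = j then 1 else 0) + F i j)"
  define P where "P = {p. p permutes {0..<d}}"
  define t where "t p = (\<Prod>i = 0..<d. A $$ (i, p i))" for p
  have Ac: "A \<in> carrier_mat d d" by (simp add: A_def)
  have P: "finite P" "card P = fact d" "id \<in> P"
    by (auto simp: P_def finite_permutations card_permutations permutes_id)
  have ent: "A $$ (i, j) = (if i = j then 1 else 0) + F i j" if "i < d" "j < d" for i j
    using that by (simp add: A_def)
  have small: "\<bar>t p\<bar> \<le> 2 ^ d * \<eta>\<^sup>2" if p: "p \<in> P - {id}" for p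
  proof -
    have perm: "p permutes {0..<d}" and ne: "p \<noteq> id" using p by (auto simp: P_def)
    then obtain i where i: "p i \<noteq> i" by fastforce
    then have id: "i < d" using perm permutes_not_in by fastforce
    define j where "j = p i"
    have jd: "j < d" "j \<noteq> i" using i id permutes_in_image[OF perm, of i] by (auto simp: j_def)
    have pj: "p j \<noteq> j" using i permutes_inj[OF perm] by (auto simp: j_def inj_eq)
    have bd: "\<bar>A $$ (k, p k)\<bar> \<le> 2" if "k < d" for k
      using that permutes_in_image[OF perm, of k] assms(2) assms(3)[of k "p k"] by (auto simp: ent)
    have off: "\<bar>A $$ (k, p k)\<bar> \<le> \<eta>" if "k < d" "p k \<noteq> k" for k
      using that permutes_in_image[OF perm, of k] assms(3)[of k "p k"] by (auto simp: ent)
    define B where "B = {0..<d} - {i, j}"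
    have B: "finite B" "i \<notin> insert j B" "j \<notin> B" "B \<subseteq> {0..<d}" using jd by (auto simp: B_def)
    have split: "{0..<d} = insert i (insert j B)" using id jd by (auto simp: B_def)
    have "\<bar>t p\<bar> = (\<Prod>k = 0..<d. \<bar>A $$ (k, p k)\<bar>)" by (simp add: t_def abs_prod)
    also have "\<dots> = \<bar>A $$ (i, p i)\<bar> * (\<bar>A $$ (j, p j)\<bar> * (\<Prod>k\<in>B. \<bar>A $$ (k, p k)\<bar>))"
      unfolding split using B by simp
    also have "\<dots> \<le> \<eta> * (\<eta> * (\<Prod>k\<in>B. 2))"
      using assms(1) bd off id jd i pj B by (intro mult_mono prod_mono mult_nonneg_nonneg prod_nonneg) auto
    also have "\<dots> = 2 ^ card B * \<eta>\<^sup>2" by (simp add: power2_eq_square)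
    also have "\<dots> \<le> 2 ^ d * \<eta>\<^sup>2"
      using card_mono[OF _ B(4)] by (intro mult_right_mono power_increasing) auto
    finally show ?thesis .
  qed
  have "Determinant.det A = (\<Sum>p\<in>P. signof p * t p)"
    unfolding det_def'[OF Ac] P_def t_def ..
  also have "\<dots> = t id + (\<Sum>p\<in>P - {id}. signof p * t p)"
    using P by (simp add: sum.remove)
  finally have "Determinant.det A - 1 - (\<Sum>i<d. F i i) =
      (t id - 1 - (\<Sum>i<d. F i i)) + (\<Sum>p\<in>P - {id}. signof p * t p)" by simp
  moreover have "\<bar>t id - 1 - (\<Sum>i<d. F i i)\<bar> \<le> 4 ^ d * \<eta>\<^sup>2"
  proof -
    have "t id = (\<Prod>i<d. 1 + F i i)" unfolding t_def atLeast0LessThan by (rule prod.cong) (auto simp: ent)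
    then show ?thesis using prod_one_plus_expand[of "{..<d}" \<eta> "\<lambda>i. F i i"] assms by simp
  qed
  moreover have "\<bar>\<Sum>p\<in>P - {id}. signof p * t p\<bar> \<le> fact d * 2 ^ d * \<eta>\<^sup>2"
  proof -
    have "\<bar>\<Sum>p\<in>P - {id}. signof p * t p\<bar> \<le> (\<Sum>p\<in>P - {id}. 2 ^ d * \<eta>\<^sup>2)"
      using small by (intro order_trans[OF sum_abs] sum_mono) (auto simp: abs_mult sign_def)
    also have "\<dots> = real (card (P - {id})) * (2 ^ d * \<eta>\<^sup>2)" by simp
    also have "\<dots> \<le> real (fact d) * (2 ^ d * \<eta>\<^sup>2)"
      unfolding P(2)[symmetric] using P by (intro mult_right_mono of_nat_mono card_mono) auto
    finally show ?thesis by simp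
  qed
  ultimately show ?thesis unfolding A_def by (simp add: distrib_right)
qed

section \<open>Tangential Jacobian of a linear map: chain rule and expansion\<close>

definition jac :: "nat \<Rightarrow> 'n::finite endo \<Rightarrow> 'n endo \<Rightarrow> real" where
  "jac d A S = (let s = (SOME s. is_onb d s (subspace_of S)); Y = (\<lambda>i. blinfun_apply A (s i))
      in sqrt (Determinant.det (Matrix.mat d d (\<lambda>(i, j). inner (Y i) (Y j)))))"

lemma tangential_jacobian_eq_jac:
  assumes "(f has_derivative blinfun_apply A) (at x)"
  shows "tangential_jacobian d f x S = jac d A S"
  unfolding tangential_jacobian_def jac_def frechet_derivative_at[OF assms, symmetric] ..

lemma is_onb_some:
  assumes "S \<in> grassmannian d"
  shows "is_onb d (SOME s. is_onb d s (subspace_of S)) (subspace_of S)"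
  using is_onb_exists[OF grassmannianD(1,2)[OF assms]] by (rule someI_ex)

text \<open>With R the coordinates of the A s_i in the orthonormal basis t, the Gram matrix of the C
  A s_i is R H R^T, where H is the Gram matrix of the C t_i. Identity maps for \<open>A\<close> or
  \<open>C\<close> specialise this to independence of the basis and to the chain rule.\<close>

lemma gram_det_compose:
  fixes A C :: "'n::finite endo"
  assumes t: "is_onb d t (subspace_of T)" and A: "\<And>i. i < d \<Longrightarrow> blinfun_apply A (s i) \<in> subspace_of T"
  shows "Determinant.det (Matrix.mat d d (\<lambda>(i, j). inner (C (A (s i))) (C (A (s j))))) =
    (Determinant.det (Matrix.mat d d (\<lambda>(i, k). inner (A (s i)) (t k))))\<^sup>2 *
    Determinant.det (Matrix.mat d d (\<lambda>(i, j). inner (C (t i)) (C (t j))))"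
proof -
  define R where "R = Matrix.mat d d (\<lambda>(i, k). inner (A (s i)) (t k))"
  define H where "H = Matrix.mat d d (\<lambda>(i, j). inner (C (t i)) (C (t j)))"
  have car: "R \<in> carrier_mat d d" "H \<in> carrier_mat d d" "R\<^sup>T \<in> carrier_mat d d" by (auto simp: R_def H_def)
  have exp: "C (A (s i)) = (\<Sum>k<d. inner (A (s i)) (t k) *\<^sub>R C (t k))" if "i < d" for i
    by (subst is_onb_expand[OF t A[OF that]]) (simp add: blinfun.sum_right blinfun.scaleR_right)
  have "Matrix.mat d d (\<lambda>(i, j). inner (C (A (s i))) (C (A (s j)))) = R * H * R\<^sup>T"
  proof (rule eq_matI)
    fix i j assume "i < dim_row (R * H * R\<^sup>T)" "j < dim_col (R * H * R\<^sup>T)"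
    then have ij: "i < d" "j < d" by (auto simp: R_def)
    have "(R * H * R\<^sup>T) $$ (i, j) = (\<Sum>l<d. (\<Sum>k<d. inner (A (s i)) (t k) * inner (C (t k)) (C (t l))) * inner (A (s j)) (t l))"
      using ij by (simp add: R_def H_def scalar_prod_def atLeast0LessThan)
    also have "\<dots> = inner (C (A (s i))) (C (A (s j)))"
      unfolding exp[OF ij(1)] exp[OF ij(2)]
      by (simp add: inner_sum_left inner_sum_right sum_distrib_left sum_distrib_right mult_ac)
    finally show "Matrix.mat d d (\<lambda>(i, j). inner (C (A (s i))) (C (A (s j)))) $$ (i, j) = (R * H * R\<^sup>T) $$ (i, j)"
      using ij by simp
  qed (auto simp: R_def)
  moreover have "Determinant.det (R * H * R\<^sup>T) = (Determinant.det R)\<^sup>2 * Determinant.det H"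
    using car Determinant.det_mult[OF mult_carrier_mat[OF car(1,2)] car(3)] Determinant.det_mult[OF car(1,2)] Determinant.det_transpose[OF car(1)]
    by (simp add: power2_eq_square)
  ultimately show ?thesis unfolding R_def H_def by simp
qed

lemma is_onb_gram:
  "is_onb d s W \<Longrightarrow> Determinant.det (Matrix.mat d d (\<lambda>(i, j). inner (s i) (s j))) = 1"
proof -
  assume "is_onb d s W"
  then have "Matrix.mat d d (\<lambda>(i, j). inner (s i) (s j)) = 1\<^sub>m d"
    by (intro eq_matI) (auto simp: is_onb_def)
  then show ?thesis by simp
qed

lemma is_onb_mem: "is_onb d s W \<Longrightarrow> i < d \<Longrightarrow> s i \<in> W"
  by (auto simp: is_onb_def intro: span_base)

lemma jac_onb:
  assumes S: "S \<in> grassmannian d" and s: "is_onb d s (subspace_of S)"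
  shows "jac d A S = sqrt (Determinant.det (Matrix.mat d d (\<lambda>(i, j). inner (A (s i)) (A (s j)))))"
proof -
  define t where "t = (SOME s. is_onb d s (subspace_of S))"
  have t: "is_onb d t (subspace_of S)" unfolding t_def by (rule is_onb_some[OF S])
  define r where "r = Determinant.det (Matrix.mat d d (\<lambda>(i, k). inner (s i) (t k)))"
  \<comment> \<open>Here both maps are the identity: the change between two orthonormal bases has
    determinant of square 1.\<close>
  have "1 = r\<^sup>2"
    using gram_det_compose[OF t, where A=id_blinfun and s=s and C=id_blinfun] is_onb_mem[OF s]
    by (simp add: is_onb_gram[OF s] is_onb_gram[OF t] r_def)
  moreover have "Determinant.det (Matrix.mat d d (\<lambda>(i, j). inner (A (s i)) (A (s j)))) = r\<^sup>2 *
      Determinant.det (Matrix.mat d d (\<lambda>(i, j). inner (A (t i)) (A (t j))))"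
    using gram_det_compose[OF t, where A=id_blinfun and s=s and C=A] is_onb_mem[OF s] by (simp add: r_def)
  ultimately show ?thesis by (simp add: jac_def Let_def flip: t_def)
qed

lemma jac_compose:
  assumes S: "S \<in> grassmannian d" and A: "inj (blinfun_apply A)"
  shows "jac d (C o\<^sub>L A) S = jac d C (tangent_map A S) * jac d A S"
proof -
  note T = tangent_map_grassmannian[OF S A]
  define s where "s = (SOME s. is_onb d s (subspace_of S))"
  define t where "t = (SOME s. is_onb d s (subspace_of (tangent_map A S)))"
  have s: "is_onb d s (subspace_of S)" unfolding s_def by (rule is_onb_some[OF S])
  have t: "is_onb d t (subspace_of (tangent_map A S))" unfolding t_def by (rule is_onb_some[OF T(1)])
  have mem: "A (s i) \<in> subspace_of (tangent_map A S)" if "i < d" for i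
    using is_onb_mem[OF s that] T(2) by auto
  \<comment> \<open>Taking the identity for \<open>C\<close> identifies the squared coordinate
    determinant with the Gram determinant that defines \<open>jac d A S\<close>; inserting this into
    the general case is the chain rule.\<close>
  show ?thesis
    unfolding jac_onb[OF S s] jac_onb[OF T(1) t]
    using gram_det_compose[OF t mem, where C=C] gram_det_compose[OF t mem, where C=id_blinfun]
    by (simp add: is_onb_gram[OF t] real_sqrt_mult mult.commute)
qed

text \<open>The bracket is K with |D - 1| <= K |E| for the Gram determinant D of id + E: the 9 stems
  from entries of size at most 3 |E|, and 3 n collects the diagonal quadratic terms and the trace.
  The square of K absorbs the quadratic error of the logarithm, and the 6 forces |E| <= 1/6 whenever
  \<open>jac_const n * norm E\<close> is at most 1.\<close>

definition jac_const :: "nat \<Rightarrow> real" where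
  "jac_const n = 6 + 4 * (9 * (4 ^ n + fact n * 2 ^ n) + 3 * real n)\<^sup>2"

lemma jac_const_mono: "d \<le> n \<Longrightarrow> jac_const d \<le> jac_const n"
  unfolding jac_const_def
  by (intro add_mono mult_left_mono power_mono mult_mono power_increasing fact_mono) auto

lemma jac_const_ge: "6 \<le> jac_const n" by (simp add: jac_const_def)

text \<open>The Gram matrix of the perturbed basis is the identity plus \<open>F\<close>, so its
  determinant is 1 + x with x = 2 tr + O(|E|^2). The logarithmic estimates come from ln(1 + x)/2,
  and the upper bound on the Jacobian itself from sqrt(1 + x) <= 1 + x/2. The latter is the form
  that can be integrated against the varifold to control mass.\<close>

lemma jac_expand:
  fixes E S :: "'n::finite endo"
  assumes S: "S \<in> grassmannian d" and E: "jac_const d * norm E \<le> 1"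
  shows "0 < jac d (id_blinfun + E) S"
    "\<bar>ln (jac d (id_blinfun + E) S) - grass_trace S E\<bar> \<le> jac_const d * (norm E)\<^sup>2"
    "jac d (id_blinfun + E) S \<le> 1 + grass_trace S E + jac_const d * (norm E)\<^sup>2"
    "\<bar>ln (jac d (id_blinfun + E) S)\<bar> \<le> jac_const d * norm E"
proof -
  define s where "s = (SOME s. is_onb d s (subspace_of S))"
  have s: "is_onb d s (subspace_of S)" unfolding s_def by (rule is_onb_some[OF S])
  define F where "F i j = inner (E (s i)) (s j) + inner (s i) (E (s j)) + inner (E (s i)) (E (s j))" for i j
  define D where "D = Determinant.det (Matrix.mat d d (\<lambda>(i, j). (if i = j then 1 else 0) + F i j))"
  define tr where "tr = grass_trace S E"
  define b where "b = 9 * (4 ^ d + fact d * 2 ^ d) + real d"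
  define K where "K = b + 2 * real d"
  define e where "e = norm E"
  have e0: "0 \<le> e" by (simp add: e_def)
  have b1: "9 \<le> b" unfolding b_def by (simp add: add_increasing2 one_le_power)
  then have K1: "9 \<le> K" "b \<le> K" by (auto simp: K_def)
  have jc: "jac_const d = 6 + 4 * K\<^sup>2" by (simp add: jac_const_def K_def b_def)
  have KK: "K \<le> K\<^sup>2" using K1 by (simp add: power2_eq_square)
  have Ke: "K * e \<le> 1/4"
  proof -
    have "4 * (K * e) \<le> (6 + 4 * K\<^sup>2) * e"
      using mult_right_mono[OF KK e0] e0 by (simp add: distrib_right)
    then show ?thesis using E by (simp add: jc e_def)
  qed
  have e9: "9 * e \<le> 1/4" using mult_right_mono[OF K1(1) e0] Ke by linarith
  have ns: "norm (s i) = 1" if "i < d" for i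
    using s that by (simp add: is_onb_def norm_eq_1)
  have nE: "norm (E (s i)) \<le> e" if "i < d" for i
    using norm_blinfun[of E "s i"] ns[OF that] by (simp add: e_def)
  have ip: "\<bar>inner u v\<bar> \<le> a * c" if "norm u \<le> a" "norm v \<le> c" for u v :: "real^'n" and a c
    using Cauchy_Schwarz_ineq2[of u v] mult_mono[OF that] norm_ge_zero order_trans that(1)
    by (smt (verit))
  have F: "\<bar>F i j\<bar> \<le> 3 * e" if "i < d" "j < d" for i j
  proof -
    have "\<bar>inner (E (s i)) (s j)\<bar> \<le> e * 1" "\<bar>inner (s i) (E (s j))\<bar> \<le> 1 * e" "\<bar>inner (E (s i)) (E (s j))\<bar> \<le> e * e"
      using that by (intro ip; simp add: nE ns)+
    moreover have "e * e \<le> e" using e9 e0 by (simp add: mult_left_le)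
    ultimately show ?thesis unfolding F_def by linarith
  qed
  have jac: "jac d (id_blinfun + E) S = sqrt D"
  proof -
    have "Matrix.mat d d (\<lambda>(i, j). inner ((id_blinfun + E) (s i)) ((id_blinfun + E) (s j)))
        = Matrix.mat d d (\<lambda>(i, j). (if i = j then 1 else 0) + F i j)"
      using s by (intro eq_matI) (auto simp: is_onb_def F_def blinfun.add_left inner_add_left inner_add_right)
    then show ?thesis unfolding jac_onb[OF S s] D_def by simp
  qed
  have tr: "tr = (\<Sum>i<d. inner (E (s i)) (s i))" unfolding tr_def by (rule grass_trace_onb[OF S s])
  have trb: "\<bar>tr\<bar> \<le> real d * e"
  proof -
    have "\<bar>tr\<bar> \<le> (\<Sum>i<d. e)" unfolding tr
      using ip[OF nE, of _ "s _" 1] ns by (intro order_trans[OF sum_abs] sum_mono) (auto)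
    then show ?thesis by simp
  qed
  define x where "x = D - 1"
  have sumF: "(\<Sum>i<d. F i i) = 2 * tr + (\<Sum>i<d. inner (E (s i)) (E (s i)))"
    unfolding F_def tr sum.distrib mult_2 by (simp add: inner_commute[of "s _" "blinfun_apply E (s _)"])
  have sq: "0 \<le> (\<Sum>i<d. inner (E (s i)) (E (s i)))" "(\<Sum>i<d. inner (E (s i)) (E (s i))) \<le> real d * e\<^sup>2"
  proof -
    have "(\<Sum>i<d. inner (E (s i)) (E (s i))) \<le> (\<Sum>i<d. e\<^sup>2)"
      using nE by (intro sum_mono) (simp add: dot_square_norm power_mono)
    then show "(\<Sum>i<d. inner (E (s i)) (E (s i))) \<le> real d * e\<^sup>2" by simp
  qed (simp add: sum_nonneg)
  have "\<bar>D - 1 - (\<Sum>i<d. F i i)\<bar> \<le> (4 ^ d + fact d * 2 ^ d) * (3 * e)\<^sup>2"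
    unfolding D_def by (rule det_near_one) (use e0 e9 F in auto)
  then have xb: "\<bar>x - 2 * tr\<bar> \<le> b * e\<^sup>2"
    using sq unfolding sumF x_def b_def by (simp add: power2_eq_square algebra_simps)
  have ee: "e\<^sup>2 \<le> e" using e9 e0 by (simp add: power2_eq_square mult_left_le)
  have "b * e\<^sup>2 \<le> b * e" using ee b1 by (intro mult_left_mono) auto
  then have xK: "\<bar>x\<bar> \<le> K * e" using xb trb unfolding K_def by (simp add: distrib_right)
  then have x12: "\<bar>x\<bar> \<le> 1/2" using Ke by simp
  have "x\<^sup>2 \<le> (K * e)\<^sup>2" using xK power_mono[of "\<bar>x\<bar>" "K * e" 2] by simp
  then have x2: "x\<^sup>2 \<le> K\<^sup>2 * e\<^sup>2" by (simp add: power_mult_distrib)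
  have D0: "D > 0" using x12 unfolding x_def by linarith
  then show "0 < jac d (id_blinfun + E) S" by (simp add: jac)
  have lnj: "ln (jac d (id_blinfun + E) S) = ln (1 + x) / 2" using D0 by (simp add: jac ln_sqrt x_def)
  have lnx: "\<bar>ln (1 + x) - x\<bar> \<le> 2 * x\<^sup>2" using abs_ln_one_plus_x_minus_x_bound[OF x12] .
  have be: "b * e\<^sup>2 \<le> K\<^sup>2 * e\<^sup>2" using K1 KK by (intro mult_right_mono) auto
  have jce: "jac_const d * e\<^sup>2 = 6 * e\<^sup>2 + 4 * (K\<^sup>2 * e\<^sup>2)" by (simp add: jc algebra_simps)
  have e20: "0 \<le> e\<^sup>2" by simp
  show "\<bar>ln (jac d (id_blinfun + E) S) - grass_trace S E\<bar> \<le> jac_const d * (norm E)\<^sup>2"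
    unfolding lnj tr_def[symmetric] e_def[symmetric] jce
    using lnx xb x2 be e20 by linarith
  have "sqrt D \<le> 1 + x / 2"
  proof (rule real_le_lsqrt)
    have "D = 1 + x" by (simp add: x_def)
    then show "D \<le> (1 + x / 2)\<^sup>2" by (simp add: power2_sum power_divide)
    show "0 \<le> 1 + x / 2" using x12 by linarith
  qed
  then show "jac d (id_blinfun + E) S \<le> 1 + grass_trace S E + jac_const d * (norm E)\<^sup>2"
    unfolding jac tr_def[symmetric] e_def[symmetric] jce using xb be e20 by linarith
  have "x\<^sup>2 \<le> \<bar>x\<bar>" using x12 mult_left_le[of "\<bar>x\<bar>" "\<bar>x\<bar>"] by (simp add: power2_eq_square)
  then have "\<bar>ln (1 + x) / 2\<bar> \<le> 2 * (K * e)" using lnx xK by linarith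
  also have "\<dots> \<le> jac_const d * e" proof -
    have "0 \<le> K * e" using K1 e0 by simp
    then show ?thesis using mult_right_mono[OF KK e0] e0 by (simp add: jc distrib_right mult.assoc)
  qed
  finally show "\<bar>ln (jac d (id_blinfun + E) S)\<bar> \<le> jac_const d * norm E" by (simp add: lnj e_def)
qed

lemma jac_const_norm: "jac_const d * norm E \<le> 1 \<Longrightarrow> norm E \<le> 1/6"
  using mult_right_mono[OF jac_const_ge[of d] norm_ge_zero[of E]] by simp

text \<open>The map \<open>U = 1 + T - S\<close> carries the range of \<open>S\<close> onto that of \<open>T\<close>; comparing \<open>B U\<close> with
  \<open>A\<close> on the range of \<open>S\<close> reduces everything to maps near the identity.\<close>

lemma tangent_map_jac_local_lipschitz:
  fixes E F S T :: "'n::finite endo"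
  assumes S: "S \<in> grassmannian d" and T: "T \<in> grassmannian d"
    and E: "jac_const d * norm E \<le> 1" and F: "jac_const d * norm F \<le> 1"
    and small: "jac_const d * (4 * norm (T - S) + 2 * norm (F - E)) \<le> 1"
  shows "norm (tangent_map (id_blinfun + F) T - tangent_map (id_blinfun + E) S)
      \<le> 3 * (4 * norm (T - S) + 2 * norm (F - E))"
    and "\<bar>ln (jac d (id_blinfun + F) T) - ln (jac d (id_blinfun + E) S)\<bar>
      \<le> 2 * jac_const d * (4 * norm (T - S) + 2 * norm (F - E))"
proof -
  define r where "r = 4 * norm (T - S) + 2 * norm (F - E)"
  define A where "A = id_blinfun + E"
  define B where "B = id_blinfun + F"
  define U where "U = id_blinfun + (T - S)"
  have K6: "6 \<le> jac_const d" by (rule jac_const_ge)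
  have r0: "norm (T - S) \<le> r" "0 \<le> r" by (auto simp: r_def)
  have Kts: "jac_const d * norm (T - S) \<le> 1"
    by (rule order_trans[OF mult_left_mono[OF r0(1)]]) (use K6 small in \<open>auto simp: r_def\<close>)
  have half: "norm E \<le> 1/2" "norm F \<le> 1/2" "norm (T - S) \<le> 1/2"
    using jac_const_norm[OF E] jac_const_norm[OF F] jac_const_norm[OF Kts] by auto
  obtain G :: "'n endo" where G0: "norm G \<le> 2" "\<forall>x. G x + E (G x) = x" "\<forall>x. G (x + E x) = x"
    using near_id_inverse[OF half(1)] by blast
  have injA: "inj (blinfun_apply A)" unfolding A_def by (rule near_id_inj[OF half(1)])
  have injU: "inj (blinfun_apply U)" unfolding U_def by (rule near_id_inj[OF half(3)])
  have UT: "tangent_map U S = T"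
  proof -
    have "U ` subspace_of S \<subseteq> subspace_of T"
    proof (rule image_subsetI)
      fix w assume "w \<in> subspace_of S"
      then have "blinfun_apply S w = w" by (rule subspace_of_fixes[OF S])
      then have "U w = T w" by (simp add: U_def blinfun.add_left blinfun.diff_left)
      then show "U w \<in> subspace_of T" by (simp add: subspace_of_def)
    qed
    moreover note tg = tangent_map_grassmannian[OF S injU]
    ultimately have "subspace_of (tangent_map U S) = subspace_of T"
      using grassmannianD[OF tg(1)] grassmannianD[OF T] by (intro subspace_dim_equal) simp_all
    then show ?thesis using orth_proj_subspace_of[OF T] orth_proj_subspace_of[OF tg(1)] by simp
  qed
  define Q where "Q = ((B o\<^sub>L U) - A) o\<^sub>L G"
  have comp: "(id_blinfun + Q) o\<^sub>L A = B o\<^sub>L U"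
  proof (rule blinfun_eqI)
    fix x
    have "G (A x) = x" using G0(3) by (simp add: A_def blinfun.add_left)
    then show "((id_blinfun + Q) o\<^sub>L A) x = (B o\<^sub>L U) x"
      by (simp add: Q_def blinfun.add_left blinfun.diff_left)
  qed
  have "norm ((B o\<^sub>L U) - A) \<le> 2 * norm (T - S) + norm (F - E)"
  proof -
    have "(B o\<^sub>L U) - A = (B o\<^sub>L (T - S)) + (F - E)"
      by (rule blinfun_eqI) (simp add: A_def B_def U_def blinfun.bilinear_simps)
    moreover have "norm B \<le> 2"
      unfolding B_def using norm_triangle_ineq[of id_blinfun F] norm_blinfun_id_le[where 'a="real^'n"] half by simp
    then have "norm (B o\<^sub>L (T - S)) \<le> 2 * norm (T - S)"
      by (intro order_trans[OF norm_blinfun_compose] mult_right_mono) auto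
    ultimately show ?thesis using norm_triangle_ineq[of "B o\<^sub>L (T - S)" "F - E"] by simp
  qed
  then have Qr: "norm Q \<le> r"
    unfolding Q_def r_def using norm_blinfun_compose[of "(B o\<^sub>L U) - A" G]
      mult_mono[OF _ G0(1), of "norm ((B o\<^sub>L U) - A)" "2 * norm (T - S) + norm (F - E)"] by simp
  have KQ: "jac_const d * norm Q \<le> 1"
    by (rule order_trans[OF mult_left_mono[OF Qr]]) (use K6 small in \<open>auto simp: r_def\<close>)
  have Q2: "norm Q \<le> 1/2" using jac_const_norm[OF KQ] by simp
  note tA = tangent_map_grassmannian[OF S injA]
  have "tangent_map B T = tangent_map (id_blinfun + Q) (tangent_map A S)"
    by (subst UT[symmetric]) (simp add: tangent_map_compose[OF S injA] tangent_map_compose[OF S injU] comp)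
  then show "norm (tangent_map (id_blinfun + F) T - tangent_map (id_blinfun + E) S)
      \<le> 3 * (4 * norm (T - S) + 2 * norm (F - E))"
    using tangent_map_expand(1)[OF tA(1) Q2] Qr unfolding r_def A_def[symmetric] B_def[symmetric] by simp
  have "jac d B T * jac d U S = jac d (id_blinfun + Q) (tangent_map A S) * jac d A S"
    using jac_compose[OF S injU, of B] jac_compose[OF S injA, of "id_blinfun + Q"] by (simp add: UT comp)
  moreover have "0 < jac d B T" "0 < jac d U S" "0 < jac d (id_blinfun + Q) (tangent_map A S)" "0 < jac d A S"
    unfolding A_def[symmetric] B_def[symmetric] U_def[symmetric]
    using jac_expand(1)[OF T F] jac_expand(1)[OF S Kts] jac_expand(1)[OF tA(1) KQ] jac_expand(1)[OF S E]
    by (simp_all add: A_def B_def U_def)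
  ultimately have "ln (jac d B T) + ln (jac d U S) = ln (jac d (id_blinfun + Q) (tangent_map A S)) + ln (jac d A S)"
    using ln_mult_pos[of "jac d B T" "jac d U S"]
      ln_mult_pos[of "jac d (id_blinfun + Q) (tangent_map A S)" "jac d A S"] by simp
  moreover have "\<bar>ln (jac d U S)\<bar> \<le> jac_const d * r" "\<bar>ln (jac d (id_blinfun + Q) (tangent_map A S))\<bar> \<le> jac_const d * r"
    unfolding U_def
    by (rule order_trans[OF jac_expand(4)[OF S Kts]] order_trans[OF jac_expand(4)[OF tA(1) KQ]],
        use K6 Qr r0 in \<open>simp add: mult_left_mono\<close>)+
  ultimately show "\<bar>ln (jac d (id_blinfun + F) T) - ln (jac d (id_blinfun + E) S)\<bar>
      \<le> 2 * jac_const d * (4 * norm (T - S) + 2 * norm (F - E))"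
    unfolding A_def[symmetric] B_def[symmetric] r_def[symmetric] by linarith
qed

section \<open>Increments of planes and Jacobians inside one Euler step\<close>

lemma blinfun_adj_scaleR: "blinfun_adj (c *\<^sub>R E) = c *\<^sub>R blinfun_adj E"
proof (rule blinfun_eqI)
  fix x
  show "blinfun_apply (blinfun_adj (c *\<^sub>R E)) x = blinfun_apply (c *\<^sub>R blinfun_adj E) x"
    by (rule vector_eq_rdotI) (simp add: blinfun_adj_works blinfun.scaleR_left)
qed

lemma grass_deriv_scaleR: "grass_deriv S (c *\<^sub>R E) = c *\<^sub>R grass_deriv S E"
  by (rule blinfun_eqI)
    (simp add: grass_deriv_apply blinfun_adj_scaleR blinfun.scaleR_left blinfun.scaleR_right scaleR_diff_right scaleR_add_right)

lemma grass_trace_scaleR: "grass_trace S (c *\<^sub>R E) = c * grass_trace S E"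
  by (simp add: grass_trace_def blinfun.scaleR_left sum_distrib_left)

text \<open>Writing G for the inverse of id + t B, one has id + (t+s) B = (id + s C)(id + t B) with
  C = B G, and C differs from B by at most 2 t |B|^2. The increment from t to t+s is thus a step
  near the identity starting at the current plane \<open>Sa\<close>. Both the quadratic error in s C
  and the replacement of C by B are of order s (t+s) |B|^2, hence proportional to s.\<close>

lemma tangent_increment:
  fixes B S :: "'n::finite endo"
  assumes S: "S \<in> grassmannian d" and t: "0 \<le> t" "0 \<le> s"
    and B: "jac_const d * (2 * ((t + s) * norm B)) \<le> 1"
  defines "Sa \<equiv> tangent_map (id_blinfun + t *\<^sub>R B) S"
    and "Sb \<equiv> tangent_map (id_blinfun + (t + s) *\<^sub>R B) S"
  shows "norm (Sb - Sa - s *\<^sub>R grass_deriv Sa B) \<le> 36 * (s * (t + s) * (norm B)\<^sup>2)"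
    and "\<bar>ln (jac d (id_blinfun + (t + s) *\<^sub>R B) S) - ln (jac d (id_blinfun + t *\<^sub>R B) S)
        - s * grass_trace Sa B\<bar> \<le> (4 * jac_const d + 2 * real CARD('n)) * (s * (t + s) * (norm B)\<^sup>2)"
proof -
  define b where "b = norm B"
  define K where "K = jac_const d"
  have K6: "6 \<le> K" unfolding K_def by (rule jac_const_ge)
  have b0: "0 \<le> b" by (simp add: b_def)
  have Kb: "K * ((t + s) * b) \<le> 1/2" using B by (simp add: K_def b_def)
  have "K * (t * b) \<le> K * ((t + s) * b)" "K * (s * b) \<le> K * ((t + s) * b)"
    using K6 b0 t by (auto intro!: mult_left_mono mult_right_mono)
  then have Ktb: "K * (t * b) \<le> 1/2" and Ksb: "K * (s * b) \<le> 1/2" using Kb by auto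
  have ntB: "norm (t *\<^sub>R B) = t * b" using t by (simp add: b_def)
  have Kt: "jac_const d * norm (t *\<^sub>R B) \<le> 1" unfolding ntB using Ktb by (simp add: K_def)
  have half: "norm (t *\<^sub>R B) \<le> 1/2" using jac_const_norm[OF Kt] by simp
  obtain G :: "'n endo" where G0: "norm G \<le> 2" "\<forall>x. G x + (t *\<^sub>R B) (G x) = x" "\<forall>x. G (x + (t *\<^sub>R B) x) = x"
    using near_id_inverse[OF half] by blast
  define A where "A = id_blinfun + t *\<^sub>R B"
  have injA: "inj (blinfun_apply A)" unfolding A_def by (rule near_id_inj[OF half])
  note tA = tangent_map_grassmannian[OF S injA, folded Sa_def[folded A_def]]
  define C where "C = B o\<^sub>L G"
  have comp: "(id_blinfun + s *\<^sub>R C) o\<^sub>L A = id_blinfun + (t + s) *\<^sub>R B"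
  proof (rule blinfun_eqI)
    fix x
    have "G (A x) = x" using G0(3) by (simp add: A_def blinfun.add_left)
    then have "((id_blinfun + s *\<^sub>R C) o\<^sub>L A) x = A x + s *\<^sub>R B x"
      by (simp add: C_def blinfun.add_left blinfun.scaleR_left)
    then show "((id_blinfun + s *\<^sub>R C) o\<^sub>L A) x = (id_blinfun + (t + s) *\<^sub>R B) x"
      by (simp add: A_def blinfun.add_left blinfun.scaleR_left scaleR_add_left)
  qed
  have C: "norm C \<le> 2 * b"
    unfolding C_def b_def using norm_blinfun_compose[of B G] mult_left_mono[OF G0(1), of "norm B"] by simp
  have CB: "norm (C - B) \<le> 2 * (t * b\<^sup>2)"
  proof (rule norm_blinfun_bound)
    fix x
    have "x = G x + t *\<^sub>R B (G x)" using G0(2) by (simp add: blinfun.scaleR_left)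
    then have "B x = B (G x + t *\<^sub>R B (G x))" by simp
    then have "(C - B) x = - (t *\<^sub>R B (B (G x)))"
      by (simp add: C_def blinfun.diff_left blinfun.add_right blinfun.scaleR_right)
    then have "norm ((C - B) x) = t * norm (B (B (G x)))" using t by simp
    also have "\<dots> \<le> t * (b * (b * (2 * norm x)))"
      unfolding b_def using t
      by (intro mult_left_mono order_trans[OF norm_blinfun] mult_right_mono G0) auto
    finally show "norm ((C - B) x) \<le> 2 * (t * b\<^sup>2) * norm x" by (simp add: power2_eq_square mult_ac)
  qed (use t b0 in simp)
  have nE: "norm (s *\<^sub>R C) \<le> 2 * (s * b)" using mult_left_mono[OF C t(2)] t by (simp add: mult_ac)
  have KE: "jac_const d * norm (s *\<^sub>R C) \<le> 1"
  proof -
    have "K * norm (s *\<^sub>R C) \<le> K * (2 * (s * b))" using nE K6 by (intro mult_left_mono) auto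
    moreover have "K * (2 * (s * b)) = 2 * (K * (s * b))" by simp
    ultimately show ?thesis using Ksb unfolding K_def by linarith
  qed
  have Eh: "norm (s *\<^sub>R C) \<le> 1/2" using jac_const_norm[OF KE] by simp
  have E2: "(norm (s *\<^sub>R C))\<^sup>2 \<le> 4 * (s * s * b\<^sup>2)"
    using power_mono[OF nE, of 2] by (simp add: power_mult_distrib power2_eq_square mult_ac)
  have Sb: "Sb = tangent_map (id_blinfun + s *\<^sub>R C) Sa"
    unfolding Sb_def Sa_def comp[symmetric] A_def[symmetric] by (simp add: tangent_map_compose[OF S injA])
  have q: "s * s * b\<^sup>2 \<le> s * (t + s) * b\<^sup>2" "s * t * b\<^sup>2 \<le> s * (t + s) * b\<^sup>2"
    using t by (auto intro!: mult_right_mono mult_left_mono)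
  have CB': "norm (s *\<^sub>R C - s *\<^sub>R B) \<le> 2 * (s * t * b\<^sup>2)"
    using mult_left_mono[OF CB t(2)] t by (simp flip: scaleR_diff_right add: mult_ac)
  have "norm (Sb - Sa - s *\<^sub>R grass_deriv Sa B) \<le> norm (Sb - Sa - grass_deriv Sa (s *\<^sub>R C)) 
      + norm (grass_deriv Sa (s *\<^sub>R C) - grass_deriv Sa (s *\<^sub>R B))"
    using norm_triangle_ineq[of "Sb - Sa - grass_deriv Sa (s *\<^sub>R C)" "grass_deriv Sa (s *\<^sub>R C) - grass_deriv Sa (s *\<^sub>R B)"]
    by (simp add: grass_deriv_scaleR)
  also have "\<dots> \<le> 8 * (4 * (s * s * b\<^sup>2)) + 2 * (2 * (s * t * b\<^sup>2))"
  proof (rule add_mono)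
    show "norm (Sb - Sa - grass_deriv Sa (s *\<^sub>R C)) \<le> 8 * (4 * (s * s * b\<^sup>2))"
      using tangent_map_expand(2)[OF tA(1) Eh] E2 unfolding Sb by simp
    show "norm (grass_deriv Sa (s *\<^sub>R C) - grass_deriv Sa (s *\<^sub>R B)) \<le> 2 * (2 * (s * t * b\<^sup>2))"
      using grass_deriv_diff[OF tA(1) tA(1), of "s *\<^sub>R C" "s *\<^sub>R B"] CB' by simp
  qed
  also have "\<dots> \<le> 36 * (s * (t + s) * b\<^sup>2)" using q by simp
  finally show "norm (Sb - Sa - s *\<^sub>R grass_deriv Sa B) \<le> 36 * (s * (t + s) * (norm B)\<^sup>2)" by (simp add: b_def)
  have pos: "0 < jac d (id_blinfun + s *\<^sub>R C) Sa" "0 < jac d A S"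
    using jac_expand(1)[OF tA(1) KE] jac_expand(1)[OF S Kt] by (auto simp: A_def)
  have "ln (jac d (id_blinfun + (t + s) *\<^sub>R B) S) = ln (jac d (id_blinfun + s *\<^sub>R C) Sa) + ln (jac d A S)"
    unfolding comp[symmetric] jac_compose[OF S injA] Sa_def[folded A_def, symmetric]
    using pos by (simp add: ln_mult_pos)
  moreover have "\<bar>ln (jac d (id_blinfun + s *\<^sub>R C) Sa) - grass_trace Sa (s *\<^sub>R C)\<bar> \<le> K * (4 * (s * s * b\<^sup>2))"
    unfolding K_def by (rule order_trans[OF jac_expand(2)[OF tA(1) KE]], rule mult_left_mono[OF E2])
      (use K6 in \<open>simp add: K_def\<close>)
  moreover have "\<bar>grass_trace Sa (s *\<^sub>R C) - s * grass_trace Sa B\<bar> \<le> real CARD('n) * (2 * (s * t * b\<^sup>2))"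
  proof -
    have "\<bar>grass_trace Sa (s *\<^sub>R C) - s * grass_trace Sa B\<bar> \<le> real CARD('n) * norm (s *\<^sub>R C - s *\<^sub>R B)"
      using grass_trace_diff[OF tA(1), of "s *\<^sub>R C" Sa "s *\<^sub>R B"] by (simp only: grass_trace_scaleR) simp
    also have "\<dots> \<le> real CARD('n) * (2 * (s * t * b\<^sup>2))" by (intro mult_left_mono CB') simp
    finally show ?thesis .
  qed
  moreover have "K * (4 * (s * s * b\<^sup>2)) + real CARD('n) * (2 * (s * t * b\<^sup>2)) \<le> (4 * K + 2 * real CARD('n)) * (s * (t + s) * b\<^sup>2)"
  proof -
    have eq: "(4 * K + 2 * m) * z = K * (4 * z) + m * (2 * z)" for z m :: real by (simp add: distrib_right)
    show ?thesis unfolding eq by (intro add_mono mult_left_mono q) (use K6 in auto)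
  qed
  ultimately show "\<bar>ln (jac d (id_blinfun + (t + s) *\<^sub>R B) S) - ln (jac d (id_blinfun + t *\<^sub>R B) S)
        - s * grass_trace Sa B\<bar> \<le> (4 * jac_const d + 2 * real CARD('n)) * (s * (t + s) * (norm B)\<^sup>2)"
    unfolding K_def[symmetric] b_def[symmetric] A_def[symmetric] by linarith
qed

text \<open>The two flows run for the same time \<open>s\<close>, but they left their own nodes
  \<open>t\<^sub>1\<close> and \<open>t\<^sub>2\<close> ago. Both increments are replaced by their
  first-order parts at the current planes, and those are Lipschitz in plane and matrix. Everything
  added to the old distance carries the factor \<open>s\<close>, as the Gronwall argument
  requires.\<close>

lemma tangent_pair_step:
  fixes S\<^sub>1 S\<^sub>2 B\<^sub>1 B\<^sub>2 :: "'n::finite endo" and H \<delta> s t\<^sub>1 t\<^sub>2 l\<^sub>1 l\<^sub>2 :: real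
  assumes S: "S\<^sub>1 \<in> grassmannian d" "S\<^sub>2 \<in> grassmannian d" and B: "norm B\<^sub>1 \<le> H" "norm B\<^sub>2 \<le> H"
    and t: "0 \<le> t\<^sub>1" "0 \<le> t\<^sub>2" "0 \<le> s" "t\<^sub>1 + s \<le> \<delta>" "t\<^sub>2 + s \<le> \<delta>"
    and small: "jac_const d * (2 * (\<delta> * H)) \<le> 1"
  defines "P1 t \<equiv> tangent_map (id_blinfun + t *\<^sub>R B\<^sub>1) S\<^sub>1" and "P2 t \<equiv> tangent_map (id_blinfun + t *\<^sub>R B\<^sub>2) S\<^sub>2"
    and "L1 t \<equiv> l\<^sub>1 + ln (jac d (id_blinfun + t *\<^sub>R B\<^sub>1) S\<^sub>1)" and "L2 t \<equiv> l\<^sub>2 + ln (jac d (id_blinfun + t *\<^sub>R B\<^sub>2) S\<^sub>2)"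
    and "c \<equiv> 36 + 4 * jac_const d + 2 * real CARD('n)"
  shows "norm (P1 (t\<^sub>1 + s) - P2 (t\<^sub>2 + s)) + \<bar>L1 (t\<^sub>1 + s) - L2 (t\<^sub>2 + s)\<bar>
    \<le> norm (P1 t\<^sub>1 - P2 t\<^sub>2) + \<bar>L1 t\<^sub>1 - L2 t\<^sub>2\<bar> +
      s * ((2 + real CARD('n)) * norm (B\<^sub>1 - B\<^sub>2) + (6 + real CARD('n)) * H * norm (P1 t\<^sub>1 - P2 t\<^sub>2)
        + 2 * c * (\<delta> * H\<^sup>2))"
proof -
  have K6: "6 \<le> jac_const d" by (rule jac_const_ge)
  have H0: "0 \<le> H" using B(1) norm_ge_zero order_trans by blast
  have \<delta>0: "0 \<le> \<delta>" using t by simp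
  have sm: "jac_const d * (2 * (u * norm B)) \<le> 1" if "norm B \<le> H" "0 \<le> u" "u \<le> \<delta>" for u and B :: "'n endo"
  proof -
    have "u * norm B \<le> \<delta> * H" using that \<delta>0 by (intro mult_mono) auto
    then have "jac_const d * (2 * (u * norm B)) \<le> jac_const d * (2 * (\<delta> * H))" using K6 by (intro mult_left_mono) auto
    then show ?thesis using small by (rule order_trans)
  qed
  have gr: "tangent_map (id_blinfun + u *\<^sub>R B) S \<in> grassmannian d"
    if "S \<in> grassmannian d" "norm B \<le> H" "0 \<le> u" "u \<le> \<delta>" for u and B S :: "'n endo"
  proof (intro tangent_map_grassmannian(1)[OF that(1)] near_id_inj)
    have "jac_const d * norm (2 *\<^sub>R u *\<^sub>R B) \<le> 1" using sm[OF that(2-4)] that by simp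
    from jac_const_norm[OF this] show "norm (u *\<^sub>R B) \<le> 1/2" by simp
  qed
  have quad: "s * (u + s) * (norm B)\<^sup>2 \<le> s * (\<delta> * H\<^sup>2)" if "norm B \<le> H" "0 \<le> u" "u + s \<le> \<delta>" for u and B :: "'n endo"
    using that t(3) \<delta>0 by (simp add: mult.assoc) (intro mult_left_mono mult_mono power_mono; simp)
  note i1 = tangent_increment[OF S(1) t(1,3) sm[OF B(1) _ t(4)], folded P1_def]
  note i2 = tangent_increment[OF S(2) t(2,3) sm[OF B(2) _ t(5)], folded P2_def]
  have g1: "P1 t\<^sub>1 \<in> grassmannian d" "P2 t\<^sub>2 \<in> grassmannian d"
    unfolding P1_def P2_def using t by (auto intro!: gr S B)
  define x where "x = norm (P1 t\<^sub>1 - P2 t\<^sub>2)"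
  define y where "y = norm (B\<^sub>1 - B\<^sub>2)"
  have x0: "0 \<le> x" by (simp add: x_def)
  define q where "q = s * (\<delta> * H\<^sup>2)"
  have Hx: "norm B\<^sub>2 * x \<le> H * x" using B(2) x0 by (rule mult_right_mono)
  have a1: "norm (P1 (t\<^sub>1 + s) - P1 t\<^sub>1 - s *\<^sub>R grass_deriv (P1 t\<^sub>1) B\<^sub>1) \<le> 36 * q"
    using i1(1) quad[OF B(1) t(1,4)] t by (simp add: q_def)
  have a2: "norm (P2 (t\<^sub>2 + s) - P2 t\<^sub>2 - s *\<^sub>R grass_deriv (P2 t\<^sub>2) B\<^sub>2) \<le> 36 * q"
    using i2(1) quad[OF B(2) t(2,5)] t by (simp add: q_def)
  have a3: "norm (s *\<^sub>R grass_deriv (P1 t\<^sub>1) B\<^sub>1 - s *\<^sub>R grass_deriv (P2 t\<^sub>2) B\<^sub>2) \<le> s * (2 * y + 6 * (H * x))"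
  proof -
    have "norm (grass_deriv (P1 t\<^sub>1) B\<^sub>1 - grass_deriv (P2 t\<^sub>2) B\<^sub>2) \<le> 2 * y + 6 * (H * x)"
      using grass_deriv_diff[OF g1, of B\<^sub>1 B\<^sub>2] Hx by (simp add: x_def y_def)
    then show ?thesis using t(3) by (simp flip: scaleR_diff_right add: mult_left_mono)
  qed
  have "norm (P1 (t\<^sub>1 + s) - P2 (t\<^sub>2 + s)) \<le> x + 36 * q + 36 * q + s * (2 * y + 6 * (H * x))"
  proof -
    have tri: "norm (a + b - c + e) \<le> norm a + norm b + norm c + norm e" for a b c e :: "'n endo"
      by (intro order_trans[OF norm_triangle_ineq] order_trans[OF norm_triangle_ineq4] add_mono order_refl)
    have eq: "P1 (t\<^sub>1 + s) - P2 (t\<^sub>2 + s) = (P1 t\<^sub>1 - P2 t\<^sub>2) +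
        (P1 (t\<^sub>1 + s) - P1 t\<^sub>1 - s *\<^sub>R grass_deriv (P1 t\<^sub>1) B\<^sub>1)
        - (P2 (t\<^sub>2 + s) - P2 t\<^sub>2 - s *\<^sub>R grass_deriv (P2 t\<^sub>2) B\<^sub>2)
        + (s *\<^sub>R grass_deriv (P1 t\<^sub>1) B\<^sub>1 - s *\<^sub>R grass_deriv (P2 t\<^sub>2) B\<^sub>2)" by simp
    show ?thesis
      unfolding eq by (rule order_trans[OF tri]) (use a1 a2 a3 x_def in linarith)
  qed
  moreover define K where "K = 4 * jac_const d + 2 * real CARD('n)"
  have K0: "0 \<le> K" using K6 by (simp add: K_def)
  have b1: "\<bar>L1 (t\<^sub>1 + s) - L1 t\<^sub>1 - s * grass_trace (P1 t\<^sub>1) B\<^sub>1\<bar> \<le> K * q"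
    using i1(2) mult_left_mono[OF quad[OF B(1) t(1,4)] K0] t by (simp add: q_def L1_def K_def)
  have b2: "\<bar>L2 (t\<^sub>2 + s) - L2 t\<^sub>2 - s * grass_trace (P2 t\<^sub>2) B\<^sub>2\<bar> \<le> K * q"
    using i2(2) mult_left_mono[OF quad[OF B(2) t(2,5)] K0] t by (simp add: q_def L2_def K_def)
  have b3: "\<bar>s * grass_trace (P1 t\<^sub>1) B\<^sub>1 - s * grass_trace (P2 t\<^sub>2) B\<^sub>2\<bar> \<le> s * (real CARD('n) * (y + H * x))"
  proof -
    have "\<bar>grass_trace (P1 t\<^sub>1) B\<^sub>1 - grass_trace (P2 t\<^sub>2) B\<^sub>2\<bar> \<le> real CARD('n) * (y + norm B\<^sub>2 * x)"
      using grass_trace_diff[OF g1(1), of B\<^sub>1 "P2 t\<^sub>2" B\<^sub>2] by (simp add: x_def y_def)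
    also have "\<dots> \<le> real CARD('n) * (y + H * x)" using Hx by (intro mult_left_mono) auto
    finally show ?thesis using t(3) by (simp flip: right_diff_distrib add: abs_mult mult_left_mono)
  qed
  have "\<bar>L1 (t\<^sub>1 + s) - L2 (t\<^sub>2 + s)\<bar> \<le> \<bar>L1 t\<^sub>1 - L2 t\<^sub>2\<bar> + K * q + K * q + s * (real CARD('n) * (y + H * x))"
    using b1 b2 b3 by linarith
  moreover have "s * ((2 + real CARD('n)) * y + (6 + real CARD('n)) * H * x + 2 * c * (\<delta> * H\<^sup>2))
      = 36 * q + 36 * q + s * (2 * y + 6 * (H * x)) + K * q + K * q + s * (real CARD('n) * (y + H * x))"
    unfolding c_def q_def K_def by (simp add: algebra_simps)
  ultimately show ?thesis unfolding x_def[symmetric] y_def[symmetric] by linarith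
qed

lemma tangent_displacement:
  fixes S B :: "'n::finite endo"
  assumes S: "S \<in> grassmannian d" and B: "norm B \<le> H" and t: "0 \<le> t" "t \<le> \<delta>"
    and small: "jac_const d * (\<delta> * H) \<le> 1"
  shows "norm (tangent_map (id_blinfun + t *\<^sub>R B) S - S) + \<bar>ln (jac d (id_blinfun + t *\<^sub>R B) S)\<bar>
     \<le> (3 + jac_const d) * (\<delta> * H)"
proof -
  have K6: "6 \<le> jac_const d" by (rule jac_const_ge)
  have nB: "norm (t *\<^sub>R B) \<le> \<delta> * H" using B t by (auto intro!: mult_mono)
  have K: "jac_const d * norm (t *\<^sub>R B) \<le> jac_const d * (\<delta> * H)" using nB K6 by (intro mult_left_mono) auto
  then have K1: "jac_const d * norm (t *\<^sub>R B) \<le> 1" using small by simp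
  have half: "norm (t *\<^sub>R B) \<le> 1/2" using jac_const_norm[OF K1] by simp
  show ?thesis
    using tangent_map_expand(1)[OF S half] jac_expand(4)[OF S K1] nB K by (simp add: distrib_right)
qed

section \<open>The kernel\<close>

lemma gradient_eqI: "GDERIV f x :> D \<Longrightarrow> gradient f x = D"
  unfolding gradient_def
proof (rule the_equality)
  fix D' assume D: "GDERIV f x :> D" "GDERIV f x :> D'"
  have "(\<lambda>h. inner h D') = (\<lambda>h. inner h D)"
    using has_derivative_unique[OF D(2)[unfolded gderiv_def] D(1)[unfolded gderiv_def]] .
  then show "D' = D" using vector_eq_ldot[of D' D] by metis
qed

lemma GDERIV_gradient:
  fixes f :: "'a::euclidean_space \<Rightarrow> real"
  assumes "f differentiable (at x)"
  shows "GDERIV f x :> gradient f x"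
proof -
  let ?f = "frechet_derivative f (at x)"
  have d: "(f has_derivative ?f) (at x)" using assms by (simp add: frechet_derivative_works)
  then interpret bounded_linear ?f by (rule has_derivative_bounded_linear)
  have "?f h = inner h (\<Sum>b\<in>Basis. ?f b *\<^sub>R b)" for h
  proof -
    have "?f h = ?f (\<Sum>b\<in>Basis. inner h b *\<^sub>R b)" by (simp add: euclidean_representation)
    also have "\<dots> = (\<Sum>b\<in>Basis. inner h b * ?f b)" by (simp add: sum scaleR)
    also have "\<dots> = inner h (\<Sum>b\<in>Basis. ?f b *\<^sub>R b)" by (simp add: inner_sum_right mult.commute)
    finally show ?thesis .
  qed
  then have "?f = (\<lambda>h. inner h (\<Sum>b\<in>Basis. ?f b *\<^sub>R b))" by blast
  then have "GDERIV f x :> (\<Sum>b\<in>Basis. ?f b *\<^sub>R b)" unfolding gderiv_def using d by metis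
  then show ?thesis using gradient_eqI by metis
qed

lemma onorm_inner_le: "onorm (\<lambda>h. inner h (D::'a::real_inner)) \<le> norm D"
  by (rule onorm_bound) (auto intro: order_trans[OF Cauchy_Schwarz_ineq2] simp: mult.commute)

text \<open>Applied to the cutoff, to the Gaussian and to the kernel itself, whose Lipschitz
  constants are all read off from gradient bounds.\<close>

lemma GDERIV_lipschitz:
  fixes f :: "'a::real_inner \<Rightarrow> real"
  assumes "\<And>x. GDERIV f x :> g x" "\<And>x. norm (g x) \<le> B"
  shows "\<bar>f x - f y\<bar> \<le> B * norm (x - y)"
  using differentiable_bound[of UNIV f "\<lambda>x h. inner h (g x)" B x y] assms
    order_trans[OF onorm_inner_le assms(2)] by (simp add: gderiv_def)

lemma GDERIV_continuous_on:
  assumes "\<And>x. GDERIV f x :> g x"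
  shows "continuous_on UNIV f"
  by (rule has_derivative_continuous_on[where f' = "\<lambda>x h. inner h (g x)"]) (use assms in \<open>simp add: gderiv_def\<close>)

lemma GDERIV_taylor:
  fixes f :: "'a::real_inner \<Rightarrow> real"
  assumes f: "\<And>x. GDERIV f x :> g x" and g: "\<And>x y. norm (g x - g y) \<le> B * norm (x - y)" and B: "0 \<le> B"
  shows "\<bar>f (x + v) - f x - inner v (g x)\<bar> \<le> B * (norm v)\<^sup>2"
proof -
  define F where "F y = f y - inner y (g x)" for y
  have F: "(F has_derivative (\<lambda>h. inner h (g y - g x))) (at y within cball x (norm v))" for y
    unfolding F_def inner_diff_right
    by (intro has_derivative_diff has_derivative_at_withinI[OF f[unfolded gderiv_def]])
       (auto intro!: derivative_eq_intros)
  have "onorm (\<lambda>h. inner h (g y - g x)) \<le> B * norm v" if "y \<in> cball x (norm v)" for y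
  proof -
    have "norm (y - x) \<le> norm v" using that by (simp add: dist_norm norm_minus_commute)
    then have "B * norm (y - x) \<le> B * norm v" by (rule mult_left_mono[OF _ B])
    then show ?thesis using g[of y x] onorm_inner_le[of "g y - g x"] by linarith
  qed
  from differentiable_bound[OF convex_cball F this, of "x + v" x]
  have "\<bar>F (x + v) - F x\<bar> \<le> B * norm v * norm v" by (simp add: dist_norm)
  then show ?thesis by (simp add: F_def inner_add_left power2_eq_square mult.assoc)
qed

lemma admissible_cutoffD:
  assumes "admissible_cutoff \<psi>"
  shows "smooth \<psi>" "0 \<le> \<psi> x" "\<psi> x \<le> 1" "norm x \<le> 1/2 \<Longrightarrow> \<psi> x = 1" "norm x \<ge> 1 \<Longrightarrow> \<psi> x = 0"
    "norm (gradient \<psi> x) \<le> 3"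
  using assms unfolding admissible_cutoff_def by blast+

text \<open>A Lipschitz constant of the gradient is not part of \<open>admissible_cutoff\<close>.
  The second partial derivatives are continuous, hence bounded on the unit ball, and they vanish
  outside it. The constant depends on \<open>\<psi>\<close> alone.\<close>

lemma cutoff_gradient:
  fixes \<psi> :: "real^'n::finite \<Rightarrow> real"
  assumes \<psi>: "admissible_cutoff \<psi>"
  shows "GDERIV \<psi> x :> gradient \<psi> x"
    and "norm x > 1 \<Longrightarrow> gradient \<psi> x = 0" and "norm x < 1/2 \<Longrightarrow> gradient \<psi> x = 0"
    and "\<exists>L\<ge>0. \<forall>x y. norm (gradient \<psi> x - gradient \<psi> y) \<le> L * norm (x - y)"
proof -
  have C2: "C_k (Suc (Suc 0)) \<psi>" using admissible_cutoffD(1)[OF \<psi>] by (simp add: smooth_def)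
  have G: "GDERIV \<psi> x :> gradient \<psi> x" for x using C2 by (intro GDERIV_gradient) simp
  then show "GDERIV \<psi> x :> gradient \<psi> x" .
  have const: "gradient \<psi> x = 0" if "open U" "x \<in> U" "\<And>y. y \<in> U \<Longrightarrow> \<psi> y = c" for x U c
  proof (rule gradient_eqI)
    have "((\<lambda>y. c) has_derivative (\<lambda>h. inner h 0)) (at x)" by simp
    from has_derivative_transform_within_open[OF this that(1,2)] that(3)
    show "GDERIV \<psi> x :> 0" unfolding gderiv_def by simp
  qed
  have op: "open {x::real^'n. 1 < norm x}" "open {x::real^'n. norm x < 1/2}"
    by (intro open_Collect_less continuous_intros)+
  have out: "gradient \<psi> x = 0" if "norm x > 1" for x
    by (rule const[OF op(1), of x 0]) (use admissible_cutoffD(5)[OF \<psi>] that in auto)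
  then show "norm x > 1 \<Longrightarrow> gradient \<psi> x = 0" .
  show "norm x < 1/2 \<Longrightarrow> gradient \<psi> x = 0"
    by (rule const[OF op(2), of x 1]) (use admissible_cutoffD(4)[OF \<psi>] in auto)
  define p where "p b y = inner b (gradient \<psi> y)" for b y
  have fd: "(\<lambda>y. frechet_derivative \<psi> (at y) b) = p b" for b
    using frechet_derivative_at[OF G[unfolded gderiv_def], symmetric] by (auto simp: p_def)
  have diff: "p b differentiable (at y)" and cont: "continuous_on UNIV (\<lambda>y. frechet_derivative (p b) (at y) c)" for b c y
    using C2 unfolding C_k.simps fd by auto
  have "\<exists>B. \<forall>y\<in>cball 0 1. \<bar>frechet_derivative (p b) (at y) c\<bar> \<le> B" for b c
    using compact_continuous_image[OF continuous_on_subset[OF cont subset_UNIV], of "cball 0 1" b c]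
    by (auto dest!: compact_imp_bounded simp: bounded_iff)
  then obtain B where B: "\<And>b c y. y \<in> cball 0 1 \<Longrightarrow> \<bar>frechet_derivative (p b) (at y) c\<bar> \<le> B b c" by metis
  define L where "L b = (\<Sum>c\<in>Basis. \<bar>B b c\<bar>)" for b
  have pd: "(p b has_derivative frechet_derivative (p b) (at y)) (at y)" for b y
    using diff by (simp add: frechet_derivative_works)
  have on: "onorm (frechet_derivative (p b) (at y)) \<le> L b" for b y
  proof (rule onorm_bound)
    show "0 \<le> L b" unfolding L_def by (simp add: sum_nonneg)
    fix h :: "real^'n"
    interpret bounded_linear "frechet_derivative (p b) (at y)" by (rule has_derivative_bounded_linear[OF pd])
    have c: "\<bar>frechet_derivative (p b) (at y) c\<bar> \<le> \<bar>B b c\<bar>" for c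
    proof (cases "norm y \<le> 1")
      case False
      have "((\<lambda>y. 0) has_derivative (\<lambda>h. 0)) (at y)" by simp
      from has_derivative_transform_within_open[OF this op(1), of "p b"]
      have "(p b has_derivative (\<lambda>h. 0)) (at y)"
        using False out by (auto simp: p_def)
      then show ?thesis by (simp add: frechet_derivative_at[symmetric])
    next
      case True
      then show ?thesis using B[of y b c] by (auto intro: order_trans)
    qed
    have "frechet_derivative (p b) (at y) h = frechet_derivative (p b) (at y) (\<Sum>c\<in>Basis. inner h c *\<^sub>R c)"
      by (simp add: euclidean_representation)
    also have "\<dots> = (\<Sum>c\<in>Basis. inner h c * frechet_derivative (p b) (at y) c)" by (simp add: sum scaleR)
    also have "norm \<dots> \<le> (\<Sum>c\<in>Basis. norm h * \<bar>B b c\<bar>)"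
      unfolding real_norm_def
      by (rule order_trans[OF sum_abs], rule sum_mono) (auto simp: abs_mult Basis_le_norm intro!: mult_mono c)
    also have "\<dots> = L b * norm h" unfolding L_def by (simp add: sum_distrib_left[symmetric] mult.commute)
    finally show "norm (frechet_derivative (p b) (at y) h) \<le> L b * norm h" .
  qed
  have pl: "\<bar>p b x - p b y\<bar> \<le> L b * norm (x - y)" for b x y
    using differentiable_bound[of UNIV "p b" "\<lambda>y. frechet_derivative (p b) (at y)" "L b" x y] pd on by simp
  have "norm (gradient \<psi> x - gradient \<psi> y) \<le> (\<Sum>b\<in>Basis. L b) * norm (x - y)" for x y
  proof -
    have "norm (gradient \<psi> x - gradient \<psi> y) \<le> (\<Sum>b\<in>Basis. \<bar>inner (gradient \<psi> x - gradient \<psi> y) b\<bar>)"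
      by (rule norm_le_l1)
    also have "\<dots> \<le> (\<Sum>b\<in>Basis. L b * norm (x - y))"
      by (rule sum_mono) (use pl in \<open>auto simp: p_def inner_commute inner_diff_right\<close>)
    finally show ?thesis by (simp add: sum_distrib_right)
  qed
  moreover have "0 \<le> (\<Sum>b\<in>Basis. L b)" unfolding L_def by (simp add: sum_nonneg)
  ultimately show "\<exists>L\<ge>0. \<forall>x y. norm (gradient \<psi> x - gradient \<psi> y) \<le> L * norm (x - y)" by blast
qed

text \<open>What the later estimates use of the kernel, with \<kappa> in the role of 1/\<epsilon>.
  The essential item is \<open>gradient_le\<close>: the large part of the gradient is dominated by
  the kernel itself, so it can be cancelled by the smoothed weight in the denominator of the
  curvature. The last two bounds carry the dimension in the exponent and serve for comparing
  fields.\<close>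

locale mollifier =
  fixes \<Phi> :: "real^'n::finite \<Rightarrow> real" and C \<kappa> :: real
  assumes C1: "1 \<le> C" and \<kappa>1: "1 \<le> \<kappa>"
    and nonneg: "0 \<le> \<Phi> x" and supp: "1 < norm x \<Longrightarrow> \<Phi> x = 0"
    and integrable: "integrable lborel \<Phi>" and integral_1: "integral\<^sup>L lborel \<Phi> = 1"
    and has_gradient: "GDERIV \<Phi> x :> gradient \<Phi> x" and gradient_supp: "1 < norm x \<Longrightarrow> gradient \<Phi> x = 0"
    and gradient_le: "norm (gradient \<Phi> x) \<le> \<kappa>\<^sup>2 * \<Phi> x + C"
    and gradient_bound: "norm (gradient \<Phi> x) \<le> C * \<kappa> ^ (CARD('n) + 2)"
    and gradient_lipschitz: "norm (gradient \<Phi> x - gradient \<Phi> y) \<le> C * \<kappa> ^ (CARD('n) + 4) * norm (x - y)"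

section \<open>The Gaussian and its truncation, uniformly in \<epsilon>\<close>

definition gaussian :: "real \<Rightarrow> 'a::euclidean_space \<Rightarrow> real" where
  "gaussian \<epsilon> x = (2 * pi * \<epsilon>\<^sup>2) powr (- real DIM('a) / 2) * exp (- (norm x)\<^sup>2 / (2 * \<epsilon>\<^sup>2))"

lemma gaussian_const:
  assumes "0 < \<epsilon>"
  shows "(2 * pi * \<epsilon>\<^sup>2) powr (- real n / 2) = (2 * pi) powr (- real n / 2) * (1 / \<epsilon>) ^ n"
proof -
  have "(\<epsilon>\<^sup>2) powr (- real n / 2) = \<epsilon> powr (- real n)"
    using assms by (simp add: powr_powr flip: powr_numeral)
  also have "\<dots> = (1 / \<epsilon>) ^ n"
    using assms by (simp add: powr_minus powr_realpow power_divide field_simps)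
  finally show ?thesis using assms by (simp add: powr_mult)
qed

lemma gaussian_GDERIV:
  fixes x :: "'a::euclidean_space"
  assumes "0 < \<epsilon>"
  shows "GDERIV (gaussian \<epsilon>) x :> (- (gaussian \<epsilon> x / \<epsilon>\<^sup>2)) *\<^sub>R x"
  unfolding gderiv_def gaussian_def power2_norm_eq_inner
  using assms by (auto intro!: derivative_eq_intros ext simp: inner_commute field_simps power2_eq_square)

lemma gaussian_bounds:
  fixes x :: "'a::euclidean_space"
  assumes \<epsilon>: "0 < \<epsilon>"
  shows "0 < gaussian \<epsilon> x" "gaussian \<epsilon> x \<le> (1 / \<epsilon>) ^ DIM('a)"
    "norm ((- (gaussian \<epsilon> x / \<epsilon>\<^sup>2)) *\<^sub>R x) \<le> (1 / \<epsilon>) ^ (DIM('a) + 1)"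
proof -
  let ?a = "(2 * pi * \<epsilon>\<^sup>2) powr (- real DIM('a) / 2)"
  define k where "k = (1 / \<epsilon>) ^ DIM('a)"
  have k0: "0 \<le> k" using \<epsilon> by (simp add: k_def)
  show pos: "0 < gaussian \<epsilon> x" using \<epsilon> by (simp add: gaussian_def)
  have "(2 * pi) powr (- real DIM('a) / 2) \<le> 1 powr (- real DIM('a) / 2)"
    by (rule powr_mono2') (use pi_ge_two in auto)
  then have "(2 * pi) powr (- real DIM('a) / 2) * k \<le> 1 * k" using k0 by (intro mult_right_mono) auto
  then have a: "?a \<le> k" using gaussian_const[OF \<epsilon>, of "DIM('a)"] by (simp add: k_def)
  have a0: "0 \<le> ?a" by simp
  have "?a * exp (- (norm x)\<^sup>2 / (2 * \<epsilon>\<^sup>2)) \<le> k * 1" using a k0 by (intro mult_mono) auto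
  then show "gaussian \<epsilon> x \<le> (1 / \<epsilon>) ^ DIM('a)" by (simp add: gaussian_def k_def)
  define r where "r = norm x / \<epsilon>"
  have r2: "(norm x)\<^sup>2 / (2 * \<epsilon>\<^sup>2) = r\<^sup>2 / 2" by (simp add: r_def power_divide)
  have "r \<le> 1 + r\<^sup>2 / 2" using zero_le_power2[of "r - 1"] by (simp add: power2_diff)
  also have "\<dots> \<le> exp (r\<^sup>2 / 2)" by (rule exp_ge_add_one_self)
  finally have r: "r * exp (- (r\<^sup>2 / 2)) \<le> 1" by (simp add: exp_minus field_simps)
  have "norm ((- (gaussian \<epsilon> x / \<epsilon>\<^sup>2)) *\<^sub>R x) = gaussian \<epsilon> x / \<epsilon>\<^sup>2 * norm x" using pos by simp
  also have "\<dots> = ?a * (1 / \<epsilon>) * (r * exp (- (r\<^sup>2 / 2)))"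
    unfolding gaussian_def using r2 by (simp add: r_def power2_eq_square)
  also have "\<dots> \<le> k * (1 / \<epsilon>) * 1"
    using a a0 k0 \<epsilon> r by (intro mult_mono) (auto simp: r_def)
  also have "\<dots> = (1 / \<epsilon>) ^ (DIM('a) + 1)" by (simp add: k_def)
  finally show "norm ((- (gaussian \<epsilon> x / \<epsilon>\<^sup>2)) *\<^sub>R x) \<le> (1 / \<epsilon>) ^ (DIM('a) + 1)" .
qed

text \<open>Away from the origin the factor exp(-1/(8 \<epsilon>^2)) beats \<epsilon>^(-n). The
  explicit constant comes from exp(y) >= (1 + y/n)^n with y = 1/(8 \<epsilon>^2).\<close>

lemma gaussian_far:
  fixes x :: "'a::euclidean_space"
  assumes \<epsilon>: "0 < \<epsilon>" "\<epsilon> < 1" and x: "1/2 \<le> norm x"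
  shows "gaussian \<epsilon> x \<le> (8 * real DIM('a)) ^ DIM('a)"
proof -
  let ?n = "DIM('a)"
  define k where "k = 1 / \<epsilon>"
  have k: "1 \<le> k" using \<epsilon> by (simp add: k_def)
  have n: "0 < ?n" by simp
  have g0: "gaussian \<epsilon> x = (2 * pi) powr (- real ?n / 2) * k ^ ?n * exp (- (norm x)\<^sup>2 / (2 * \<epsilon>\<^sup>2))"
    unfolding gaussian_def gaussian_const[OF \<epsilon>(1)] k_def ..
  have "(2 * pi) powr (- real ?n / 2) \<le> 1 powr (- real ?n / 2)"
    by (rule powr_mono2') (use pi_ge_two in auto)
  then have c: "(2 * pi) powr (- real ?n / 2) * k ^ ?n \<le> 1 * k ^ ?n" using k by (intro mult_right_mono) auto
  have "(1/2)\<^sup>2 \<le> (norm x)\<^sup>2" by (rule power_mono[OF x]) simp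
  then have "k\<^sup>2 / 8 \<le> (norm x)\<^sup>2 / (2 * \<epsilon>\<^sup>2)" using \<epsilon> by (simp add: k_def field_simps)
  then have e: "exp (- (norm x)\<^sup>2 / (2 * \<epsilon>\<^sup>2)) \<le> inverse (exp (k\<^sup>2 / 8))"
    by (simp flip: exp_minus)
  have "k ^ ?n / (8 * real ?n) ^ ?n = (k / (8 * real ?n)) ^ ?n" by (simp add: power_divide)
  also have "\<dots> \<le> (1 + (k\<^sup>2 / 8) / real ?n) ^ ?n"
  proof (rule power_mono)
    have "k * 1 \<le> k * k" using k by (intro mult_left_mono) auto
    then have "k / (8 * real ?n) \<le> k\<^sup>2 / (8 * real ?n)" by (intro divide_right_mono) (auto simp: power2_eq_square)
    then show "k / (8 * real ?n) \<le> 1 + (k\<^sup>2 / 8) / real ?n" by simp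
  qed (use k in simp)
  also have "\<dots> \<le> exp (k\<^sup>2 / 8)"
    by (rule exp_ge_one_plus_x_over_n_power_n) (use n in \<open>auto intro: order_trans[of _ 0]\<close>)
  finally have kn: "k ^ ?n * inverse (exp (k\<^sup>2 / 8)) \<le> (8 * real ?n) ^ ?n"
    using n by (simp add: field_simps)
  have "gaussian \<epsilon> x \<le> 1 * k ^ ?n * inverse (exp (k\<^sup>2 / 8))"
    unfolding g0 using c e k by (intro mult_mono) auto
  with kn show ?thesis by simp
qed

lemma truncated_gaussian_eq:
  fixes \<psi> :: "real^'n::finite \<Rightarrow> real"
  shows "truncated_gaussian \<psi> \<epsilon> x = \<psi> x * gaussian \<epsilon> x"
proof -
  have "DIM(real^'n) = CARD('n)" by simp
  then show ?thesis unfolding truncated_gaussian_def gaussian_def by (simp only:)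
qed

text \<open>On the ball of radius \<epsilon>/2 the cutoff equals 1 and the exponential is at least
  exp(-1/8). The volume of that ball cancels the factor \<epsilon>^(-n), so the lower bound is free
  of \<epsilon> and the normalising factor stays bounded.\<close>

lemma truncated_gaussian_integral:
  fixes \<psi> :: "real^'n::finite \<Rightarrow> real"
  assumes \<psi>: "admissible_cutoff \<psi>" and \<epsilon>: "0 < \<epsilon>" "\<epsilon> < 1"
  shows "integrable lborel (truncated_gaussian \<psi> \<epsilon>)"
    and "(2 * pi) powr (- real CARD('n) / 2) * exp (- 1/8) * (unit_ball_vol (real CARD('n)) * (1/2) ^ CARD('n))
      \<le> integral\<^sup>L lborel (truncated_gaussian \<psi> \<epsilon>)"
proof -
  let ?T = "truncated_gaussian \<psi> \<epsilon>" and ?n = "CARD('n)"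
  have cont: "continuous_on UNIV ?T"
    unfolding truncated_gaussian_eq[abs_def]
    by (intro continuous_on_mult GDERIV_continuous_on[OF cutoff_gradient(1)[OF \<psi>]]
        GDERIV_continuous_on[OF gaussian_GDERIV[OF \<epsilon>(1)]])
  have supp: "?T x = 0" if "x \<notin> cball 0 1" for x
    using admissible_cutoffD(5)[OF \<psi>, of x] that by (simp add: truncated_gaussian_eq)
  have "integrable lborel (\<lambda>x. indicator (cball 0 1) x *\<^sub>R ?T x)"
    by (rule borel_integrable_compact) (auto intro: continuous_on_subset[OF cont])
  also have "(\<lambda>x. indicator (cball 0 1) x *\<^sub>R ?T x) = ?T" using supp by (auto simp: indicator_def fun_eq_iff)
  finally show int: "integrable lborel ?T" .
  define c where "c = (2 * pi) powr (- real ?n / 2) * (1 / \<epsilon>) ^ ?n * exp (- 1/8)"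
  have T0: "0 \<le> ?T x" for x
    using admissible_cutoffD(2)[OF \<psi>, of x] gaussian_bounds(1)[OF \<epsilon>(1), of x] by (simp add: truncated_gaussian_eq)
  have low: "c * indicator (cball 0 (\<epsilon>/2)) x \<le> ?T x" for x :: "real^'n"
  proof (cases "x \<in> cball 0 (\<epsilon>/2)")
    case True
    then have nx: "norm x \<le> \<epsilon>/2" by simp
    then have "\<psi> x = 1" using admissible_cutoffD(4)[OF \<psi>, of x] \<epsilon> by simp
    moreover have "(norm x)\<^sup>2 \<le> (\<epsilon>/2)\<^sup>2" using nx by (intro power_mono) auto
    then have "- 1/8 \<le> - (norm x)\<^sup>2 / (2 * \<epsilon>\<^sup>2)" using \<epsilon> by (simp add: field_simps)
    then have "c \<le> gaussian \<epsilon> x"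
      unfolding c_def gaussian_def using \<epsilon> gaussian_const[OF \<epsilon>(1), of ?n] by (auto intro!: mult_left_mono)
    ultimately show ?thesis using True by (simp add: truncated_gaussian_eq)
  qed (use T0 in simp)
  have ind: "integrable lborel (indicator (cball 0 (\<epsilon>/2)) :: real^'n \<Rightarrow> real)"
    by (rule integrable_real_indicator) (auto simp: emeasure_lborel_cball_finite[simplified])
  have "c * measure lborel (cball (0::real^'n) (\<epsilon>/2)) = (\<integral>x. c * indicator (cball (0::real^'n) (\<epsilon>/2)) x \<partial>lborel)"
    by simp
  also have "\<dots> \<le> integral\<^sup>L lborel ?T"
    by (rule integral_mono) (use ind int low in auto)
  also have "measure lborel (cball (0::real^'n) (\<epsilon>/2)) = unit_ball_vol (real ?n) * (\<epsilon>/2) ^ ?n"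
    using \<epsilon> by (subst measure_def, subst emeasure_cball) auto
  also have "c * (unit_ball_vol (real ?n) * (\<epsilon>/2) ^ ?n)
      = (2 * pi) powr (- real ?n / 2) * exp (- 1/8) * (unit_ball_vol (real ?n) * (1/2) ^ ?n) * ((1 / \<epsilon>) ^ ?n * \<epsilon> ^ ?n)"
    by (simp add: c_def power_divide)
  also have "(1 / \<epsilon>) ^ ?n * \<epsilon> ^ ?n = 1" using \<epsilon> by (simp flip: power_mult_distrib)
  finally show "(2 * pi) powr (- real ?n / 2) * exp (- 1/8) * (unit_ball_vol (real ?n) * (1/2) ^ ?n)
      \<le> integral\<^sup>L lborel ?T" by simp
qed

text \<open>The gradient of the kernel has a Gaussian part, which is -x/\<epsilon>^2 times the
  kernel, and a cutoff part. The support lies in the unit ball, so the first is at most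
  \<open>\<kappa>\<^sup>2\<close> times the kernel; the second is bounded uniformly in
  \<epsilon>.\<close>

lemma kernel_mollifier:
  fixes \<psi> :: "real^'n::finite \<Rightarrow> real"
  assumes \<psi>: "admissible_cutoff \<psi>"
  shows "\<exists>C. \<forall>\<epsilon>. 0 < \<epsilon> \<longrightarrow> \<epsilon> < 1 \<longrightarrow> mollifier (kernel \<psi> \<epsilon>) C (1 / \<epsilon>)"
proof -
  let ?n = "CARD('n)"
  obtain L where L: "0 \<le> L" "\<And>x y. norm (gradient \<psi> x - gradient \<psi> y) \<le> L * norm (x - y)"
    using cutoff_gradient(4)[OF \<psi>] by blast
  define c where "c = (2 * pi) powr (- real ?n / 2) * exp (- 1/8) * (unit_ball_vol (real ?n) * (1/2) ^ ?n)"
  have c0: "0 < c" by (simp add: c_def)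
  define J where "J = 1 + 1 / c"
  define F where "F = 3 * (8 * real ?n) ^ ?n"
  have F0: "0 \<le> F" by (simp add: F_def)
  have J0: "1 \<le> J" using c0 by (simp add: J_def)
  define C where "C = J * (1 + F + L + 8)"
  have C: "1 \<le> C" "J * F \<le> C" "J + J * F \<le> C" "J * (L + 8) \<le> C"
    using J0 F0 L(1) by (auto simp: C_def distrib_left intro: add_increasing2 add_increasing)
  have "mollifier (kernel \<psi> \<epsilon>) C (1 / \<epsilon>)" if \<epsilon>: "0 < \<epsilon>" "\<epsilon> < 1" for \<epsilon>
  proof -
    define \<kappa> where "\<kappa> = 1 / \<epsilon>"
    have \<kappa>: "1 \<le> \<kappa>" using \<epsilon> by (simp add: \<kappa>_def)
    let ?T = "truncated_gaussian \<psi> \<epsilon>" and ?G = "gaussian \<epsilon> :: real^'n \<Rightarrow> real"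
    define I where "I = integral\<^sup>L lborel ?T"
    note Ti = truncated_gaussian_integral[OF \<psi> \<epsilon>, folded I_def c_def]
    have I0: "0 < I" using Ti(2) c0 by simp
    have IJ: "inverse I \<le> J" using le_imp_inverse_le[OF Ti(2) c0] by (simp add: J_def inverse_eq_divide)
    have iI0: "0 \<le> inverse I" using I0 by simp
    have K: "kernel \<psi> \<epsilon> x = inverse I * (\<psi> x * ?G x)" for x
    proof -
      have "kernel \<psi> \<epsilon> x = inverse I * truncated_gaussian \<psi> \<epsilon> x" by (simp only: kernel_def I_def)
      then show ?thesis by (simp only: truncated_gaussian_eq)
    qed
    have \<psi>b: "0 \<le> \<psi> x" "\<psi> x \<le> 1" "norm (gradient \<psi> x) \<le> 3" for x
      using admissible_cutoffD(2,3,6)[OF \<psi>] by blast+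
    have \<psi>b0: "\<psi> x = 0" if "norm x > 1" for x
      using admissible_cutoffD(5)[OF \<psi>, of x] that by simp
    have G: "0 < ?G x" "?G x \<le> \<kappa> ^ ?n" for x
      using gaussian_bounds[OF \<epsilon>(1), of x] by (auto simp: \<kappa>_def)
    have K0: "0 \<le> kernel \<psi> \<epsilon> x" for x using I0 \<psi>b(1)[of x] G(1)[of x] by (simp add: K)
    define w where "w x = gradient \<psi> x - (\<psi> x * \<kappa>\<^sup>2) *\<^sub>R x" for x
    define g where "g x = (inverse I * ?G x) *\<^sub>R w x" for x
    have Kg: "GDERIV (kernel \<psi> \<epsilon>) x :> g x" for x
    proof -
      have "GDERIV (\<lambda>x. inverse I * (\<psi> x * ?G x)) x :>
          inverse I *\<^sub>R (\<psi> x *\<^sub>R ((- (?G x / \<epsilon>\<^sup>2)) *\<^sub>R x) + ?G x *\<^sub>R gradient \<psi> x) + (\<psi> x * ?G x) *\<^sub>R 0"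
        by (intro GDERIV_mult cutoff_gradient(1)[OF \<psi>] gaussian_GDERIV \<epsilon> GDERIV_const)
      also have "inverse I *\<^sub>R (\<psi> x *\<^sub>R ((- (?G x / \<epsilon>\<^sup>2)) *\<^sub>R x) + ?G x *\<^sub>R gradient \<psi> x) + (\<psi> x * ?G x) *\<^sub>R 0 = g x"
        by (simp add: g_def w_def \<kappa>_def scaleR_diff_right scaleR_add_right power_divide mult_ac)
      finally show ?thesis unfolding K[abs_def] .
    qed
    have grad: "gradient (kernel \<psi> \<epsilon>) x = g x" for x by (rule gradient_eqI[OF Kg])
    have w0: "w x = 0" if "norm x > 1" for x
      using cutoff_gradient(2)[OF \<psi> that] \<psi>b0[OF that] by (simp add: w_def)
    have \<kappa>2: "1 \<le> \<kappa>\<^sup>2" using \<kappa> by simp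
    have x\<psi>: "\<psi> x * norm x \<le> \<psi> x" for x
      using \<psi>b[of x] \<psi>b0[of x] by (cases "norm x > 1") (auto intro: mult_left_le)
    have wb: "norm (w x) \<le> 4 * \<kappa>\<^sup>2" for x
    proof -
      have "norm (w x) \<le> norm (gradient \<psi> x) + norm ((\<psi> x * \<kappa>\<^sup>2) *\<^sub>R x)" unfolding w_def by (rule norm_triangle_ineq4)
      also have "norm ((\<psi> x * \<kappa>\<^sup>2) *\<^sub>R x) = \<kappa>\<^sup>2 * (\<psi> x * norm x)" using \<psi>b(1)[of x] by simp
      also have "\<dots> \<le> \<kappa>\<^sup>2 * 1" using x\<psi>[of x] \<psi>b(2)[of x] by (intro mult_left_mono) auto
      finally show ?thesis using \<psi>b(3)[of x] \<kappa>2 by simp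
    qed
    have g0: "g x = 0" if "norm x > 1" for x using w0[OF that] by (simp add: g_def)
    have gle: "norm (g x) \<le> \<kappa>\<^sup>2 * kernel \<psi> \<epsilon> x + J * F" for x
    proof -
      \<comment> \<open>The gradient of the cutoff vanishes for |x| < 1/2, and beyond that radius
        \<open>gaussian_far\<close> bounds the Gaussian without any power of \<kappa>.\<close>
      have far: "?G x * norm (gradient \<psi> x) \<le> F"
      proof (cases "norm x < 1/2")
        case True
        then show ?thesis using cutoff_gradient(3)[OF \<psi> True] F0 by simp
      next
        case False
        then have "?G x * norm (gradient \<psi> x) \<le> (8 * real ?n) ^ ?n * 3"
          using gaussian_far[OF \<epsilon>, of x] \<psi>b(3)[of x] G(1)[of x] by (intro mult_mono) auto
        then show ?thesis by (simp add: F_def)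
      qed
      have "norm (w x) \<le> norm (gradient \<psi> x) + \<kappa>\<^sup>2 * \<psi> x"
      proof -
        have "norm (w x) \<le> norm (gradient \<psi> x) + norm ((\<psi> x * \<kappa>\<^sup>2) *\<^sub>R x)" unfolding w_def by (rule norm_triangle_ineq4)
        also have "norm ((\<psi> x * \<kappa>\<^sup>2) *\<^sub>R x) = \<kappa>\<^sup>2 * (\<psi> x * norm x)" using \<psi>b(1)[of x] by simp
        also have "\<dots> \<le> \<kappa>\<^sup>2 * \<psi> x" using x\<psi>[of x] by (intro mult_left_mono) auto
        finally show ?thesis by simp
      qed
      then have "norm (g x) \<le> (inverse I * ?G x) * (norm (gradient \<psi> x) + \<kappa>\<^sup>2 * \<psi> x)"
        unfolding g_def norm_scaleR using iI0 G(1)[of x] by (simp add: abs_mult mult_left_mono)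
      also have "\<dots> = inverse I * (?G x * norm (gradient \<psi> x)) + \<kappa>\<^sup>2 * kernel \<psi> \<epsilon> x"
        by (simp add: K algebra_simps)
      also have "inverse I * (?G x * norm (gradient \<psi> x)) \<le> J * F"
        using IJ far iI0 J0 G(1)[of x] by (intro mult_mono) auto
      finally show ?thesis by simp
    qed
    have Kb: "kernel \<psi> \<epsilon> x \<le> J * \<kappa> ^ ?n" for x
    proof -
      have "kernel \<psi> \<epsilon> x \<le> J * (1 * \<kappa> ^ ?n)"
        unfolding K using IJ \<psi>b[of x] G[of x] J0 \<kappa> by (intro mult_mono) (auto intro: less_imp_le)
      then show ?thesis by simp
    qed
    have gb: "norm (g x) \<le> C * \<kappa> ^ (?n + 2)" for x
    proof -
      have "\<kappa>\<^sup>2 * kernel \<psi> \<epsilon> x \<le> \<kappa>\<^sup>2 * (J * \<kappa> ^ ?n)" using Kb by (intro mult_left_mono) auto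
      moreover have "J * F * 1 \<le> J * F * \<kappa> ^ (?n + 2)" using J0 F0 \<kappa> by (intro mult_left_mono one_le_power) auto
      moreover have "(J + J * F) * \<kappa> ^ (?n + 2) = \<kappa>\<^sup>2 * (J * \<kappa> ^ ?n) + J * F * \<kappa> ^ (?n + 2)"
        unfolding power_add distrib_right by (simp only: mult_ac)
      ultimately have "norm (g x) \<le> (J + J * F) * \<kappa> ^ (?n + 2)" using gle[of x] by linarith
      also have "\<dots> \<le> C * \<kappa> ^ (?n + 2)" using C(3) \<kappa> by (intro mult_right_mono) auto
      finally show ?thesis .
    qed
    have \<psi>l: "\<bar>\<psi> x - \<psi> y\<bar> \<le> 3 * norm (x - y)" for x y
      by (rule GDERIV_lipschitz[OF cutoff_gradient(1)[OF \<psi>] \<psi>b(3)])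
    have Gl: "\<bar>?G x - ?G y\<bar> \<le> \<kappa> ^ (?n + 1) * norm (x - y)" for x y
      using GDERIV_lipschitz[of ?G, OF gaussian_GDERIV[OF \<epsilon>(1)] gaussian_bounds(3)[OF \<epsilon>(1)]]
      by (simp add: \<kappa>_def)
    have xl: "norm (\<psi> x *\<^sub>R x - \<psi> y *\<^sub>R y) \<le> 4 * norm (x - y)" for x y
    proof -
      \<comment> \<open>Splitting off the difference of the cutoffs leaves a factor |y|, so one
        point has to lie in the unit ball. The roles can be exchanged, and if both points are
        outside, both terms vanish.\<close>
      have *: "norm (\<psi> x *\<^sub>R x - \<psi> y *\<^sub>R y) \<le> 4 * norm (x - y)" if "norm y \<le> 1" for x y
      proof -
        have "\<psi> x *\<^sub>R x - \<psi> y *\<^sub>R y = \<psi> x *\<^sub>R (x - y) + (\<psi> x - \<psi> y) *\<^sub>R y"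
          by (simp add: scaleR_diff_right scaleR_diff_left)
        also have "norm \<dots> \<le> \<bar>\<psi> x\<bar> * norm (x - y) + \<bar>\<psi> x - \<psi> y\<bar> * norm y"
          by (rule order_trans[OF norm_triangle_ineq]) simp
        also have "\<dots> \<le> 1 * norm (x - y) + (3 * norm (x - y)) * 1"
          using \<psi>b[of x] \<psi>l[of x y] that by (intro add_mono mult_mono) auto
        finally show ?thesis by simp
      qed
      show ?thesis
      proof (cases "norm y \<le> 1")
        case False
        show ?thesis
        proof (cases "norm x \<le> 1")
          case True
          then show ?thesis using *[OF True, of y] by (simp add: norm_minus_commute)
        qed (use False \<psi>b0 in simp)
      qed (use * in simp)
    qed
    have wl: "norm (w x - w y) \<le> (L + 4) * \<kappa>\<^sup>2 * norm (x - y)" for x y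
    proof -
      have "w x - w y = (gradient \<psi> x - gradient \<psi> y) - \<kappa>\<^sup>2 *\<^sub>R (\<psi> x *\<^sub>R x - \<psi> y *\<^sub>R y)"
        by (simp add: w_def scaleR_diff_right mult.commute)
      then have "norm (w x - w y) \<le> norm (gradient \<psi> x - gradient \<psi> y) + \<kappa>\<^sup>2 * norm (\<psi> x *\<^sub>R x - \<psi> y *\<^sub>R y)"
        using norm_triangle_ineq4[of "gradient \<psi> x - gradient \<psi> y" "\<kappa>\<^sup>2 *\<^sub>R (\<psi> x *\<^sub>R x - \<psi> y *\<^sub>R y)"]
        by (simp only: norm_scaleR abs_power2)
      also have "\<dots> \<le> \<kappa>\<^sup>2 * (L * norm (x - y)) + \<kappa>\<^sup>2 * (4 * norm (x - y))"
        using \<kappa>2 L(1) xl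
        by (intro add_mono mult_left_mono order_trans[OF L(2)]) (auto intro: order_trans[OF _ mult_right_mono[of 1]])
      finally show ?thesis by (simp add: algebra_simps)
    qed
    have gl: "norm (g x - g y) \<le> C * \<kappa> ^ (?n + 4) * norm (x - y)" for x y
    proof -
      have "?G x *\<^sub>R w x - ?G y *\<^sub>R w y = ?G x *\<^sub>R (w x - w y) + (?G x - ?G y) *\<^sub>R w y"
        by (simp add: scaleR_diff_right scaleR_diff_left)
      also have "norm \<dots> \<le> \<bar>?G x\<bar> * norm (w x - w y) + \<bar>?G x - ?G y\<bar> * norm (w y)"
        by (rule order_trans[OF norm_triangle_ineq]) simp
      also have "\<dots> \<le> \<kappa> ^ ?n * ((L + 4) * \<kappa>\<^sup>2 * norm (x - y)) + (\<kappa> ^ (?n + 1) * norm (x - y)) * (4 * \<kappa>\<^sup>2)"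
        using G[of x] \<kappa> Gl wl wb by (intro add_mono mult_mono) auto
      also have "\<dots> = ((L + 4) * \<kappa> ^ (?n + 2) + 4 * \<kappa> ^ (?n + 3)) * norm (x - y)"
        by (simp add: algebra_simps power_add power2_eq_square power3_eq_cube)
      also have "\<dots> \<le> ((L + 4) * \<kappa> ^ (?n + 4) + 4 * \<kappa> ^ (?n + 4)) * norm (x - y)"
        using L(1) \<kappa> by (intro mult_right_mono add_mono mult_left_mono power_increasing) auto
      finally have d: "norm (?G x *\<^sub>R w x - ?G y *\<^sub>R w y) \<le> (L + 8) * \<kappa> ^ (?n + 4) * norm (x - y)"
        by (simp add: algebra_simps)
      have "g x - g y = inverse I *\<^sub>R (?G x *\<^sub>R w x - ?G y *\<^sub>R w y)"
        by (simp add: g_def scaleR_diff_right)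
      then have "norm (g x - g y) = inverse I * norm (?G x *\<^sub>R w x - ?G y *\<^sub>R w y)" using iI0 by simp
      also have "\<dots> \<le> J * ((L + 8) * \<kappa> ^ (?n + 4) * norm (x - y))"
        using IJ d J0 by (intro mult_mono) auto
      also have "\<dots> = J * (L + 8) * (\<kappa> ^ (?n + 4) * norm (x - y))" by simp
      also have "\<dots> \<le> C * (\<kappa> ^ (?n + 4) * norm (x - y))" using C(4) \<kappa> by (intro mult_right_mono) auto
      finally show ?thesis by (simp add: mult.assoc)
    qed
    have Ki: "integrable lborel (kernel \<psi> \<epsilon>)" "integral\<^sup>L lborel (kernel \<psi> \<epsilon>) = 1"
      unfolding kernel_def[abs_def] I_def[symmetric] using Ti(1) I0 by (auto simp: I_def[symmetric])
    have Ks: "kernel \<psi> \<epsilon> x = 0" if "1 < norm x" for x by (simp add: K \<psi>b0[OF that])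
    have gC: "norm (g x) \<le> \<kappa>\<^sup>2 * kernel \<psi> \<epsilon> x + C" for x using gle[of x] C(2) by linarith
    show ?thesis
      unfolding \<kappa>_def[symmetric] mollifier_def grad
      using C(1) \<kappa> K0 Ks Ki Kg g0 gC gb gl by blast
  qed
  then show ?thesis by (intro exI allI impI)
qed

section \<open>Convolution with the kernel\<close>

lemma lborel_reflect:
  fixes x :: "'a::euclidean_space"
  shows "distr lborel borel (\<lambda>y. x - y) = lborel"
proof -
  have "(\<lambda>y. x + (- 1) *\<^sub>R y) = (\<lambda>y. x - y)" by auto
  with lborel_affine[of "-1" x, symmetric] show ?thesis by (simp add: density_1)
qed

lemma integral_reflect:
  fixes f :: "'a::euclidean_space \<Rightarrow> real"
  assumes "f \<in> borel_measurable borel"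
  shows "(\<integral>y. f (x - y) \<partial>lborel) = integral\<^sup>L lborel f"
  using integral_distr[of "\<lambda>y. x - y" lborel borel f] assms by (simp add: lborel_reflect)

lemma integrable_reflect:
  fixes f :: "'a::euclidean_space \<Rightarrow> real"
  assumes "integrable lborel f"
  shows "integrable lborel (\<lambda>y. f (x - y))"
  using integrable_distr_eq[of "\<lambda>y. x - y" lborel borel f] assms by (simp add: lborel_reflect)

lemma content_cball_shift:
  "measure lborel (cball (c::'a::euclidean_space) r) = measure lborel (cball (0::'a) r)"
proof (cases "0 \<le> r")
  case True
  then show ?thesis by (simp add: measure_def emeasure_cball)
qed simp

lemma content_unit_cball: "measure lborel (cball (c::real^'n::finite) 1) = unit_ball_vol (real CARD('n))"
  by (simp add: measure_def emeasure_cball)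

lemma integrable_indicator_cball: "integrable lborel (indicator (cball c r) :: 'a::euclidean_space \<Rightarrow> real)"
  by (rule integrable_real_indicator) (use emeasure_lborel_cball_finite[of c r] in auto)

context mollifier
begin

lemma continuous: "continuous_on UNIV \<Phi>"
  by (rule GDERIV_continuous_on[OF has_gradient])

lemma C0: "0 \<le> C" and \<kappa>0: "0 \<le> \<kappa>" using C1 \<kappa>1 by auto

lemma gradient_continuous: "continuous_on UNIV (gradient \<Phi>)"
proof -
  have "(C * \<kappa> ^ (CARD('n) + 4))-lipschitz_on UNIV (gradient \<Phi>)"
    using gradient_lipschitz C0 \<kappa>0 by (auto simp: lipschitz_on_def dist_norm)
  then show ?thesis by (rule lipschitz_on_continuous_on)
qed

lemma lipschitz: "\<bar>\<Phi> x - \<Phi> y\<bar> \<le> C * \<kappa> ^ (CARD('n) + 2) * norm (x - y)"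
  by (rule GDERIV_lipschitz[OF has_gradient gradient_bound])

text \<open>A point of norm 2 is a zero of the kernel at distance at most 3 from every point of the
  unit ball, so the Lipschitz bound gives the supremum bound with the factor 3.\<close>

lemma bound: "\<Phi> x \<le> 3 * C * \<kappa> ^ (CARD('n) + 2)"
proof (cases "norm x \<le> 1")
  case True
  obtain b :: "real^'n" where "b \<in> Basis" using nonempty_Basis by blast
  then have b: "norm (2 *\<^sub>R b) = 2" by simp
  then have "\<Phi> (2 *\<^sub>R b) = 0" by (intro supp) simp
  moreover have "norm (x - 2 *\<^sub>R b) \<le> 3" using norm_triangle_ineq4[of x "2 *\<^sub>R b"] True b by simp
  then have "C * \<kappa> ^ (CARD('n) + 2) * norm (x - 2 *\<^sub>R b) \<le> C * \<kappa> ^ (CARD('n) + 2) * 3"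
    using C0 \<kappa>0 by (intro mult_left_mono) auto
  ultimately show ?thesis using lipschitz[of x "2 *\<^sub>R b"] by simp
qed (use supp C0 \<kappa>0 in simp)

definition conv :: "(real^'n \<Rightarrow> real^'n) \<Rightarrow> real^'n \<Rightarrow> real^'n" where
  "conv w x = (\<integral>y. \<Phi> (x - y) *\<^sub>R w y \<partial>lborel)"

text \<open>The derivative of \<open>conv w\<close>, placed on the kernel so that \<open>w\<close>
  need only be continuous. \<open>Blinfun\<close> acquires its meaning in
  \<open>dconv_apply\<close>, where integrability makes the map linear.\<close>

definition dconv :: "(real^'n \<Rightarrow> real^'n) \<Rightarrow> real^'n \<Rightarrow> 'n endo" where
  "dconv w x = Blinfun (\<lambda>v. \<integral>y. inner v (gradient \<Phi> (x - y)) *\<^sub>R w y \<partial>lborel)"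

lemma compact_support_integrable:
  fixes f :: "real^'n \<Rightarrow> real" and w :: "real^'n \<Rightarrow> 'c::euclidean_space"
  assumes "continuous_on UNIV f" "continuous_on UNIV w" "\<And>y. r < norm (x - y) \<Longrightarrow> f y = 0"
  shows "integrable lborel (\<lambda>y. f y *\<^sub>R w y)"
proof -
  have "integrable lborel (\<lambda>y. indicator (cball x r) y *\<^sub>R (f y *\<^sub>R w y))"
    by (rule borel_integrable_compact) (auto intro: continuous_on_scaleR continuous_on_subset[OF assms(1)] continuous_on_subset[OF assms(2)])
  also have "(\<lambda>y. indicator (cball x r) y *\<^sub>R (f y *\<^sub>R w y)) = (\<lambda>y. f y *\<^sub>R w y)"
  proof
    fix y show "indicator (cball x r) y *\<^sub>R (f y *\<^sub>R w y) = f y *\<^sub>R w y"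
      using assms(3)[of y] by (cases "norm (x - y) \<le> r") (auto simp: dist_norm)
  qed
  finally show ?thesis .
qed

lemma conv_integrable:
  fixes w :: "real^'n \<Rightarrow> real^'n"
  assumes "continuous_on UNIV w"
  shows "integrable lborel (\<lambda>y. \<Phi> (x - y) *\<^sub>R w y)"
  by (rule compact_support_integrable[OF _ assms, of _ 1 x])
     (auto intro!: continuous_on_compose2[OF continuous] continuous_intros supp)

lemma gradient_integrable:
  fixes w :: "real^'n \<Rightarrow> real^'n"
  assumes "continuous_on UNIV w"
  shows "integrable lborel (\<lambda>y. inner v (gradient \<Phi> (x - y)) *\<^sub>R w y)"
  by (rule compact_support_integrable[OF _ assms, of _ 1 x])
     (auto intro!: continuous_on_compose2[OF gradient_continuous] continuous_intros simp: gradient_supp)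

lemma norm_integral_le:
  fixes f :: "real^'n \<Rightarrow> 'c::euclidean_space"
  assumes "integrable lborel f" "integrable lborel g" "\<And>y. norm (f y) \<le> g y"
  shows "norm (integral\<^sup>L lborel f) \<le> integral\<^sup>L lborel g"
  using assms by (intro order_trans[OF integral_norm_bound] integral_mono) auto

lemma reflected_integral: "integrable lborel (\<lambda>y. \<Phi> (x - y))" "(\<integral>y. \<Phi> (x - y) \<partial>lborel) = 1"
  using integrable_reflect[OF integrable] integral_reflect[of \<Phi> x] integral_1 continuous
  by (auto simp: borel_measurable_continuous_onI)

lemma norm_conv:
  fixes w :: "real^'n \<Rightarrow> real^'n"
  assumes "continuous_on UNIV w" "\<And>y. norm (w y) \<le> B"
  shows "norm (conv w x) \<le> B"
proof -
  have "norm (conv w x) \<le> (\<integral>y. \<Phi> (x - y) * B \<partial>lborel)"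
    unfolding conv_def
    by (rule norm_integral_le[OF conv_integrable[OF assms(1)]])
      (use reflected_integral(1) nonneg assms(2) in \<open>auto intro!: mult_left_mono\<close>)
  then show ?thesis by (simp add: reflected_integral(2))
qed

lemma dconv_apply:
  fixes w :: "real^'n \<Rightarrow> real^'n"
  assumes "continuous_on UNIV w"
  shows "blinfun_apply (dconv w x) v = (\<integral>y. inner v (gradient \<Phi> (x - y)) *\<^sub>R w y \<partial>lborel)"
proof -
  have "linear (\<lambda>v. \<integral>y. inner v (gradient \<Phi> (x - y)) *\<^sub>R w y \<partial>lborel)"
    using gradient_integrable[OF assms]
    by (intro linearI) (simp_all add: inner_add_left scaleR_add_left flip: scaleR_scaleR)
  then show ?thesis unfolding dconv_def by (simp add: linear_conv_bounded_linear bounded_linear_Blinfun_apply)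
qed

lemma gradient_le': "norm (gradient \<Phi> z) \<le> \<kappa>\<^sup>2 * \<Phi> z + C * indicator (cball 0 1) z"
  using gradient_le[of z] gradient_supp[of z] supp[of z] by (cases "norm z \<le> 1") auto

text \<open>The gradient is integrated through \<open>gradient_le\<close>:
  \<open>\<kappa>\<^sup>2\<close> times an integral equal to 1, plus C times the volume of the unit
  ball. Its supremum bound would bring the dimension into the exponent of the field size.\<close>

lemma norm_dconv:
  fixes w :: "real^'n \<Rightarrow> real^'n"
  assumes w: "continuous_on UNIV w" and B: "\<And>y. norm (w y) \<le> B"
  shows "norm (dconv w x) \<le> (\<kappa>\<^sup>2 + C * unit_ball_vol (real CARD('n))) * B"
proof (rule norm_blinfun_bound)
  have B0: "0 \<le> B" using B[of 0] norm_ge_zero order_trans by blast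
  show "0 \<le> (\<kappa>\<^sup>2 + C * unit_ball_vol (real CARD('n))) * B" using B0 C0 by simp
  fix v :: "real^'n"
  let ?g = "\<lambda>y. (norm v * B) * (\<kappa>\<^sup>2 * \<Phi> (x - y) + C * indicator (cball x 1) y)"
  have ind: "indicator (cball 0 1) (x - y) = (indicator (cball x 1) y :: real)" for y
    by (simp add: indicator_def dist_norm norm_minus_commute)
  have "norm (inner v (gradient \<Phi> (x - y)) *\<^sub>R w y) \<le> ?g y" for y
  proof -
    have "norm (inner v (gradient \<Phi> (x - y)) *\<^sub>R w y) \<le> (norm v * norm (gradient \<Phi> (x - y))) * norm (w y)"
      by (simp add: Cauchy_Schwarz_ineq2 mult_right_mono)
    also have "\<dots> \<le> (norm v * (\<kappa>\<^sup>2 * \<Phi> (x - y) + C * indicator (cball x 1) y)) * B"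
      using gradient_le'[of "x - y"] B nonneg C0 unfolding ind
      by (intro mult_mono) auto
    finally show ?thesis by (simp add: mult_ac)
  qed
  then have "norm (dconv w x v) \<le> (\<integral>y. ?g y \<partial>lborel)"
    unfolding dconv_apply[OF w]
    by (intro norm_integral_le gradient_integrable[OF w])
       (use reflected_integral(1)[of x] integrable_indicator_cball[of x 1] in \<open>auto intro!: Bochner_Integration.integrable_add integrable_mult_right\<close>)
  also have "(\<integral>y. ?g y \<partial>lborel) = (norm v * B) * (\<kappa>\<^sup>2 * 1 + C * unit_ball_vol (real CARD('n)))"
    using reflected_integral[of x] integrable_indicator_cball[of x 1]
    by (simp add: content_unit_cball[of x])
  finally show "norm (dconv w x v) \<le> (\<kappa>\<^sup>2 + C * unit_ball_vol (real CARD('n))) * B * norm v" by (simp add: mult_ac)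
qed

text \<open>The two gradients vanish off the unit balls around \<open>x\<close> and
  \<open>x'\<close>; the total volume of these balls is the factor 2 in front of the volume of the
  unit ball.\<close>

lemma dconv_lipschitz:
  fixes w :: "real^'n \<Rightarrow> real^'n"
  assumes w: "continuous_on UNIV w" and B: "\<And>y. norm (w y) \<le> B"
  shows "norm (dconv w x - dconv w x') \<le> 2 * unit_ball_vol (real CARD('n)) * C * B * \<kappa> ^ (CARD('n) + 4) * norm (x - x')"
proof (rule norm_blinfun_bound)
  let ?L = "C * \<kappa> ^ (CARD('n) + 4)"
  have L0: "0 \<le> ?L" using C0 \<kappa>0 by simp
  have B0: "0 \<le> B" using B[of 0] norm_ge_zero order_trans by blast
  show "0 \<le> 2 * unit_ball_vol (real CARD('n)) * C * B * \<kappa> ^ (CARD('n) + 4) * norm (x - x')" using B0 C0 \<kappa>0 by simp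
  fix v :: "real^'n"
  let ?f = "\<lambda>y. inner v (gradient \<Phi> (x - y)) *\<^sub>R w y - inner v (gradient \<Phi> (x' - y)) *\<^sub>R w y"
  let ?g = "\<lambda>y. (norm v * (?L * norm (x - x')) * B) * (indicator (cball x 1) y + indicator (cball x' 1) y)"
  have "norm (?f y) \<le> ?g y" for y
  proof (cases "y \<in> cball x 1 \<union> cball x' 1")
    case True
    have "?f y = inner v (gradient \<Phi> (x - y) - gradient \<Phi> (x' - y)) *\<^sub>R w y"
      by (simp add: inner_diff_right scaleR_diff_left)
    also have "norm \<dots> \<le> (norm v * norm (gradient \<Phi> (x - y) - gradient \<Phi> (x' - y))) * norm (w y)"
      by (simp add: Cauchy_Schwarz_ineq2 mult_right_mono)
    also have "\<dots> \<le> (norm v * (?L * norm (x - x'))) * B"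
      using gradient_lipschitz[of "x - y" "x' - y"] B L0 by (intro mult_mono) auto
    also have "\<dots> \<le> (norm v * (?L * norm (x - x')) * B) * (indicator (cball x 1) y + indicator (cball x' 1) y)"
    proof -
      have "1 \<le> (indicator (cball x 1) y + indicator (cball x' 1) y :: real)" using True by (auto simp: indicator_def)
      from mult_left_mono[OF this, of "norm v * (?L * norm (x - x')) * B"] show ?thesis
        using L0 B0 by simp
    qed
    finally show ?thesis .
  next
    case False
    then have "norm (x - y) > 1" "norm (x' - y) > 1" by (auto simp: dist_norm)
    then show ?thesis using False by (simp add: gradient_supp)
  qed
  then have "norm (\<integral>y. ?f y \<partial>lborel) \<le> (\<integral>y. ?g y \<partial>lborel)"
    by (intro norm_integral_le)
       (use gradient_integrable[OF w] integrable_indicator_cball in \<open>auto intro!: Bochner_Integration.integrable_diff Bochner_Integration.integrable_add integrable_mult_right\<close>)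
  also have "(\<integral>y. ?f y \<partial>lborel) = (dconv w x - dconv w x') v"
    unfolding blinfun.diff_left dconv_apply[OF w]
    by (rule Bochner_Integration.integral_diff) (intro gradient_integrable[OF w])+
  also have "(\<integral>y. ?g y \<partial>lborel) = (norm v * (?L * norm (x - x')) * B) * (unit_ball_vol (real CARD('n)) + unit_ball_vol (real CARD('n)))"
    using integrable_indicator_cball[of x 1] integrable_indicator_cball[of x' 1]
    by (simp add: content_unit_cball[of x] content_unit_cball[of x'])
  finally show "norm ((dconv w x - dconv w x') v) \<le> 2 * unit_ball_vol (real CARD('n)) * C * B * \<kappa> ^ (CARD('n) + 4) * norm (x - x') * norm v"
    by (simp add: mult_ac)
qed

text \<open>The Taylor remainder of the kernel is quadratic uniformly in y. Its support lies in the
  ball of radius 2 around \<open>x\<close>, since only displacements of length at most 1 are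
  considered, so the remainder may be integrated.\<close>

lemma conv_has_derivative:
  fixes w :: "real^'n \<Rightarrow> real^'n"
  assumes w: "continuous_on UNIV w" and B: "\<And>y. norm (w y) \<le> B"
  shows "(conv w has_derivative blinfun_apply (dconv w x)) (at x)"
proof (rule has_derivativeI_sandwich)
  let ?L = "C * \<kappa> ^ (CARD('n) + 4)"
  let ?K = "?L * B * measure lborel (cball (0::real^'n) 2)"
  have L0: "0 \<le> ?L" using C0 \<kappa>0 by simp
  have B0: "0 \<le> B" using B[of 0] norm_ge_zero order_trans by blast
  show "(0::real) < 1" by simp
  show "bounded_linear (blinfun_apply (dconv w x))" by (rule blinfun.bounded_linear_right)
  show "((\<lambda>z. ?K * norm (z - x)) \<longlongrightarrow> 0) (at x)"
    by (rule tendsto_eq_intros refl | simp)+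
  fix z assume z: "z \<noteq> x" "dist z x < 1"
  define v where "v = z - x"
  have v: "norm v \<le> 1" "v \<noteq> 0" "z = x + v" using z by (auto simp: v_def dist_norm)
  let ?f = "\<lambda>y. \<Phi> (z - y) *\<^sub>R w y - \<Phi> (x - y) *\<^sub>R w y - inner v (gradient \<Phi> (x - y)) *\<^sub>R w y"
  let ?g = "\<lambda>y. (?L * (norm v)\<^sup>2 * B) * indicator (cball x 2) y"
  have "norm (?f y) \<le> ?g y" for y
  proof (cases "y \<in> cball x 2")
    case True
    have "?f y = (\<Phi> (x - y + v) - \<Phi> (x - y) - inner v (gradient \<Phi> (x - y))) *\<^sub>R w y"
      unfolding v(3) by (simp add: scaleR_diff_left add_diff_eq diff_add_eq)
    also have "norm \<dots> \<le> (?L * (norm v)\<^sup>2) * B"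
      unfolding norm_scaleR real_norm_def
      by (intro mult_mono B GDERIV_taylor[OF has_gradient gradient_lipschitz L0]) (use L0 in auto)
    finally show ?thesis using True by simp
  next
    case False
    then have d: "norm (x - y) > 2" by (simp add: dist_norm)
    have "norm (x - y) \<le> norm (z - y) + norm v"
      using norm_triangle_ineq4[of "z - y" v] by (simp add: v_def)
    then have "norm (z - y) > 1" "norm (x - y) > 1" using d v by auto
    then show ?thesis using False by (simp add: gradient_supp supp)
  qed
  then have "norm (\<integral>y. ?f y \<partial>lborel) \<le> (\<integral>y. ?g y \<partial>lborel)"
    by (intro norm_integral_le)
       (use gradient_integrable[OF w] conv_integrable[OF w] integrable_indicator_cball[of x 2] in \<open>auto intro!: Bochner_Integration.integrable_diff integrable_mult_right\<close>)
  also have "(\<integral>y. ?f y \<partial>lborel) = conv w z - conv w x - dconv w x (z - x)"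
    unfolding conv_def dconv_apply[OF w] v_def[symmetric]
    using gradient_integrable[OF w] conv_integrable[OF w] by simp
  also have "(\<integral>y. ?g y \<partial>lborel) = ?K * norm v * norm v"
    using integrable_indicator_cball[of x 2] by (simp add: content_cball_shift[of x 2] power2_eq_square)
  finally show "norm (conv w z - conv w x - dconv w x (z - x)) / norm (z - x) \<le> ?K * norm (z - x)"
    using v(2) unfolding v_def[symmetric] by (simp add: pos_divide_le_eq)
qed

lemma conv_diff:
  assumes "continuous_on UNIV w" "continuous_on UNIV w'"
  shows "conv w x - conv w' x = conv (\<lambda>y. w y - w' y) x"
    "dconv w x - dconv w' x = dconv (\<lambda>y. w y - w' y) x"
proof -
  show "conv w x - conv w' x = conv (\<lambda>y. w y - w' y) x"
    unfolding conv_def scaleR_diff_right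
    by (rule Bochner_Integration.integral_diff[symmetric]) (intro conv_integrable assms)+
  have "continuous_on UNIV (\<lambda>y. w y - w' y)" using assms by (intro continuous_intros)
  then show "dconv w x - dconv w' x = dconv (\<lambda>y. w y - w' y) x"
    by (intro blinfun_eqI) (simp add: blinfun.diff_left dconv_apply assms scaleR_diff_right gradient_integrable)
qed

end

section \<open>Approximate mean curvature\<close>

definition mass_le :: "nat \<Rightarrow> real \<Rightarrow> ((real^'n::finite) \<times> 'n endo) measure \<Rightarrow> bool" where
  "mass_le d m V \<longleftrightarrow> sets V = sets (bundle_algebra d) \<and> emeasure V (space V) \<le> ennreal m"

lemma bundle_space: "sets V = sets (bundle_algebra d) \<Longrightarrow> space V = grass_bundle d"
  using sets_eq_imp_space_eq[of V "bundle_algebra d"] by (simp add: bundle_algebra_def space_restrict_space)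

lemma bundle_measurable:
  assumes "sets V = sets (bundle_algebra d)" "continuous_on (grass_bundle d) f"
  shows "f \<in> borel_measurable V"
  using borel_measurable_continuous_on_restrict[OF assms(2)]
  unfolding measurable_cong_sets[OF assms(1) refl] by (simp add: bundle_algebra_def)

lemma mass_leD:
  assumes "mass_le d m V" "0 \<le> m"
  shows "sets V = sets (bundle_algebra d)" "finite_measure V" "measure V (space V) \<le> m"
proof -
  show s: "sets V = sets (bundle_algebra d)" using assms by (simp add: mass_le_def)
  have e: "emeasure V (space V) \<le> ennreal m" using assms by (simp add: mass_le_def)
  then show f: "finite_measure V" by (intro finite_measureI) (auto simp: top_unique)
  show "measure V (space V) \<le> m"
    using e assms(2) finite_measure.emeasure_eq_measure[OF f, of "space V"] by simp
qed

lemma bundle_integral_bound: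
  fixes f :: "_ \<Rightarrow> 'c::euclidean_space"
  assumes V: "mass_le d m V" and m: "0 \<le> m" and f: "continuous_on (grass_bundle d) f"
    and B: "\<And>x S. S \<in> grassmannian d \<Longrightarrow> norm (f (x, S)) \<le> B" and B0: "0 \<le> B"
  shows "integrable V f" "norm (integral\<^sup>L V f) \<le> B * m"
proof -
  interpret finite_measure V by (rule mass_leD[OF V m])
  have sp: "norm (f p) \<le> B" if "p \<in> space V" for p
    using that B[of "snd p" "fst p"] unfolding bundle_space[OF mass_leD(1)[OF V m]] grass_bundle_def by (simp add: mem_Times_iff)
  show i: "integrable V f"
    by (rule integrable_const_bound[where B=B]) (use sp bundle_measurable[OF mass_leD(1)[OF V m] f] in auto)
  have "norm (integral\<^sup>L V f) \<le> (\<integral>p. B \<partial>V)"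
    by (rule order_trans[OF integral_norm_bound], rule integral_mono) (use i sp in auto)
  also have "\<dots> = B * measure V (space V)" by simp
  also have "\<dots> \<le> B * m" using mass_leD(3)[OF V m] B0 by (rule mult_left_mono)
  finally show "norm (integral\<^sup>L V f) \<le> B * m" .
qed

definition field_bounds :: "real \<Rightarrow> real \<Rightarrow> (real^'n::finite \<Rightarrow> real^'n) \<Rightarrow> (real^'n \<Rightarrow> 'n endo) \<Rightarrow> bool" where
  "field_bounds H L h B \<longleftrightarrow> (\<forall>x. (h has_derivative blinfun_apply (B x)) (at x)) \<and>
    (\<forall>x. norm (h x) \<le> H \<and> norm (B x) \<le> H) \<and> (\<forall>x y. norm (B x - B y) \<le> L * norm (x - y))"

definition curvature_deriv :: "(real^'n::finite \<Rightarrow> real) \<Rightarrow> real \<Rightarrow>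
    ((real^'n) \<times> 'n endo) measure \<Rightarrow> real^'n \<Rightarrow> 'n endo" where
  "curvature_deriv \<psi> \<epsilon> V = mollifier.dconv (kernel \<psi> \<epsilon>) (curvature_quotient \<psi> \<epsilon> V)"

text \<open>The numerator \<open>b\<close> enters the last term only through the quotient
  \<open>b /\<^sub>R Q\<close>. For the curvature this quotient is bounded by a multiple of
  \<open>\<kappa>\<^sup>2\<close>, far below the available bound on the numerator.\<close>

lemma quotient_diff:
  fixes a b :: "'a::real_normed_vector"
  assumes "0 < \<epsilon>" "\<epsilon> \<le> P" "\<epsilon> \<le> Q"
  shows "norm (a /\<^sub>R P - b /\<^sub>R Q) \<le> norm (a - b) / \<epsilon> + \<bar>P - Q\<bar> / \<epsilon> * norm (b /\<^sub>R Q)"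
proof -
  have P: "0 < P" "0 < Q" using assms by linarith+
  have "(Q - P) / P * inverse Q = inverse P - inverse Q" using P by (simp add: field_simps)
  then have "a /\<^sub>R P - b /\<^sub>R Q = (a - b) /\<^sub>R P + ((Q - P) / P) *\<^sub>R (b /\<^sub>R Q)"
    by (simp add: scaleR_diff_right scaleR_diff_left)
  also have "norm \<dots> \<le> norm ((a - b) /\<^sub>R P) + norm (((Q - P) / P) *\<^sub>R (b /\<^sub>R Q))" by (rule norm_triangle_ineq)
  also have "\<dots> = norm (a - b) / P + \<bar>P - Q\<bar> / P * norm (b /\<^sub>R Q)"
  proof -
    have "\<bar>(Q - P) / P\<bar> = \<bar>P - Q\<bar> / P" using P by (simp only: abs_divide abs_minus_commute abs_of_pos)
    moreover have "norm ((a - b) /\<^sub>R P) = norm (a - b) / P" using P by (simp add: divide_inverse mult.commute)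
    ultimately show ?thesis by (simp only: norm_scaleR[of "(Q - P) / P"])
  qed
  also have "\<dots> \<le> norm (a - b) / \<epsilon> + \<bar>P - Q\<bar> / \<epsilon> * norm (b /\<^sub>R Q)"
    using assms P by (intro add_mono mult_right_mono divide_left_mono mult_pos_pos) auto
  finally show ?thesis .
qed

locale curvature = mollifier "kernel \<psi> \<epsilon>" C \<kappa>
  for \<psi> :: "real^'n::finite \<Rightarrow> real" and \<epsilon> C \<kappa> :: real +
  fixes d :: nat and m :: real and V :: "((real^'n) \<times> 'n endo) measure"
  assumes eps: "0 < \<epsilon>" and \<kappa>_eq: "\<kappa> = 1 / \<epsilon>" and m1: "1 \<le> m" and V: "mass_le d m V"
begin

lemma m0: "0 \<le> m" using m1 by simp

lemmas sets_V = mass_leD(1)[OF V m0]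

lemma continuous_bundle:
  "continuous_on A (\<lambda>p. kernel \<psi> \<epsilon> (fst p - y))"
  "continuous_on A (\<lambda>p. blinfun_apply (snd p) (gradient (kernel \<psi> \<epsilon>) (fst p - y)))"
  by (intro continuous_on_compose2[OF continuous] continuous_on_compose2[OF gradient_continuous]
      blinfun.continuous_on continuous_intros subset_UNIV)+

lemma smoothed_weight_eq: "smoothed_weight \<psi> \<epsilon> V y = (\<integral>p. kernel \<psi> \<epsilon> (fst p - y) \<partial>V)"
  unfolding smoothed_weight_def weight_def
  by (rule integral_distr)
    (auto intro!: bundle_measurable[OF sets_V] borel_measurable_continuous_onI
      continuous_on_compose2[OF continuous] continuous_intros)

lemma smoothed_variation_eq:
  "smoothed_variation \<psi> \<epsilon> V y = (\<integral>p. blinfun_apply (snd p) (gradient (kernel \<psi> \<epsilon>) (fst p - y)) \<partial>V)"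
  by (simp add: smoothed_variation_def case_prod_unfold)

lemma bound0: "0 \<le> 3 * C * \<kappa> ^ (CARD('n) + 2)" "0 \<le> C * \<kappa> ^ (CARD('n) + 2)" "0 \<le> C * \<kappa> ^ (CARD('n) + 4)"
  using C0 \<kappa>0 by auto

lemma grass_apply_le: "S \<in> grassmannian d \<Longrightarrow> norm v \<le> b \<Longrightarrow> norm (blinfun_apply S v) \<le> b"
  using grassmannian_contract(1) order_trans by blast

lemma integrable_weight: "integrable V (\<lambda>p. kernel \<psi> \<epsilon> (fst p - y))"
  by (rule bundle_integral_bound(1)[OF V m0 continuous_bundle(1) _ bound0(1)]) (use bound nonneg in auto)

lemma integrable_variation: "integrable V (\<lambda>p. blinfun_apply (snd p) (gradient (kernel \<psi> \<epsilon>) (fst p - y)))"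
  by (rule bundle_integral_bound(1)[OF V m0 continuous_bundle(2) _ bound0(2)]) (use grass_apply_le gradient_bound in auto)

lemma smoothed_weight_nonneg: "0 \<le> smoothed_weight \<psi> \<epsilon> V y"
  unfolding smoothed_weight_eq by (rule integral_nonneg_AE) (simp add: nonneg)

lemma smoothed_weight_lipschitz:
  "\<bar>smoothed_weight \<psi> \<epsilon> V y - smoothed_weight \<psi> \<epsilon> V z\<bar> \<le> C * \<kappa> ^ (CARD('n) + 2) * m * norm (y - z)"
proof -
  have "norm (\<integral>p. kernel \<psi> \<epsilon> (fst p - y) - kernel \<psi> \<epsilon> (fst p - z) \<partial>V) \<le> (C * \<kappa> ^ (CARD('n) + 2) * norm (y - z)) * m"
  proof (rule bundle_integral_bound(2)[OF V m0])
    fix x and S :: "'n endo"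
    show "norm (kernel \<psi> \<epsilon> (fst (x, S) - y) - kernel \<psi> \<epsilon> (fst (x, S) - z)) \<le> C * \<kappa> ^ (CARD('n) + 2) * norm (y - z)"
      using lipschitz[of "x - y" "x - z"] by (simp add: norm_minus_commute)
    show "0 \<le> C * \<kappa> ^ (CARD('n) + 2) * norm (y - z)" using bound0(2) by (rule mult_nonneg_nonneg) simp
  qed (intro continuous_on_diff continuous_bundle)
  moreover have "(\<integral>p. kernel \<psi> \<epsilon> (fst p - y) - kernel \<psi> \<epsilon> (fst p - z) \<partial>V) =
      smoothed_weight \<psi> \<epsilon> V y - smoothed_weight \<psi> \<epsilon> V z"
    unfolding smoothed_weight_eq by (rule Bochner_Integration.integral_diff) (rule integrable_weight)+
  ultimately show ?thesis by (simp only: real_norm_def mult_ac)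
qed

lemma smoothed_variation_lipschitz:
  "norm (smoothed_variation \<psi> \<epsilon> V y - smoothed_variation \<psi> \<epsilon> V z) \<le> C * \<kappa> ^ (CARD('n) + 4) * m * norm (y - z)"
proof -
  let ?g = "gradient (kernel \<psi> \<epsilon>)"
  have "norm (\<integral>p. blinfun_apply (snd p) (?g (fst p - y)) - blinfun_apply (snd p) (?g (fst p - z)) \<partial>V)
      \<le> (C * \<kappa> ^ (CARD('n) + 4) * norm (y - z)) * m"
  proof (rule bundle_integral_bound(2)[OF V m0])
    fix x and S :: "'n endo" assume S: "S \<in> grassmannian d"
    have "norm (?g (x - y) - ?g (x - z)) \<le> C * \<kappa> ^ (CARD('n) + 4) * norm (y - z)"
      using gradient_lipschitz[of "x - y" "x - z"] by (simp add: norm_minus_commute)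
    from grass_apply_le[OF S this]
    show "norm (blinfun_apply (snd (x, S)) (?g (fst (x, S) - y)) - blinfun_apply (snd (x, S)) (?g (fst (x, S) - z)))
       \<le> C * \<kappa> ^ (CARD('n) + 4) * norm (y - z)"
      by (simp add: blinfun.diff_right)
  next
    show "0 \<le> C * \<kappa> ^ (CARD('n) + 4) * norm (y - z)" using bound0(3) by (rule mult_nonneg_nonneg) simp
  qed (intro continuous_on_diff continuous_bundle)
  moreover have "(\<integral>p. blinfun_apply (snd p) (?g (fst p - y)) - blinfun_apply (snd p) (?g (fst p - z)) \<partial>V) =
      smoothed_variation \<psi> \<epsilon> V y - smoothed_variation \<psi> \<epsilon> V z"
    unfolding smoothed_variation_eq by (rule Bochner_Integration.integral_diff) (rule integrable_variation)+
  ultimately show ?thesis by (simp only: mult_ac)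
qed

lemma curvature_quotient_continuous: "continuous_on UNIV (curvature_quotient \<psi> \<epsilon> V)"
proof -
  have "(C * \<kappa> ^ (CARD('n) + 2) * m)-lipschitz_on UNIV (smoothed_weight \<psi> \<epsilon> V)"
    unfolding lipschitz_on_def dist_norm real_norm_def
    using smoothed_weight_lipschitz mult_nonneg_nonneg[OF bound0(2) m0] by blast
  moreover have "(C * \<kappa> ^ (CARD('n) + 4) * m)-lipschitz_on UNIV (smoothed_variation \<psi> \<epsilon> V)"
    unfolding lipschitz_on_def dist_norm
    using smoothed_variation_lipschitz mult_nonneg_nonneg[OF bound0(3) m0] by blast
  moreover have "smoothed_weight \<psi> \<epsilon> V y + \<epsilon> \<noteq> 0" for y using smoothed_weight_nonneg[of y] eps by linarith
  ultimately show ?thesis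
    unfolding curvature_quotient_def[abs_def]
    by (intro continuous_intros lipschitz_on_continuous_on) auto
qed

lemma norm_smoothed_variation: "norm (smoothed_variation \<psi> \<epsilon> V y) \<le> \<kappa>\<^sup>2 * smoothed_weight \<psi> \<epsilon> V y + C * m"
proof -
  interpret f: finite_measure V by (rule mass_leD[OF V m0])
  let ?g = "gradient (kernel \<psi> \<epsilon>)"
  have i: "integrable V (\<lambda>p. \<kappa>\<^sup>2 * kernel \<psi> \<epsilon> (fst p - y) + C)" using integrable_weight by simp
  have "norm (smoothed_variation \<psi> \<epsilon> V y) \<le> (\<integral>p. \<kappa>\<^sup>2 * kernel \<psi> \<epsilon> (fst p - y) + C \<partial>V)"
    unfolding smoothed_variation_eq
  proof (rule order_trans[OF integral_norm_bound], rule integral_mono)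
    fix p assume "p \<in> space V"
    then have "snd p \<in> grassmannian d" unfolding bundle_space[OF sets_V] by (auto simp: grass_bundle_def)
    then show "norm (blinfun_apply (snd p) (?g (fst p - y))) \<le> \<kappa>\<^sup>2 * kernel \<psi> \<epsilon> (fst p - y) + C"
      by (rule grass_apply_le) (rule gradient_le)
  qed (use integrable_variation i in auto)
  also have "\<dots> = \<kappa>\<^sup>2 * smoothed_weight \<psi> \<epsilon> V y + C * measure V (space V)"
    unfolding smoothed_weight_eq using integrable_weight by simp
  also have "\<dots> \<le> \<kappa>\<^sup>2 * smoothed_weight \<psi> \<epsilon> V y + C * m"
    using mass_leD(3)[OF V m0] C0 by (simp add: mult_left_mono)
  finally show ?thesis .
qed

text \<open>By \<open>norm_smoothed_variation\<close> the numerator is at most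
  \<open>\<kappa>\<^sup>2\<close> p + C m with p the smoothed weight. Divided by p + \<epsilon>, the
  first part is at most \<open>\<kappa>\<^sup>2\<close> and the second at most C m \<kappa>.\<close>

lemma norm_curvature_quotient: "norm (curvature_quotient \<psi> \<epsilon> V y) \<le> 2 * C * m * \<kappa>\<^sup>2"
proof -
  define p where "p = smoothed_weight \<psi> \<epsilon> V y"
  have p0: "0 \<le> p" unfolding p_def by (rule smoothed_weight_nonneg)
  have pe: "0 < p + \<epsilon>" using p0 eps by simp
  have Cm: "1 \<le> C * m" using C1 m1 mult_mono[OF C1 m1] by simp
  have \<kappa>2: "\<kappa> \<le> \<kappa>\<^sup>2" using \<kappa>1 by (simp add: power2_eq_square)
  have "norm (curvature_quotient \<psi> \<epsilon> V y) = norm (smoothed_variation \<psi> \<epsilon> V y) / (p + \<epsilon>)"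
    using pe by (simp add: curvature_quotient_def p_def divide_inverse mult.commute)
  also have "\<dots> \<le> (\<kappa>\<^sup>2 * p + C * m) / (p + \<epsilon>)"
    unfolding p_def by (rule divide_right_mono[OF norm_smoothed_variation]) (use pe in \<open>simp add: p_def\<close>)
  also have "\<dots> \<le> (\<kappa>\<^sup>2 * p + \<kappa>\<^sup>2 * \<epsilon>) / (p + \<epsilon>) + C * m / \<epsilon>"
  proof -
    have "C * m / (p + \<epsilon>) \<le> C * m / \<epsilon>" using p0 eps Cm by (intro divide_left_mono) auto
    moreover have "\<kappa>\<^sup>2 * p / (p + \<epsilon>) \<le> (\<kappa>\<^sup>2 * p + \<kappa>\<^sup>2 * \<epsilon>) / (p + \<epsilon>)"
      using pe eps by (intro divide_right_mono) auto
    ultimately show ?thesis by (simp add: add_divide_distrib)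
  qed
  also have "(\<kappa>\<^sup>2 * p + \<kappa>\<^sup>2 * \<epsilon>) / (p + \<epsilon>) = \<kappa>\<^sup>2" using pe by (simp flip: distrib_left)
  also have "\<kappa>\<^sup>2 + C * m / \<epsilon> \<le> C * m * \<kappa>\<^sup>2 + C * m * \<kappa>\<^sup>2"
  proof (rule add_mono)
    show "\<kappa>\<^sup>2 \<le> C * m * \<kappa>\<^sup>2" using mult_right_mono[OF Cm, of "\<kappa>\<^sup>2"] by simp
    have "C * m / \<epsilon> = C * m * \<kappa>" by (simp add: \<kappa>_eq)
    also have "\<dots> \<le> C * m * \<kappa>\<^sup>2" using \<kappa>2 Cm by (intro mult_left_mono) auto
    finally show "C * m / \<epsilon> \<le> C * m * \<kappa>\<^sup>2" .
  qed
  finally show ?thesis by simp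
qed

lemma curvature_eq_conv: "approx_mean_curvature \<psi> \<epsilon> V = conv (curvature_quotient \<psi> \<epsilon> V)"
  by (rule ext) (simp add: approx_mean_curvature_def conv_def)

lemma vol_le: "\<kappa>\<^sup>2 + C * unit_ball_vol (real CARD('n)) \<le> (1 + C * unit_ball_vol (real CARD('n))) * \<kappa>\<^sup>2"
proof -
  have "C * unit_ball_vol (real CARD('n)) * 1 \<le> C * unit_ball_vol (real CARD('n)) * \<kappa>\<^sup>2"
    using C0 \<kappa>1 by (intro mult_left_mono) auto
  then show ?thesis by (simp add: distrib_right)
qed

lemma curvature_norm: "norm (approx_mean_curvature \<psi> \<epsilon> V x) \<le> 2 * C * m * \<kappa>\<^sup>2"
  unfolding curvature_eq_conv by (rule norm_conv[OF curvature_quotient_continuous norm_curvature_quotient])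

lemma curvature_field:
  "field_bounds (2 * C * (1 + C * unit_ball_vol (real CARD('n))) * m * \<kappa> ^ 4)
    (4 * unit_ball_vol (real CARD('n)) * C\<^sup>2 * m * \<kappa> ^ (CARD('n) + 6))
    (approx_mean_curvature \<psi> \<epsilon> V) (curvature_deriv \<psi> \<epsilon> V)"
  unfolding field_bounds_def
proof (intro conjI allI)
  let ?\<omega> = "unit_ball_vol (real CARD('n))"
  note w = curvature_quotient_continuous norm_curvature_quotient
  have n: "0 \<le> 2 * C * m * \<kappa>\<^sup>2" using C0 m0 by simp
  fix x y
  show "(approx_mean_curvature \<psi> \<epsilon> V has_derivative blinfun_apply (curvature_deriv \<psi> \<epsilon> V x)) (at x)"
    unfolding curvature_eq_conv curvature_deriv_def by (rule conv_has_derivative[OF w])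
  have "norm (approx_mean_curvature \<psi> \<epsilon> V x) \<le> 1 * (2 * C * m * \<kappa>\<^sup>2)" using curvature_norm[of x] by simp
  also have "\<dots> \<le> ((1 + C * ?\<omega>) * \<kappa>\<^sup>2) * (2 * C * m * \<kappa>\<^sup>2)"
    using C0 \<kappa>1 n by (intro mult_right_mono) (auto intro: order_trans[OF _ mult_mono[of 1 _ 1]])
  finally show "norm (approx_mean_curvature \<psi> \<epsilon> V x) \<le> 2 * C * (1 + C * ?\<omega>) * m * \<kappa> ^ 4"
    by (simp add: mult_ac power4_eq_xxxx power2_eq_square)
  have "norm (curvature_deriv \<psi> \<epsilon> V x) \<le> (\<kappa>\<^sup>2 + C * ?\<omega>) * (2 * C * m * \<kappa>\<^sup>2)"
    unfolding curvature_deriv_def by (rule norm_dconv[OF w])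
  also have "\<dots> \<le> ((1 + C * ?\<omega>) * \<kappa>\<^sup>2) * (2 * C * m * \<kappa>\<^sup>2)"
    by (rule mult_right_mono[OF vol_le n])
  finally show "norm (curvature_deriv \<psi> \<epsilon> V x) \<le> 2 * C * (1 + C * ?\<omega>) * m * \<kappa> ^ 4"
    by (simp add: mult_ac power4_eq_xxxx power2_eq_square)
  have "norm (curvature_deriv \<psi> \<epsilon> V x - curvature_deriv \<psi> \<epsilon> V y)
      \<le> 2 * ?\<omega> * C * (2 * C * m * \<kappa>\<^sup>2) * \<kappa> ^ (CARD('n) + 4) * norm (x - y)"
    unfolding curvature_deriv_def by (rule dconv_lipschitz[OF w])
  also have "2 * ?\<omega> * C * (2 * C * m * \<kappa>\<^sup>2) * \<kappa> ^ (CARD('n) + 4) = 4 * ?\<omega> * C\<^sup>2 * m * \<kappa> ^ (CARD('n) + 6)"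
    by (simp add: power_add power2_eq_square numeral_eq_Suc)
  finally show "norm (curvature_deriv \<psi> \<epsilon> V x - curvature_deriv \<psi> \<epsilon> V y)
      \<le> 4 * ?\<omega> * C\<^sup>2 * m * \<kappa> ^ (CARD('n) + 6) * norm (x - y)" .
qed

text \<open>The factor \<kappa> beside each \<open>\<beta>\<close> is the reciprocal of the lower
  bound \<epsilon> on the denominators, and the outer \<open>\<kappa>\<^sup>2\<close> is the price
  of \<open>dconv\<close>; it also covers the field itself, so that one \<open>K\<close> serves
  both.\<close>

lemma curvature_diff:
  assumes W: "mass_le d m W"
    and p: "\<And>y. \<bar>smoothed_weight \<psi> \<epsilon> V y - smoothed_weight \<psi> \<epsilon> W y\<bar> \<le> \<beta>1"
    and a: "\<And>y. norm (smoothed_variation \<psi> \<epsilon> V y - smoothed_variation \<psi> \<epsilon> W y) \<le> \<beta>2"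
  defines "K \<equiv> (1 + C * unit_ball_vol (real CARD('n))) * \<kappa>\<^sup>2 * (\<beta>2 * \<kappa> + \<beta>1 * \<kappa> * (2 * C * m * \<kappa>\<^sup>2))"
  shows "norm (approx_mean_curvature \<psi> \<epsilon> V x - approx_mean_curvature \<psi> \<epsilon> W x) \<le> K"
    and "norm (curvature_deriv \<psi> \<epsilon> V x - curvature_deriv \<psi> \<epsilon> W x) \<le> K"
proof -
  interpret W: curvature \<psi> \<epsilon> C \<kappa> d m W
    by unfold_locales (use eps \<kappa>_eq m1 W in auto)
  let ?q = "\<lambda>y. curvature_quotient \<psi> \<epsilon> V y - curvature_quotient \<psi> \<epsilon> W y"
  let ?b = "\<beta>2 * \<kappa> + \<beta>1 * \<kappa> * (2 * C * m * \<kappa>\<^sup>2)"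
  have \<beta>: "0 \<le> \<beta>1" "0 \<le> \<beta>2" using p[of 0] a[of 0] norm_ge_zero order_trans abs_ge_zero by blast+
  then have b0: "0 \<le> ?b" using C0 \<kappa>0 m0 by simp
  have q: "norm (?q y) \<le> ?b" for y
  proof -
    define P where "P = smoothed_weight \<psi> \<epsilon> V y + \<epsilon>"
    define Q where "Q = smoothed_weight \<psi> \<epsilon> W y + \<epsilon>"
    let ?A = "smoothed_variation \<psi> \<epsilon> V y" and ?B = "smoothed_variation \<psi> \<epsilon> W y"
    have PQ: "\<epsilon> \<le> P" "\<epsilon> \<le> Q" using smoothed_weight_nonneg[of y] W.smoothed_weight_nonneg[of y] by (auto simp: P_def Q_def)
    have qW: "norm (?B /\<^sub>R Q) \<le> 2 * C * m * \<kappa>\<^sup>2"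
      using W.norm_curvature_quotient[of y] unfolding curvature_quotient_def Q_def[symmetric] norm_minus_cancel .
    have "norm (?q y) = norm (?A /\<^sub>R P - ?B /\<^sub>R Q)"
      by (simp add: curvature_quotient_def P_def Q_def norm_minus_commute)
    also have "\<dots> \<le> norm (?A - ?B) / \<epsilon> + \<bar>P - Q\<bar> / \<epsilon> * norm (?B /\<^sub>R Q)"
      by (rule quotient_diff[OF eps PQ])
    also have "\<dots> \<le> \<beta>2 / \<epsilon> + \<beta>1 / \<epsilon> * (2 * C * m * \<kappa>\<^sup>2)"
      using a[of y] p[of y] eps \<beta> qW by (intro add_mono mult_mono divide_right_mono) (auto simp: P_def Q_def)
    finally show ?thesis by (simp add: \<kappa>_eq)
  qed
  have cq: "continuous_on UNIV ?q"
    by (intro continuous_on_diff curvature_quotient_continuous W.curvature_quotient_continuous)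
  note cd = conv_diff[OF curvature_quotient_continuous W.curvature_quotient_continuous]
  have "norm (approx_mean_curvature \<psi> \<epsilon> V x - approx_mean_curvature \<psi> \<epsilon> W x) \<le> 1 * ?b"
    unfolding curvature_eq_conv W.curvature_eq_conv cd using norm_conv[OF cq q] by simp
  also have "\<dots> \<le> ((1 + C * unit_ball_vol (real CARD('n))) * \<kappa>\<^sup>2) * ?b"
    using C0 \<kappa>1 b0 by (intro mult_right_mono) (auto intro: order_trans[OF _ mult_mono[of 1 _ 1]])
  finally show "norm (approx_mean_curvature \<psi> \<epsilon> V x - approx_mean_curvature \<psi> \<epsilon> W x) \<le> K"
    by (simp add: K_def)
  have "norm (curvature_deriv \<psi> \<epsilon> V x - curvature_deriv \<psi> \<epsilon> W x) \<le> (\<kappa>\<^sup>2 + C * unit_ball_vol (real CARD('n))) * ?b"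
    unfolding curvature_deriv_def cd by (rule norm_dconv[OF cq q])
  also have "\<dots> \<le> K" unfolding K_def by (rule mult_right_mono[OF vol_le b0])
  finally show "norm (curvature_deriv \<psi> \<epsilon> V x - curvature_deriv \<psi> \<epsilon> W x) \<le> K" .
qed

text \<open>Self-adjointness moves the projection onto the gradient of the kernel. In this form the
  integrand, integrated over the varifold at fixed y, is the inner product of the smoothed variation
  with \<open>w\<close>.\<close>

lemma grass_trace_dconv:
  fixes w :: "real^'n \<Rightarrow> real^'n"
  assumes S: "S \<in> grassmannian d" and w: "continuous_on UNIV w"
  shows "grass_trace S (dconv w x) = (\<integral>y. inner (blinfun_apply S (gradient (kernel \<psi> \<epsilon>) (x - y))) (w y) \<partial>lborel)"
proof -
  let ?g = "\<lambda>y. gradient (kernel \<psi> \<epsilon>) (x - y)"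
  have "grass_trace S (dconv w x) = (\<Sum>k\<in>Basis. \<integral>y. inner (S k) (?g y) * inner (w y) k \<partial>lborel)"
    unfolding grass_trace_def dconv_apply[OF w]
    using gradient_integrable[OF w] by (simp flip: integral_inner_left)
  also have "\<dots> = (\<integral>y. (\<Sum>k\<in>Basis. inner (S k) (?g y) * inner (w y) k) \<partial>lborel)"
  proof (rule Bochner_Integration.integral_sum[symmetric])
    fix k :: "real^'n"
    have "integrable lborel (\<lambda>y. inner (inner (S k) (?g y) *\<^sub>R w y) k)"
      by (rule integrable_inner_left) (use gradient_integrable[OF w] in auto)
    then show "integrable lborel (\<lambda>y. inner (S k) (?g y) * inner (w y) k)" by simp
  qed
  also have "\<dots> = (\<integral>y. inner (S (?g y)) (w y) \<partial>lborel)"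
  proof (rule Bochner_Integration.integral_cong[OF refl])
    fix y
    have "inner (S k) (?g y) = inner (S (?g y)) k" for k
      by (rule trans[OF grassmannian_sym[OF S] inner_commute])
    then show "(\<Sum>k\<in>Basis. inner (S k) (?g y) * inner (w y) k) = inner (S (?g y)) (w y)"
      using euclidean_inner[of "blinfun_apply S (?g y)" "w y"] by presburger
  qed
  finally show ?thesis .
qed

text \<open>Fubini turns the integral into \<open>- \<integral> |\<delta>V * \<Phi>|\<^sup>2 / (\<parallel>V\<parallel> * \<Phi> + \<epsilon>)\<close>; to first order the flow
  does not increase mass.\<close>

lemma curvature_divergence_nonpos:
  "(\<integral>p. grass_trace (snd p) (curvature_deriv \<psi> \<epsilon> V (fst p)) \<partial>V) \<le> 0"
proof -
  define w where "w = curvature_quotient \<psi> \<epsilon> V"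
  define g where "g = gradient (kernel \<psi> \<epsilon>)"
  have w: "continuous_on UNIV w" and wb: "\<And>y. norm (w y) \<le> 2 * C * m * \<kappa>\<^sup>2"
    unfolding w_def by (rule curvature_quotient_continuous norm_curvature_quotient)+
  define F where "F p y = inner (blinfun_apply (snd p) (g (fst p - y))) (w y)" for p :: "(real^'n) \<times> 'n endo" and y
  interpret f: finite_measure V by (rule mass_leD[OF V m0])
  interpret pair_sigma_finite V "lborel :: (real^'n) measure" ..
  define X where "X p = fst p" for p :: "(real^'n) \<times> 'n endo"
  define Y where "Y j p = blinfun_apply (snd p) j" for j and p :: "(real^'n) \<times> 'n endo"
  have [measurable]: "X \<in> borel_measurable V"
    unfolding X_def by (intro bundle_measurable[OF sets_V] continuous_intros)
  have [measurable]: "Y j \<in> borel_measurable V" for j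
    unfolding Y_def by (intro bundle_measurable[OF sets_V] blinfun.continuous_on continuous_intros)
  have [measurable]: "g \<in> borel_measurable borel" "w \<in> borel_measurable borel"
    unfolding g_def using w gradient_continuous by (auto intro: borel_measurable_continuous_onI)
  \<comment> \<open>Expanding in coordinates writes \<open>F\<close> as a finite sum of products of
    functions measurable on the product space, which settles joint measurability for Fubini.\<close>
  have Fe: "F p y = (\<Sum>j\<in>Basis. inner (g (X p - y)) j * inner (Y j p) (w y))" for p y
  proof -
    have "blinfun_apply (snd p) (g (X p - y)) = blinfun_apply (snd p) (\<Sum>j\<in>Basis. inner (g (X p - y)) j *\<^sub>R j)"
      by (simp add: euclidean_representation)
    then show ?thesis by (simp add: F_def X_def Y_def blinfun.sum_right blinfun.scaleR_right inner_sum_left)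
  qed
  have Fm: "case_prod F \<in> borel_measurable (V \<Otimes>\<^sub>M lborel)"
    unfolding Fe by measurable
  define K where "K = C * \<kappa> ^ (CARD('n) + 2) * (2 * C * m * \<kappa>\<^sup>2)"
  have K0: "0 \<le> K" using C0 \<kappa>0 m0 by (simp add: K_def)
  have Fb: "norm (F p y) \<le> K * indicator (cball (fst p) 1) y" if "p \<in> space V" for p y
  proof (cases "y \<in> cball (fst p) 1")
    case True
    have S: "snd p \<in> grassmannian d" using that unfolding bundle_space[OF sets_V] by (auto simp: grass_bundle_def)
    have "norm (F p y) \<le> norm (blinfun_apply (snd p) (g (fst p - y))) * norm (w y)"
      unfolding F_def real_norm_def by (rule Cauchy_Schwarz_ineq2)
    also have "\<dots> \<le> K"
      unfolding K_def g_def using bound0(2) by (intro mult_mono wb grass_apply_le[OF S] gradient_bound) auto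
    finally show ?thesis using True by simp
  next
    case False
    then have "norm (fst p - y) > 1" by (simp add: dist_norm)
    then show ?thesis using False by (simp add: F_def g_def gradient_supp)
  qed
  have Fi: "integrable lborel (F p)" if "p \<in> space V" for p
  proof (rule Bochner_Integration.integrable_bound)
    show "integrable lborel (\<lambda>y. K * indicator (cball (fst p) 1) y :: real)"
      using integrable_indicator_cball[of "fst p" 1] by simp
    show "F p \<in> borel_measurable lborel" unfolding Fe by measurable
    show "AE y in lborel. norm (F p y) \<le> norm (K * indicator (cball (fst p) 1) y :: real)"
      using Fb[OF that] K0 by (auto simp: abs_mult)
  qed
  have int: "integrable (V \<Otimes>\<^sub>M lborel) (case_prod F)"
  proof (rule Fubini_integrable[OF Fm])
    show "integrable V (\<lambda>p. \<integral>y. norm (case_prod F (p, y)) \<partial>lborel)"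
    proof (rule f.integrable_const_bound)
      show "(\<lambda>p. \<integral>y. norm (case_prod F (p, y)) \<partial>lborel) \<in> borel_measurable V"
        using Fm by measurable
      show "AE p in V. norm (\<integral>y. norm (case_prod F (p, y)) \<partial>lborel) \<le> K * unit_ball_vol (real CARD('n))"
      proof (rule AE_I2)
        fix p assume p: "p \<in> space V"
        have "(\<integral>y. norm (F p y) \<partial>lborel) \<le> (\<integral>y. K * indicator (cball (fst p) 1) y \<partial>lborel)"
          using Fb[OF p] Fi[OF p] integrable_indicator_cball[of "fst p" 1] by (intro integral_mono) auto
        also have "\<dots> = K * unit_ball_vol (real CARD('n))"
          using integrable_indicator_cball[of "fst p" 1] by (simp add: content_unit_cball)
        finally show "norm (\<integral>y. norm (case_prod F (p, y)) \<partial>lborel) \<le> K * unit_ball_vol (real CARD('n))"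
          by (simp add: integral_nonneg_AE)
      qed
    qed
    show "AE p in V. integrable lborel (\<lambda>y. case_prod F (p, y))" using Fi by simp
  qed
  have "(\<integral>p. grass_trace (snd p) (curvature_deriv \<psi> \<epsilon> V (fst p)) \<partial>V) = (\<integral>p. (\<integral>y. F p y \<partial>lborel) \<partial>V)"
  proof (rule Bochner_Integration.integral_cong[OF refl])
    fix p assume "p \<in> space V"
    then have S: "snd p \<in> grassmannian d" unfolding bundle_space[OF sets_V] by (auto simp: grass_bundle_def)
    show "grass_trace (snd p) (curvature_deriv \<psi> \<epsilon> V (fst p)) = (\<integral>y. F p y \<partial>lborel)"
      unfolding curvature_deriv_def w_def[symmetric] F_def g_def by (rule grass_trace_dconv[OF S w])
  qed
  also have "\<dots> = (\<integral>y. (\<integral>p. F p y \<partial>V) \<partial>lborel)" by (rule Fubini_integral[OF int, symmetric])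
  also have "\<dots> = (\<integral>y. - (norm (smoothed_variation \<psi> \<epsilon> V y))\<^sup>2 / (smoothed_weight \<psi> \<epsilon> V y + \<epsilon>) \<partial>lborel)"
  proof (rule Bochner_Integration.integral_cong[OF refl])
    fix y
    have "(\<integral>p. F p y \<partial>V) = inner (smoothed_variation \<psi> \<epsilon> V y) (w y)"
      unfolding F_def g_def smoothed_variation_eq by (rule integral_inner_left) (use integrable_variation in auto)
    also have "\<dots> = - (norm (smoothed_variation \<psi> \<epsilon> V y))\<^sup>2 / (smoothed_weight \<psi> \<epsilon> V y + \<epsilon>)"
      by (simp add: w_def curvature_quotient_def dot_square_norm divide_inverse)
    finally show "(\<integral>p. F p y \<partial>V) = - (norm (smoothed_variation \<psi> \<epsilon> V y))\<^sup>2 / (smoothed_weight \<psi> \<epsilon> V y + \<epsilon>)" .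
  qed
  also have "\<dots> \<le> 0"
  proof -
    have "0 \<le> (\<integral>y. (norm (smoothed_variation \<psi> \<epsilon> V y))\<^sup>2 / (smoothed_weight \<psi> \<epsilon> V y + \<epsilon>) \<partial>lborel)"
      using smoothed_weight_nonneg eps by (intro integral_nonneg_AE) (auto intro!: divide_nonneg_nonneg add_nonneg_nonneg)
    then show ?thesis by simp
  qed
  finally show ?thesis .
qed

end

section \<open>Euler steps\<close>

lemma field_boundsD:
  assumes "field_bounds H L h B"
  shows "(h has_derivative blinfun_apply (B x)) (at x)" "norm (h x) \<le> H" "norm (B x) \<le> H"
    "norm (B x - B y) \<le> L * norm (x - y)" "0 \<le> H"
  using assms norm_ge_zero order_trans unfolding field_bounds_def by blast+

lemma field_lipschitz:
  assumes "field_bounds H L h B"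
  shows "norm (h x - h y) \<le> H * norm (x - y)"
proof (rule differentiable_bound[of UNIV h "\<lambda>x. blinfun_apply (B x)"])
  show "onorm (blinfun_apply (B z)) \<le> H" for z
    using field_boundsD(3)[OF assms] by (simp add: norm_blinfun.rep_eq)
qed (use field_boundsD(1)[OF assms] in auto)

lemma field_deriv_continuous:
  fixes B :: "real^'n::finite \<Rightarrow> 'n endo"
  assumes "field_bounds H L h B"
  shows "continuous_on UNIV B"
proof -
  have "\<bar>L\<bar>-lipschitz_on UNIV B"
    unfolding lipschitz_on_def dist_norm
    using field_boundsD(4)[OF assms] order_trans[OF _ mult_right_mono[OF abs_ge_self[of L]]] by auto
  then show ?thesis by (rule lipschitz_on_continuous_on)
qed

lemma step_has_derivative:
  assumes "field_bounds H L h B"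
  shows "((\<lambda>x. x + s *\<^sub>R h x) has_derivative blinfun_apply (id_blinfun + s *\<^sub>R B x)) (at x)"
proof -
  have "((\<lambda>x. x + s *\<^sub>R h x) has_derivative (\<lambda>v. v + s *\<^sub>R blinfun_apply (B x) v)) (at x)"
    by (intro derivative_intros field_boundsD(1)[OF assms])
  also have "(\<lambda>v. v + s *\<^sub>R blinfun_apply (B x) v) = blinfun_apply (id_blinfun + s *\<^sub>R B x)"
    by (simp add: fun_eq_iff blinfun.add_left blinfun.scaleR_left)
  finally show ?thesis .
qed

text \<open>The perturbation s h is a contraction with factor 1/2. Hence the map expands distances
  at least by 1/2, it is onto by the Banach fixed point theorem, and the inverse is 2-Lipschitz. The
  derivative of the inverse is the inverse matrix \<open>R y\<close>, and its continuity is obtained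
  from a Lipschitz estimate.\<close>

lemma C1_diffeo_step:
  fixes h :: "real^'n::finite \<Rightarrow> real^'n"
  assumes F: "field_bounds H L h B" and s: "0 \<le> s" "s * H \<le> 1/2"
  shows "C1_diffeo (\<lambda>x. x + s *\<^sub>R h x)"
proof -
  define f where "f x = x + s *\<^sub>R h x" for x
  note fd = step_has_derivative[OF F, of s, folded f_def]
  have lip: "norm (s *\<^sub>R h x - s *\<^sub>R h y) \<le> 1/2 * norm (x - y)" for x y
  proof -
    have "norm (s *\<^sub>R h x - s *\<^sub>R h y) = s * norm (h x - h y)" using s by (simp flip: scaleR_diff_right)
    also have "\<dots> \<le> s * (H * norm (x - y))" using s(1) field_lipschitz[OF F] by (rule mult_left_mono[rotated])
    also have "\<dots> = (s * H) * norm (x - y)" by simp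
    also have "\<dots> \<le> 1/2 * norm (x - y)" by (rule mult_right_mono[OF s(2)]) simp
    finally show ?thesis .
  qed
  have expand: "norm (x - y) \<le> 2 * norm (f x - f y)" for x y
  proof -
    have "norm (x - y) = norm ((f x - f y) - (s *\<^sub>R h x - s *\<^sub>R h y))" by (simp add: f_def)
    also have "\<dots> \<le> norm (f x - f y) + norm (s *\<^sub>R h x - s *\<^sub>R h y)" by (rule norm_triangle_ineq4)
    finally show ?thesis using lip[of x y] by simp
  qed
  have inj: "inj f"
  proof (rule injI)
    fix x y assume "f x = f y"
    then show "x = y" using expand[of x y] by simp
  qed
  have "\<exists>x. f x = y" for y
  proof -
    have "\<exists>!x. y - s *\<^sub>R h x = x"
      by (rule banach_fix_type[of "1/2"]) (use lip in \<open>auto simp: dist_norm norm_minus_commute\<close>)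
    then obtain x where "y - s *\<^sub>R h x = x" by blast
    then have "f x = y" unfolding f_def by (metis diff_add_cancel)
    then show ?thesis ..
  qed
  then have surj: "surj f" by (metis surjI)
  define g where "g = inv_into UNIV f"
  have fg: "f (g y) = y" for y unfolding g_def by (rule surj_f_inv_f[OF surj])
  have gl: "norm (g y - g z) \<le> 2 * norm (y - z)" for y z
    using expand[of "g y" "g z"] by (simp add: fg)
  have "2-lipschitz_on UNIV g" using gl by (simp add: lipschitz_on_def dist_norm)
  then have gc: "continuous_on UNIV g" by (rule lipschitz_on_continuous_on)
  define E where "E y = s *\<^sub>R B (g y)" for y
  have E: "norm (E y) \<le> 1/2" for y
    using order_trans[OF mult_left_mono[OF field_boundsD(3)[OF F] s(1)] s(2)] s(1) by (simp add: E_def)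
  define R where "R y = (SOME G :: 'n endo. norm G \<le> 2 \<and>
    (\<forall>x. blinfun_apply G x + blinfun_apply (E y) (blinfun_apply G x) = x) \<and>
    (\<forall>x. blinfun_apply G (x + blinfun_apply (E y) x) = x))" for y
  have R: "norm (R y) \<le> 2 \<and> (\<forall>x. blinfun_apply (R y) x + blinfun_apply (E y) (blinfun_apply (R y) x) = x) \<and>
    (\<forall>x. blinfun_apply (R y) (x + blinfun_apply (E y) x) = x)" for y
    unfolding R_def by (rule someI_ex[OF near_id_inverse[OF E]])
  have G1: "norm (R y) \<le> 2" and G2: "R y x + E y (R y x) = x" and G3: "R y (x + E y x) = x" for x y using R by blast+
  have gd: "(g has_derivative blinfun_apply (R y)) (at y)" for y
  proof (rule has_derivative_inverse_basic[OF fd blinfun.bounded_linear_right])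
    show "blinfun_apply (R y) \<circ> blinfun_apply (id_blinfun + s *\<^sub>R B (g y)) = id"
      using G3[of y] by (simp add: fun_eq_iff blinfun.add_left E_def)
    show "isCont g y" using gc by (simp add: continuous_on_eq_continuous_at)
  qed (rule open_UNIV UNIV_I fg)+
  have Gl: "norm (R y v - R z v) \<le> (8 * s * L * norm v) * norm (y - z)" for y z v
  proof -
    define u where "u = R y v - R z v"
    \<comment> \<open>Resolvent identity, the difference of the two equations \<open>G2\<close>. The
      term \<open>E y u\<close> has norm at most |u|/2 and is absorbed on the left.\<close>
    have "u = - (E y u + (E y - E z) (R z v))"
      using G2[of y v] G2[of z v] by (simp add: u_def blinfun.diff_right blinfun.diff_left algebra_simps)
    then have "norm u \<le> norm (E y u) + norm ((E y - E z) (R z v))"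
      by (metis norm_minus_cancel norm_triangle_ineq)
    also have "norm (E y u) \<le> 1/2 * norm u" using norm_blinfun[of "E y" u] mult_right_mono[OF E[of y], of "norm u"] by simp
    also have "norm ((E y - E z) (R z v)) \<le> (s * (L * (2 * norm (y - z)))) * (2 * norm v)"
    proof -
      have L0: "0 \<le> L * norm (g y - g z)" using field_boundsD(4)[OF F, of "g y" "g z"] norm_ge_zero order_trans by blast
      have "norm (E y - E z) = s * norm (B (g y) - B (g z))" using s(1) by (simp add: E_def flip: scaleR_diff_right)
      also have "\<dots> \<le> s * (L * (2 * norm (y - z)))"
      \<comment> \<open>\<open>field_bounds\<close> leaves the sign of \<open>L\<close> open; a
        negative value forces g y = g z, hence y = z.\<close>
      proof (cases "L \<ge> 0")
        case True
        then show ?thesis using field_boundsD(4)[OF F, of "g y" "g z"] mult_left_mono[OF gl[of y z] True] s(1)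
          by (intro mult_left_mono) auto
      next
        case False
        then have "norm (g y - g z) = 0" using L0 by (simp add: zero_le_mult_iff)
        then have gg: "g y = g z" by simp
        then have "y = z" using fg by metis
        then show ?thesis by simp
      qed
      finally have e: "norm (E y - E z) \<le> s * (L * (2 * norm (y - z)))" .
      have "norm ((E y - E z) (R z v)) \<le> norm (E y - E z) * norm (R z v)" by (rule norm_blinfun)
      also have "\<dots> \<le> (s * (L * (2 * norm (y - z)))) * (2 * norm v)"
        using e order_trans[OF norm_blinfun mult_right_mono[OF G1[of z] norm_ge_zero[of v]]] order_trans[OF norm_ge_zero e]
        by (intro mult_mono) auto
      finally show ?thesis .
    qed
    finally show ?thesis unfolding u_def[symmetric] by (simp add: mult_ac)
  qed
  have Gc: "continuous_on UNIV (\<lambda>y. R y v)" for v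
  proof -
    have "\<bar>8 * s * L * norm v\<bar>-lipschitz_on UNIV (\<lambda>y. R y v)"
      unfolding lipschitz_on_def dist_norm
      by (intro conjI ballI abs_ge_zero order_trans[OF Gl] mult_right_mono abs_ge_self norm_ge_zero)
    then show ?thesis by (rule lipschitz_on_continuous_on)
  qed
  have "C_k 1 g"
    using gd Gc by (auto simp: differentiable_def frechet_derivative_at[OF gd, symmetric] intro: exI)
  moreover have "C_k 1 f"
    using fd field_deriv_continuous[OF F]
    by (auto simp: differentiable_def frechet_derivative_at[OF fd, symmetric] intro!: exI blinfun.continuous_on continuous_intros)
  ultimately show ?thesis
    using inj surj unfolding C1_diffeo_def f_def[symmetric, abs_def] g_def by (simp add: bij_def)
qed

text \<open>The orthogonal projection and the basis behind \<open>jac\<close> are defined by choice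
  operators, so continuity is not visible from the definitions. It follows from the local Lipschitz
  estimate, whose smallness condition holds near each point. Measurability of the step maps rests on
  it.\<close>

lemma tangent_step_continuous:
  fixes E :: "real^'n::finite \<Rightarrow> 'n endo"
  assumes E: "continuous_on UNIV E" and small: "\<And>x. jac_const d * norm (E x) \<le> 1"
  shows "continuous_on (grass_bundle d) (\<lambda>p. tangent_map (id_blinfun + E (fst p)) (snd p))"
    and "continuous_on (grass_bundle d) (\<lambda>p. ln (jac d (id_blinfun + E (fst p)) (snd p)))"
proof -
  have K6: "6 \<le> jac_const d" by (rule jac_const_ge)
  define \<rho> where "\<rho> q p = 4 * norm (snd p - snd q) + 2 * norm (E (fst p) - E (fst q))" for p q :: "(real^'n) \<times> 'n endo"
  have \<rho>: "((\<lambda>p. c * \<rho> q p) \<longlongrightarrow> 0) (at q within grass_bundle d)" for q c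
  proof -
    have "continuous_on UNIV (\<lambda>p. c * \<rho> q p)"
      unfolding \<rho>_def by (intro continuous_intros continuous_on_compose2[OF E]) auto
    then have "((\<lambda>p. c * \<rho> q p) \<longlongrightarrow> c * \<rho> q q) (at q within grass_bundle d)"
      by (meson UNIV_I continuous_on_def tendsto_within_subset subset_UNIV)
    then show ?thesis by (simp add: \<rho>_def)
  qed
  have ev: "\<forall>\<^sub>F p in at q within grass_bundle d. p \<in> grass_bundle d \<and> jac_const d * \<rho> q p \<le> 1" for q
  proof -
    have "\<forall>\<^sub>F p in at q within grass_bundle d. jac_const d * \<rho> q p < 1"
      by (rule order_tendstoD(2)[OF \<rho>]) simp
    then show ?thesis unfolding eventually_at_filter by (elim eventually_mono) auto
  qed
  have gr: "snd p \<in> grassmannian d" if "p \<in> grass_bundle d" for p :: "(real^'n) \<times> 'n endo"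
    using that by (auto simp: grass_bundle_def)
  show "continuous_on (grass_bundle d) (\<lambda>p. tangent_map (id_blinfun + E (fst p)) (snd p))"
    unfolding continuous_on_def
  proof
    fix q :: "(real^'n) \<times> 'n endo" assume q: "q \<in> grass_bundle d"
    show "((\<lambda>p. tangent_map (id_blinfun + E (fst p)) (snd p)) \<longlongrightarrow> tangent_map (id_blinfun + E (fst q)) (snd q)) (at q within grass_bundle d)"
      by (rule metric_tendsto_imp_tendsto[OF \<rho>[of 3 q]], rule eventually_mono[OF ev[of q]])
        (use tangent_map_jac_local_lipschitz(1)[OF gr[OF q] gr small small] in \<open>auto simp: dist_norm \<rho>_def\<close>)
  qed
  show "continuous_on (grass_bundle d) (\<lambda>p. ln (jac d (id_blinfun + E (fst p)) (snd p)))"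
    unfolding continuous_on_def
  proof
    fix q :: "(real^'n) \<times> 'n endo" assume q: "q \<in> grass_bundle d"
    show "((\<lambda>p. ln (jac d (id_blinfun + E (fst p)) (snd p))) \<longlongrightarrow> ln (jac d (id_blinfun + E (fst q)) (snd q))) (at q within grass_bundle d)"
    proof (rule metric_tendsto_imp_tendsto[OF \<rho>[of "2 * jac_const d" q]], rule eventually_mono[OF ev[of q]])
      fix p assume p: "p \<in> grass_bundle d \<and> jac_const d * \<rho> q p \<le> 1"
      have "\<bar>ln (jac d (id_blinfun + E (fst p)) (snd p)) - ln (jac d (id_blinfun + E (fst q)) (snd q))\<bar> \<le> 2 * jac_const d * \<rho> q p"
        using tangent_map_jac_local_lipschitz(2)[OF gr[OF q] gr small small, of p] p by (simp add: \<rho>_def)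
      then show "dist (ln (jac d (id_blinfun + E (fst p)) (snd p))) (ln (jac d (id_blinfun + E (fst q)) (snd q)))
          \<le> dist (2 * jac_const d * \<rho> q p) 0" by (simp add: dist_real_def)
    qed
  qed
qed

lemma measurable_bundle:
  assumes "continuous_on (grass_bundle d) f" "\<And>p. p \<in> grass_bundle d \<Longrightarrow> f p \<in> grass_bundle d"
  shows "f \<in> bundle_algebra d \<rightarrow>\<^sub>M bundle_algebra d"
  unfolding bundle_algebra_def
  by (rule measurable_restrict_space2)
     (use assms borel_measurable_continuous_on_restrict[OF assms(1)] in \<open>auto simp: space_restrict_space\<close>)

definition step_map :: "real \<Rightarrow> (real^'n::finite \<Rightarrow> real^'n) \<Rightarrow> (real^'n \<Rightarrow> 'n endo) \<Rightarrow>
    (real^'n) \<times> 'n endo \<Rightarrow> (real^'n) \<times> 'n endo" where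
  "step_map s h B p = (fst p + s *\<^sub>R h (fst p), tangent_map (id_blinfun + s *\<^sub>R B (fst p)) (snd p))"

definition step_ln_jac :: "nat \<Rightarrow> real \<Rightarrow> (real^'n::finite \<Rightarrow> 'n endo) \<Rightarrow> (real^'n) \<times> 'n endo \<Rightarrow> real" where
  "step_ln_jac d s B p = ln (jac d (id_blinfun + s *\<^sub>R B (fst p)) (snd p))"

context
  fixes H L s :: real and h :: "real^'n::finite \<Rightarrow> real^'n" and B :: "real^'n \<Rightarrow> 'n endo" and d :: nat
  assumes F: "field_bounds H L h B" and s0: "0 \<le> s" and small: "jac_const d * (s * H) \<le> 1"
begin

lemma step_small: "jac_const d * norm (s *\<^sub>R B x) \<le> 1"
proof -
  have "jac_const d * norm (s *\<^sub>R B x) \<le> jac_const d * (s * H)"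
    using field_boundsD(3)[OF F, of x] s0 jac_const_ge[of d] by (auto intro!: mult_left_mono)
  then show ?thesis using small by simp
qed

lemma step_continuous:
  "continuous_on (grass_bundle d) (step_map s h B)" "continuous_on (grass_bundle d) (step_ln_jac d s B)"
proof -
  have B: "continuous_on UNIV (\<lambda>x. s *\<^sub>R B x)" by (intro continuous_intros field_deriv_continuous[OF F])
  have "continuous_on UNIV h"
    by (rule has_derivative_continuous_on[where f' = "\<lambda>x. blinfun_apply (B x)"])
      (rule has_derivative_at_withinI[OF field_boundsD(1)[OF F]])
  then have "continuous_on (grass_bundle d) (\<lambda>p. h (fst p))"
    by (rule continuous_on_compose2) (auto intro: continuous_intros)
  then show "continuous_on (grass_bundle d) (step_map s h B)"
    unfolding step_map_def[abs_def]
    by (intro continuous_on_Pair continuous_on_add continuous_on_scaleR continuous_on_const continuous_on_fst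
        continuous_on_id tangent_step_continuous(1)[OF B step_small])
  show "continuous_on (grass_bundle d) (step_ln_jac d s B)"
    unfolding step_ln_jac_def[abs_def] by (rule tangent_step_continuous(2)[OF B step_small])
qed

lemma step_map_bundle: "p \<in> grass_bundle d \<Longrightarrow> step_map s h B p \<in> grass_bundle d"
proof -
  assume "p \<in> grass_bundle d"
  then have "snd p \<in> grassmannian d" by (auto simp: grass_bundle_def)
  moreover have "norm (s *\<^sub>R B (fst p)) \<le> 1/2" using jac_const_norm[OF step_small, of "fst p"] by simp
  ultimately show ?thesis
    by (simp add: step_map_def grass_bundle_def tangent_map_grassmannian(1) near_id_inj)
qed

lemma step_jac:
  assumes "p \<in> grass_bundle d"
  shows "jac d (id_blinfun + s *\<^sub>R B (fst p)) (snd p) = exp (step_ln_jac d s B p)"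
    "exp (step_ln_jac d s B p) \<le> 1 + s * grass_trace (snd p) (B (fst p)) + jac_const d * (s * H)\<^sup>2"
proof -
  have S: "snd p \<in> grassmannian d" using assms by (auto simp: grass_bundle_def)
  show e: "jac d (id_blinfun + s *\<^sub>R B (fst p)) (snd p) = exp (step_ln_jac d s B p)"
    unfolding step_ln_jac_def using jac_expand(1)[OF S step_small] by simp
  have "jac_const d * (norm (s *\<^sub>R B (fst p)))\<^sup>2 \<le> jac_const d * (s * H)\<^sup>2"
    using field_boundsD(3)[OF F] s0 jac_const_ge[of d] by (intro mult_left_mono power_mono) (auto intro: mult_left_mono)
  then show "exp (step_ln_jac d s B p) \<le> 1 + s * grass_trace (snd p) (B (fst p)) + jac_const d * (s * H)\<^sup>2"
    using jac_expand(3)[OF S step_small, of "fst p"] unfolding e grass_trace_scaleR by linarith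
qed

lemma pushforward_step:
  assumes V: "sets V = sets (bundle_algebra d)"
  shows "pushforward d (\<lambda>x. x + s *\<^sub>R h x) V
    = distr (density V (\<lambda>p. ennreal (exp (step_ln_jac d s B p)))) (bundle_algebra d) (step_map s h B)"
proof -
  note fd = step_has_derivative[OF F, of s]
  have m: "(\<lambda>(x, S). (x + s *\<^sub>R h x, orth_proj (frechet_derivative (\<lambda>x. x + s *\<^sub>R h x) (at x) ` subspace_of S))) = step_map s h B"
    by (auto simp: step_map_def tangent_map_def fun_eq_iff frechet_derivative_at[OF fd, symmetric])
  \<comment> \<open>The two weights agree on the bundle only. Comparing the integrals that define
    the densities requires no prior measurability of the weight built from a chosen basis.\<close>
  have "density V (\<lambda>(x, S). ennreal (tangential_jacobian d (\<lambda>x. x + s *\<^sub>R h x) x S)) = density V (\<lambda>p. ennreal (exp (step_ln_jac d s B p)))"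
  proof -
    have "(\<integral>\<^sup>+p. (case p of (x, S) \<Rightarrow> ennreal (tangential_jacobian d (\<lambda>x. x + s *\<^sub>R h x) x S)) * indicator A p \<partial>V)
        = (\<integral>\<^sup>+p. ennreal (exp (step_ln_jac d s B p)) * indicator A p \<partial>V)" for A
      by (rule nn_integral_cong)
         (auto simp: bundle_space[OF V] tangential_jacobian_eq_jac[OF fd] step_jac(1)[symmetric] split: prod.splits)
    then show ?thesis unfolding density_def by (auto intro!: arg_cong[where f="measure_of _ _"])
  qed
  then show ?thesis unfolding pushforward_def m by simp
qed

end

section \<open>Transport of varifolds along trajectories\<close>

definition transported :: "nat \<Rightarrow> ((real^'n::finite) \<times> 'n endo) measure \<Rightarrow> ((real^'n) \<times> 'n endo) measure \<Rightarrow>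
    ((real^'n) \<times> 'n endo \<Rightarrow> (real^'n) \<times> 'n endo) \<Rightarrow> ((real^'n) \<times> 'n endo \<Rightarrow> real) \<Rightarrow> bool" where
  "transported d V0 V Z l \<longleftrightarrow> Z \<in> bundle_algebra d \<rightarrow>\<^sub>M bundle_algebra d \<and>
     l \<in> borel_measurable (bundle_algebra d) \<and>
     V = distr (density V0 (\<lambda>p. ennreal (exp (l p)))) (bundle_algebra d) Z"

lemma space_bundle_algebra: "space (bundle_algebra d) = grass_bundle d"
  by (simp add: bundle_algebra_def space_restrict_space)

lemma transported_bundle: "transported d V0 V Z l \<Longrightarrow> p \<in> grass_bundle d \<Longrightarrow> Z p \<in> grass_bundle d"
  unfolding transported_def using measurable_space[of Z "bundle_algebra d" "bundle_algebra d" p]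
  by (auto simp: space_bundle_algebra)

lemma transported_refl:
  assumes "sets V0 = sets (bundle_algebra d)"
  shows "transported d V0 V0 (\<lambda>p. p) (\<lambda>_. 0)"
  using assms distr_id2[of "bundle_algebra d" V0] by (simp add: transported_def density_1)

text \<open>A weight on the transported measure pulls back along \<open>Z\<close> to a weight on
  \<open>V0\<close>, and because weights are stored as logarithms the pulled-back one is simply
  added.\<close>

lemma transported_compose:
  assumes V0: "sets V0 = sets (bundle_algebra d)" and V: "transported d V0 V Z l"
    and T[measurable]: "T \<in> bundle_algebra d \<rightarrow>\<^sub>M bundle_algebra d" and k[measurable]: "k \<in> borel_measurable (bundle_algebra d)"
  shows "transported d V0 (distr (density V (\<lambda>p. ennreal (exp (k p)))) (bundle_algebra d) T)
    (\<lambda>p. T (Z p)) (\<lambda>p. l p + k (Z p))"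
proof -
  have Z[measurable]: "Z \<in> bundle_algebra d \<rightarrow>\<^sub>M bundle_algebra d" and l[measurable]: "l \<in> borel_measurable (bundle_algebra d)"
    and Ve: "V = distr (density V0 (\<lambda>p. ennreal (exp (l p)))) (bundle_algebra d) Z"
    using V by (auto simp: transported_def)
  let ?D = "density V0 (\<lambda>p. ennreal (exp (l p)))"
  have Z0: "Z \<in> V0 \<rightarrow>\<^sub>M bundle_algebra d" and l0: "l \<in> borel_measurable V0"
    using Z l by (simp_all add: measurable_cong_sets[OF V0 refl])
  have kZ: "(\<lambda>p. k (Z p)) \<in> borel_measurable V0" using measurable_compose[OF Z0 k] by simp
  have "density V (\<lambda>p. ennreal (exp (k p))) = distr (density ?D (\<lambda>p. ennreal (exp (k (Z p))))) (bundle_algebra d) Z"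
    unfolding Ve by (rule density_distr) (use Z0 in auto)
  also have "density ?D (\<lambda>p. ennreal (exp (k (Z p)))) = density V0 (\<lambda>p. ennreal (exp (l p + k (Z p))))"
    using l0 kZ by (subst density_density_eq) (auto simp: exp_add ennreal_mult')
  finally have "distr (density V (\<lambda>p. ennreal (exp (k p)))) (bundle_algebra d) T
      = distr (distr (density V0 (\<lambda>p. ennreal (exp (l p + k (Z p))))) (bundle_algebra d) Z) (bundle_algebra d) T" by simp
  also have "\<dots> = distr (density V0 (\<lambda>p. ennreal (exp (l p + k (Z p))))) (bundle_algebra d) (T \<circ> Z)"
    by (rule distr_distr) (use T Z0 in auto)
  finally show ?thesis unfolding transported_def by (auto simp: comp_def)
qed

lemma transported_integral:
  fixes g :: "_ \<Rightarrow> 'c::euclidean_space"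
  assumes V0: "sets V0 = sets (bundle_algebra d)" and V: "transported d V0 V Z l"
    and g: "g \<in> borel_measurable (bundle_algebra d)"
  shows "integral\<^sup>L V g = (\<integral>p. exp (l p) *\<^sub>R g (Z p) \<partial>V0)"
    and "integrable V g \<longleftrightarrow> integrable V0 (\<lambda>p. exp (l p) *\<^sub>R g (Z p))"
proof -
  have Z: "Z \<in> V0 \<rightarrow>\<^sub>M bundle_algebra d" and l: "l \<in> borel_measurable V0"
    and Ve: "V = distr (density V0 (\<lambda>p. ennreal (exp (l p)))) (bundle_algebra d) Z"
    using V by (auto simp: transported_def measurable_cong_sets[OF V0 refl])
  have gZ: "(\<lambda>p. g (Z p)) \<in> borel_measurable V0" by (rule measurable_compose[OF Z g])
  have le: "(\<lambda>p. exp (l p)) \<in> borel_measurable V0" using l by simp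
  have Zd: "Z \<in> density V0 (\<lambda>p. ennreal (exp (l p))) \<rightarrow>\<^sub>M bundle_algebra d" using Z by simp
  show "integral\<^sup>L V g = (\<integral>p. exp (l p) *\<^sub>R g (Z p) \<partial>V0)"
    unfolding Ve integral_distr[OF Zd g] by (rule integral_density[OF gZ le]) simp
  show "integrable V g \<longleftrightarrow> integrable V0 (\<lambda>p. exp (l p) *\<^sub>R g (Z p))"
    unfolding Ve integrable_distr_eq[OF Zd g] by (rule integrable_density[OF gZ le]) simp
qed

lemma transported_mass:
  assumes V0: "sets V0 = sets (bundle_algebra d)" and V: "transported d V0 V Z l" and m: "mass_le d m V" "0 \<le> m"
  shows "integrable V0 (\<lambda>p. exp (l p))" "(\<integral>p. exp (l p) \<partial>V0) \<le> m"
proof -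
  interpret finite_measure V by (rule mass_leD[OF m])
  have one: "(\<lambda>_. 1::real) \<in> borel_measurable (bundle_algebra d)" by simp
  show "integrable V0 (\<lambda>p. exp (l p))" using transported_integral(2)[OF V0 V one] by simp
  show "(\<integral>p. exp (l p) \<partial>V0) \<le> m"
    using transported_integral(1)[OF V0 V one] mass_leD(3)[OF m] by simp
qed

text \<open>A mean value estimate with both exponentials on the right: after integration each of
  them becomes a total mass.\<close>

lemma abs_exp_diff_le: "\<bar>exp x - exp y\<bar> \<le> \<bar>x - y\<bar> * (exp x + exp (y::real))"
proof -
  have *: "exp x - exp y \<le> (x - y) * exp x" for x y :: real
  proof -
    have "exp x * (1 + (y - x)) \<le> exp x * exp (y - x)" by (intro mult_left_mono exp_ge_add_one_self) simp
    then show ?thesis by (simp add: exp_diff algebra_simps)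
  qed
  show ?thesis
  proof (cases "y \<le> x")
    case True
    have e: "\<bar>exp x - exp y\<bar> = exp x - exp y" "\<bar>x - y\<bar> = x - y" using True by auto
    have "0 \<le> (x - y) * exp y" using True by simp
    then show ?thesis using *[of x y] unfolding e distrib_left by linarith
  next
    case False
    have e: "\<bar>exp x - exp y\<bar> = exp y - exp x" "\<bar>x - y\<bar> = y - x" using False by auto
    have "0 \<le> (y - x) * exp x" using False by simp
    then show ?thesis using *[of y x] unfolding e distrib_left by linarith
  qed
qed

text \<open>Both integrals are pulled back to \<open>V0\<close> and compared pointwise. The
  Lipschitz bound handles the moved points, the supremum bound the changed weights, and one constant
  \<open>b\<close> serves for both. The vector-valued \<open>g\<close> covers the kernel, its
  projected gradient and the test functions of the bounded Lipschitz distance alike.\<close>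

lemma coupling_bound:
  fixes g :: "_ \<Rightarrow> 'c::euclidean_space"
  assumes V0: "sets V0 = sets (bundle_algebra d)" and m: "0 \<le> m"
    and V: "transported d V0 V Z l" "mass_le d m V" and W: "transported d V0 W Y k" "mass_le d m W"
    and g: "continuous_on (grass_bundle d) g" and b: "0 \<le> b"
    and gb: "\<And>p. p \<in> grass_bundle d \<Longrightarrow> norm (g p) \<le> b"
    and gl: "\<And>p q. p \<in> grass_bundle d \<Longrightarrow> q \<in> grass_bundle d \<Longrightarrow> norm (g p - g q) \<le> b * bundle_dist p q"
    and r: "\<And>p. p \<in> grass_bundle d \<Longrightarrow> bundle_dist (Z p) (Y p) + \<bar>l p - k p\<bar> \<le> r"
    and r0: "0 \<le> r"
  shows "norm (integral\<^sup>L V g - integral\<^sup>L W g) \<le> 2 * m * b * r"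
proof -
  have gm: "g \<in> borel_measurable (bundle_algebra d)" by (rule bundle_measurable[OF refl g])
  note e1 = transported_mass[OF V0 V m] and e2 = transported_mass[OF V0 W m]
  have i1: "integrable V g" and i2: "integrable W g"
    using bundle_integral_bound(1)[OF V(2) m g _ b] bundle_integral_bound(1)[OF W(2) m g _ b] gb
    by (auto simp: grass_bundle_def)
  note j1 = transported_integral[OF V0 V(1) gm] and j2 = transported_integral[OF V0 W(1) gm]
  have d0: "0 \<le> bundle_dist p q" for p q :: "(real^'a) \<times> 'a endo" by (simp add: bundle_dist_def)
  have pt: "norm (exp (l p) *\<^sub>R g (Z p) - exp (k p) *\<^sub>R g (Y p)) \<le> b * r * (exp (l p) + exp (k p))"
    if "p \<in> space V0" for p
  proof -
    have p: "p \<in> grass_bundle d" using that by (simp add: bundle_space[OF V0])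
    note ZY = transported_bundle[OF V(1) p] transported_bundle[OF W(1) p]
    define x where "x = bundle_dist (Z p) (Y p)"
    define y where "y = \<bar>l p - k p\<bar>"
    define e where "e = exp (l p) + exp (k p)"
    have x0: "0 \<le> x" by (simp add: x_def d0)
    have e0: "0 \<le> e" "exp (l p) \<le> e" by (auto simp: e_def)
    have "exp (l p) *\<^sub>R g (Z p) - exp (k p) *\<^sub>R g (Y p) = exp (l p) *\<^sub>R (g (Z p) - g (Y p)) + (exp (l p) - exp (k p)) *\<^sub>R g (Y p)"
      by (simp add: scaleR_diff_right scaleR_diff_left)
    also have "norm \<dots> \<le> exp (l p) * norm (g (Z p) - g (Y p)) + \<bar>exp (l p) - exp (k p)\<bar> * norm (g (Y p))"
      by (rule order_trans[OF norm_triangle_ineq]) simp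
    also have "\<dots> \<le> e * (b * x) + (y * e) * b"
      using gl[OF ZY] gb[OF ZY(2)] abs_exp_diff_le[of "l p" "k p"] e0 b x0
      by (intro add_mono mult_mono) (auto simp: x_def y_def e_def)
    also have "\<dots> = b * (x + y) * e" by (simp add: algebra_simps)
    also have "\<dots> \<le> b * r * e" using r[OF p] b e0 by (intro mult_right_mono mult_left_mono) (auto simp: x_def y_def)
    finally show ?thesis by (simp add: e_def)
  qed
  have "norm (integral\<^sup>L V g - integral\<^sup>L W g) = norm (\<integral>p. exp (l p) *\<^sub>R g (Z p) - exp (k p) *\<^sub>R g (Y p) \<partial>V0)"
    using i1 i2 j1 j2 by simp
  also have "\<dots> \<le> (\<integral>p. b * r * (exp (l p) + exp (k p)) \<partial>V0)"
  proof (rule order_trans[OF integral_norm_bound], rule integral_mono)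
    show "integrable V0 (\<lambda>p. norm (exp (l p) *\<^sub>R g (Z p) - exp (k p) *\<^sub>R g (Y p)))"
      using i1 i2 j1(2) j2(2) by (intro integrable_norm Bochner_Integration.integrable_diff) auto
    show "integrable V0 (\<lambda>p. b * r * (exp (l p) + exp (k p)))"
      using e1(1) e2(1) by (intro integrable_mult_right Bochner_Integration.integrable_add)
  qed (rule pt)
  also have "\<dots> = b * r * ((\<integral>p. exp (l p) \<partial>V0) + (\<integral>p. exp (k p) \<partial>V0))" using e1(1) e2(1) by simp
  also have "\<dots> \<le> b * r * (m + m)"
    using e1(2) e2(2) b r0 by (intro mult_left_mono add_mono) auto
  finally show ?thesis by (simp add: algebra_simps)
qed


lemma euler_step_eq: "euler_step \<psi> \<epsilon> s V = (\<lambda>x. x + s *\<^sub>R approx_mean_curvature \<psi> \<epsilon> V x)"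
  by (simp add: euler_step_def fun_eq_iff)

context curvature
begin

text \<open>The Jacobian is at most 1 + s tr + O((s H)^2), and the integral of the trace is
  nonpositive. There are two mass bounds on purpose: \<open>m\<close> fixes the size of the field
  for all times, while \<open>m'\<close> is the current, sharper bound that is propagated.\<close>

lemma pushforward_mass_le:
  assumes F: "field_bounds H L (approx_mean_curvature \<psi> \<epsilon> V) (curvature_deriv \<psi> \<epsilon> V)"
    and s: "0 \<le> s" and small: "jac_const d * (s * H) \<le> 1" and m': "mass_le d m' V" "0 \<le> m'"
  shows "mass_le d (m' * (1 + jac_const d * (s * H)\<^sup>2)) (pushforward d (euler_step \<psi> \<epsilon> s V) V)"
proof -
  let ?B = "curvature_deriv \<psi> \<epsilon> V" and ?h = "approx_mean_curvature \<psi> \<epsilon> V"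
  let ?k = "step_ln_jac d s ?B" and ?tr = "\<lambda>p. grass_trace (snd p) (?B (fst p))"
  define c where "c = jac_const d * (s * H)\<^sup>2"
  have c0: "0 \<le> c" using jac_const_ge[of d] by (simp add: c_def)
  interpret f: finite_measure V by (rule mass_leD[OF V m0])
  have gr: "snd p \<in> grassmannian d" if "p \<in> grass_bundle d" for p :: "(real^'n) \<times> 'n endo"
    using that by (auto simp: grass_bundle_def)
  have kc: "continuous_on (grass_bundle d) (\<lambda>p. exp (?k p))"
    by (intro continuous_intros step_continuous(2)[OF F s small])
  have ki: "integrable V (\<lambda>p. exp (?k p))"
  proof (rule bundle_integral_bound(1)[OF V m0 kc, of "exp 1"])
    fix x and S :: "'n endo" assume S: "S \<in> grassmannian d"
    have "\<bar>?k (x, S)\<bar> \<le> 1"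
      unfolding step_ln_jac_def using jac_expand(4)[OF S step_small[OF F s small, of x]] step_small[OF F s small, of x] by simp
    then show "norm (exp (?k (x, S))) \<le> exp 1" by simp
  qed simp
  have "continuous_on (grass_bundle d) (\<lambda>p. ?B (fst p))"
    by (rule continuous_on_compose2[OF field_deriv_continuous[OF F]]) (auto intro: continuous_intros)
  then have tc: "continuous_on (grass_bundle d) ?tr"
    unfolding grass_trace_def
    by (intro continuous_on_sum continuous_on_inner blinfun.continuous_on continuous_on_const continuous_on_snd continuous_on_id)
  have ti: "integrable V ?tr"
  proof (rule bundle_integral_bound(1)[OF V m0 tc, of "real CARD('n) * H"])
    fix x and S :: "'n endo" assume S: "S \<in> grassmannian d"
    have "\<bar>grass_trace S (?B x) - grass_trace S 0\<bar> \<le> real CARD('n) * norm (?B x)"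
      using grass_trace_diff[OF S, of "?B x" S 0] by simp
    also have "\<dots> \<le> real CARD('n) * H" by (intro mult_left_mono field_boundsD(3)[OF F]) simp
    finally show "norm (?tr (x, S)) \<le> real CARD('n) * H" by (simp add: grass_trace_def)
  qed (simp add: field_boundsD(5)[OF F])
  have "(\<integral>p. exp (?k p) \<partial>V) \<le> (\<integral>p. (1 + c) + s * ?tr p \<partial>V)"
  proof (rule integral_mono)
    fix p assume "p \<in> space V"
    then have "p \<in> grass_bundle d" by (simp add: bundle_space[OF sets_V])
    from step_jac(2)[OF F s small this] show "exp (?k p) \<le> (1 + c) + s * ?tr p" by (simp add: c_def)
  qed (use ki ti in auto)
  also have "\<dots> = (1 + c) * measure V (space V) + s * (\<integral>p. ?tr p \<partial>V)" using ti by simp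
  also have "\<dots> \<le> (1 + c) * m' + s * 0"
    using mass_leD(3)[OF m'] c0 s curvature_divergence_nonpos by (intro add_mono mult_left_mono) auto
  finally have le: "(\<integral>p. exp (?k p) \<partial>V) \<le> m' * (1 + c)" by (simp add: mult.commute)
  have km: "?k \<in> borel_measurable V" by (rule bundle_measurable[OF sets_V step_continuous(2)[OF F s small]])
  have Tm: "step_map s ?h ?B \<in> V \<rightarrow>\<^sub>M bundle_algebra d"
    using measurable_bundle[OF step_continuous(1)[OF F s small] step_map_bundle[OF F s small]]
    by (simp add: measurable_cong_sets[OF sets_V refl])
  let ?P = "pushforward d (euler_step \<psi> \<epsilon> s V) V"
  have P: "?P = distr (density V (\<lambda>p. ennreal (exp (?k p)))) (bundle_algebra d) (step_map s ?h ?B)"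
    unfolding euler_step_eq by (rule pushforward_step[OF F s small sets_V])
  have sP: "space ?P = grass_bundle d" unfolding P by (simp add: space_bundle_algebra)
  have "emeasure ?P (space ?P) = emeasure (density V (\<lambda>p. ennreal (exp (?k p)))) (step_map s ?h ?B -` grass_bundle d \<inter> space V)"
    unfolding sP unfolding P using Tm sets.top[of "bundle_algebra d"]
    by (subst emeasure_distr) (auto simp: space_bundle_algebra)
  also have "\<dots> \<le> emeasure (density V (\<lambda>p. ennreal (exp (?k p)))) (space (density V (\<lambda>p. ennreal (exp (?k p)))))"
    by (rule emeasure_space)
  also have "\<dots> = (\<integral>\<^sup>+p. ennreal (exp (?k p)) \<partial>V)"
    using km by (subst emeasure_density) (auto intro!: nn_integral_cong)
  also have "\<dots> = ennreal (\<integral>p. exp (?k p) \<partial>V)" by (rule nn_integral_eq_integral[OF ki]) simp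
  also have "\<dots> \<le> ennreal (m' * (1 + c))" by (rule ennreal_leI[OF le])
  finally show ?thesis unfolding mass_le_def c_def[symmetric] by (simp add: pushforward_def)
qed

end

section \<open>The flow along trajectories\<close>

definition field_size :: "nat \<Rightarrow> real \<Rightarrow> real \<Rightarrow> real \<Rightarrow> real" where
  "field_size n C m \<kappa> = 2 * C * (1 + C * unit_ball_vol (real n)) * m * \<kappa> ^ 4"

definition field_lip :: "nat \<Rightarrow> real \<Rightarrow> real \<Rightarrow> real \<Rightarrow> real" where
  "field_lip n C m \<kappa> = 4 * unit_ball_vol (real n) * C\<^sup>2 * m * \<kappa> ^ (n + 6)"

text \<open>The case distinction copies \<open>flow_upto\<close>, so that flow and trajectories
  unfold in parallel. The second component accumulates the logarithm of the Jacobian.\<close>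

primrec flow_traj :: "nat \<Rightarrow> (real^'n::finite \<Rightarrow> real) \<Rightarrow> real \<Rightarrow> ((real^'n) \<times> 'n endo) measure \<Rightarrow>
    (nat \<Rightarrow> real) \<Rightarrow> nat \<Rightarrow> real \<Rightarrow> (real^'n) \<times> 'n endo \<Rightarrow> ((real^'n) \<times> 'n endo) \<times> real" where
  "flow_traj d \<psi> \<epsilon> V0 \<tau> 0 t p = (p, 0)"
| "flow_traj d \<psi> \<epsilon> V0 \<tau> (Suc i) t p =
     (if t \<le> \<tau> i then flow_traj d \<psi> \<epsilon> V0 \<tau> i t p
      else (let V = flow_upto d \<psi> \<epsilon> V0 \<tau> i (\<tau> i); q = flow_traj d \<psi> \<epsilon> V0 \<tau> i (\<tau> i) p
            in (step_map (t - \<tau> i) (approx_mean_curvature \<psi> \<epsilon> V) (curvature_deriv \<psi> \<epsilon> V) (fst q),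
                snd q + step_ln_jac d (t - \<tau> i) (curvature_deriv \<psi> \<epsilon> V) (fst q))))"

lemma flow_traj_stable:
  assumes "subdivision m \<tau>" "i \<le> k" "k \<le> m" "t \<le> \<tau> i"
  shows "flow_traj d \<psi> \<epsilon> V0 \<tau> k t p = flow_traj d \<psi> \<epsilon> V0 \<tau> i t p"
  using assms(2,3)
proof (induction k rule: dec_induct)
  case (step k)
  then have "t \<le> \<tau> k" using subdivision_mono[OF assms(1), of i k] assms(4) by simp
  then show ?case using step by simp
qed simp

text \<open>At a node \<open>flow_traj\<close> stays in the branch of the earlier interval; this
  makes the step formula valid on the closed interval as well.\<close>

lemma step_zero:
  assumes "p \<in> grass_bundle d"
  shows "step_map 0 h B p = p" "step_ln_jac d 0 B p = 0"
proof -
  have S: "snd p \<in> grassmannian d" using assms by (auto simp: grass_bundle_def)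
  have "blinfun_apply id_blinfun ` subspace_of (snd p) = subspace_of (snd p)" by simp
  then have "tangent_map id_blinfun (snd p) = snd p"
    unfolding tangent_map_def using orth_proj_subspace_of[OF S] by simp
  then show "step_map 0 h B p = p" by (simp add: step_map_def)
  show "step_ln_jac d 0 B p = 0"
    using jac_expand(4)[OF S, of 0] by (simp add: step_ln_jac_def)
qed

lemma mass_le_mono: "mass_le d m V \<Longrightarrow> m \<le> m' \<Longrightarrow> mass_le d m' V"
  unfolding mass_le_def using ennreal_leI order_trans by blast

text \<open>\<open>H\<close> and \<open>L\<close> are the field bounds for mass
  \<open>M + 1\<close>, valid at all times. The condition \<open>\<delta>1\<close> keeps every step
  in the range of the expansions; its factor 2 is that of \<open>tangent_increment\<close>, where
  the matrix relative to the current plane may be twice as large. The condition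
  \<open>\<delta>2\<close> makes the mass gained in a step at most its length.\<close>

locale euler_flow = mollifier "kernel \<psi> \<epsilon>" C \<kappa>
  for \<psi> :: "real^'n::finite \<Rightarrow> real" and \<epsilon> C \<kappa> :: real +
  fixes d :: nat and M \<delta> H L N :: real and V0 :: "((real^'n) \<times> 'n endo) measure"
  assumes eps: "0 < \<epsilon>" and \<kappa>_eq: "\<kappa> = 1 / \<epsilon>" and d: "d \<le> CARD('n)" and M1: "1 \<le> M" and V0: "mass_le d M V0"
    and H_eq: "H = field_size CARD('n) C (M + 1) \<kappa>" and L_eq: "L = field_lip CARD('n) C (M + 1) \<kappa>"
    and N_eq: "N = jac_const CARD('n)"
    and \<delta>0: "0 \<le> \<delta>" and \<delta>1: "N * (2 * (\<delta> * H)) \<le> 1" and \<delta>2: "N * (\<delta> * H\<^sup>2) * (M + 1) \<le> 1"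
begin

lemma sets_V0: "sets V0 = sets (bundle_algebra d)" using V0 by (simp add: mass_le_def)

lemma curvatureI: "mass_le d (M + 1) V \<Longrightarrow> curvature \<psi> \<epsilon> C \<kappa> d (M + 1) V"
  by unfold_locales (use eps \<kappa>_eq M1 in auto)

lemma field: "mass_le d (M + 1) V \<Longrightarrow> field_bounds H L (approx_mean_curvature \<psi> \<epsilon> V) (curvature_deriv \<psi> \<epsilon> V)"
  using curvature.curvature_field[OF curvatureI] by (simp add: H_eq L_eq field_size_def field_lip_def)

lemma H0: "0 \<le> H" using C0 \<kappa>0 M1 by (simp add: H_eq field_size_def)

lemma N6: "6 \<le> N" "jac_const d \<le> N" "6 \<le> jac_const d"
  using jac_const_ge jac_const_mono[OF d] by (auto simp: N_eq)

lemma small2: "0 \<le> s \<Longrightarrow> s \<le> \<delta> \<Longrightarrow> jac_const d * (2 * (s * H)) \<le> 1"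
proof -
  assume "0 \<le> s" "s \<le> \<delta>"
  then have "jac_const d * (2 * (s * H)) \<le> N * (2 * (\<delta> * H))"
    using N6 H0 by (intro mult_mono) auto
  then show ?thesis using \<delta>1 by (rule order_trans)
qed

lemma small: "0 \<le> s \<Longrightarrow> s \<le> \<delta> \<Longrightarrow> jac_const d * (s * H) \<le> 1"
  using small2[of s] H0 N6 mult_nonneg_nonneg[of "jac_const d" "s * H"] by simp

lemma half: "0 \<le> s \<Longrightarrow> s \<le> \<delta> \<Longrightarrow> s * H \<le> 1/2"
proof -
  assume s: "0 \<le> s" "s \<le> \<delta>"
  have "6 * (s * H) \<le> jac_const d * (s * H)" using N6 s H0 by (intro mult_right_mono) auto
  then show ?thesis using small[OF s] by simp
qed

abbreviation "flow m \<tau> t \<equiv> amcf d \<psi> \<epsilon> V0 m \<tau> t"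
abbreviation "pos m \<tau> t p \<equiv> fst (flow_traj d \<psi> \<epsilon> V0 \<tau> m t p)"
abbreviation "lnj m \<tau> t p \<equiv> snd (flow_traj d \<psi> \<epsilon> V0 \<tau> m t p)"

context
  fixes m :: nat and \<tau> :: "nat \<Rightarrow> real"
  assumes sub: "subdivision m \<tau>" and mesh: "\<forall>i<m. \<tau> (Suc i) - \<tau> i \<le> \<delta>"
begin

text \<open>Transport and mass are proved together, since the field bounds for the next step
  presuppose the mass bound at the node. The invariant \<open>M + t\<close> grows linearly and
  therefore stays below \<open>M + 1\<close> on the unit interval.\<close>

lemma flow_upto_transported:
  assumes "i \<le> m" "0 \<le> t" "t \<le> \<tau> i"
  shows "transported d V0 (flow_upto d \<psi> \<epsilon> V0 \<tau> i t) (\<lambda>p. fst (flow_traj d \<psi> \<epsilon> V0 \<tau> i t p)) (\<lambda>p. snd (flow_traj d \<psi> \<epsilon> V0 \<tau> i t p))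
    \<and> mass_le d (M + t) (flow_upto d \<psi> \<epsilon> V0 \<tau> i t)"
  using assms
proof (induction i arbitrary: t)
  case 0
  then have "t = 0" using sub by (simp add: subdivision_def)
  then show ?case using transported_refl[OF sets_V0] V0 by simp
next
  case (Suc i)
  show ?case
  proof (cases "t \<le> \<tau> i")
    case True
    then show ?thesis using Suc by simp
  next
    case False
    define U where "U = flow_upto d \<psi> \<epsilon> V0 \<tau> i (\<tau> i)"
    define s where "s = t - \<tau> i"
    have \<tau>i: "0 \<le> \<tau> i" "\<tau> i \<le> 1"
      using subdivision_mono[OF sub, of 0 i] subdivision_mono[OF sub, of i m] Suc(2) sub by (auto simp: subdivision_def)
    have s: "0 \<le> s" "s \<le> \<delta>" using False Suc(2,4) mesh[rule_format, of i] by (auto simp: s_def)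
    have IH: "transported d V0 U (\<lambda>p. fst (flow_traj d \<psi> \<epsilon> V0 \<tau> i (\<tau> i) p)) (\<lambda>p. snd (flow_traj d \<psi> \<epsilon> V0 \<tau> i (\<tau> i) p))"
      "mass_le d (M + \<tau> i) U"
      using Suc.IH[of "\<tau> i"] Suc(2) \<tau>i unfolding U_def by auto
    have U: "mass_le d (M + 1) U" using mass_le_mono[OF IH(2)] \<tau>i by simp
    interpret U: curvature \<psi> \<epsilon> C \<kappa> d "M + 1" U by (rule curvatureI[OF U])
    note F = field[OF U] and sm = small[OF s]
    have e: "flow_upto d \<psi> \<epsilon> V0 \<tau> (Suc i) t = pushforward d (euler_step \<psi> \<epsilon> s U) U"
      using False by (simp add: U_def s_def Let_def)
    have p: "pushforward d (euler_step \<psi> \<epsilon> s U) U =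
        distr (density U (\<lambda>p. ennreal (exp (step_ln_jac d s (curvature_deriv \<psi> \<epsilon> U) p)))) (bundle_algebra d)
          (step_map s (approx_mean_curvature \<psi> \<epsilon> U) (curvature_deriv \<psi> \<epsilon> U))"
      unfolding euler_step_eq by (rule pushforward_step[OF F s(1) sm U.sets_V])
    have tr: "flow_traj d \<psi> \<epsilon> V0 \<tau> (Suc i) t p =
       (step_map s (approx_mean_curvature \<psi> \<epsilon> U) (curvature_deriv \<psi> \<epsilon> U) (fst (flow_traj d \<psi> \<epsilon> V0 \<tau> i (\<tau> i) p)),
        snd (flow_traj d \<psi> \<epsilon> V0 \<tau> i (\<tau> i) p) + step_ln_jac d s (curvature_deriv \<psi> \<epsilon> U) (fst (flow_traj d \<psi> \<epsilon> V0 \<tau> i (\<tau> i) p)))" for p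
      using False by (simp add: U_def s_def Let_def)
    have "transported d V0 (flow_upto d \<psi> \<epsilon> V0 \<tau> (Suc i) t) (\<lambda>p. fst (flow_traj d \<psi> \<epsilon> V0 \<tau> (Suc i) t p)) (\<lambda>p. snd (flow_traj d \<psi> \<epsilon> V0 \<tau> (Suc i) t p))"
      unfolding e p tr fst_conv snd_conv
      by (rule transported_compose[OF sets_V0 IH(1)])
        (rule measurable_bundle[OF step_continuous(1)[OF F s(1) sm] step_map_bundle[OF F s(1) sm]]
          bundle_measurable[OF refl step_continuous(2)[OF F s(1) sm]], assumption?)+
    moreover have "mass_le d (M + t) (flow_upto d \<psi> \<epsilon> V0 \<tau> (Suc i) t)"
    proof -
      \<comment> \<open>The gain is quadratic in \<open>s\<close>: one factor \<open>s\<close> is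
        kept as the increase of \<open>t\<close>, the other is bounded by \<open>\<delta>\<close>
        and used up by \<open>\<delta>2\<close>.\<close>
      have "(M + \<tau> i) * (jac_const d * (s * H)\<^sup>2) = s * (jac_const d * (s * H\<^sup>2) * (M + \<tau> i))"
        by (simp add: power2_eq_square)
      also have "\<dots> \<le> s * (N * (\<delta> * H\<^sup>2) * (M + 1))"
        using s N6 \<tau>i M1 by (intro mult_left_mono mult_mono) auto
      also have "\<dots> \<le> s * 1" using s(1) \<delta>2 by (rule mult_left_mono[rotated])
      finally have "(M + \<tau> i) * (1 + jac_const d * (s * H)\<^sup>2) \<le> M + t" by (simp add: distrib_left s_def)
      moreover have "mass_le d ((M + \<tau> i) * (1 + jac_const d * (s * H)\<^sup>2)) (pushforward d (euler_step \<psi> \<epsilon> s U) U)"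
        by (rule U.pushforward_mass_le[OF F s(1) sm IH(2)]) (use M1 \<tau>i in simp)
      ultimately show ?thesis unfolding e by (rule mass_le_mono[rotated])
    qed
    ultimately show ?thesis ..
  qed
qed

lemma flow_transported:
  assumes "t \<in> {0..1}"
  shows "transported d V0 (flow m \<tau> t) (pos m \<tau> t) (lnj m \<tau> t)" "mass_le d (M + t) (flow m \<tau> t)" "mass_le d (M + 1) (flow m \<tau> t)"
proof -
  have "t \<le> \<tau> m" using assms sub by (simp add: subdivision_def)
  then show "transported d V0 (flow m \<tau> t) (pos m \<tau> t) (lnj m \<tau> t)" and m: "mass_le d (M + t) (flow m \<tau> t)"
    using flow_upto_transported[of m t] assms by (auto simp: amcf_def)
  show "mass_le d (M + 1) (flow m \<tau> t)" using mass_le_mono[OF m] assms by simp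
qed

lemma node_in_unit: "i \<le> m \<Longrightarrow> \<tau> i \<in> {0..1}"
  using subdivision_mono[OF sub, of 0 i] subdivision_mono[OF sub, of i m] sub by (auto simp: subdivision_def)

lemma traj_step:
  assumes i: "i < m" and t: "t \<in> {\<tau> i..\<tau> (Suc i)}" and p: "p \<in> grass_bundle d"
  defines "U \<equiv> flow m \<tau> (\<tau> i)"
  shows "pos m \<tau> t p = step_map (t - \<tau> i) (approx_mean_curvature \<psi> \<epsilon> U) (curvature_deriv \<psi> \<epsilon> U) (pos m \<tau> (\<tau> i) p)"
    and "lnj m \<tau> t p = lnj m \<tau> (\<tau> i) p + step_ln_jac d (t - \<tau> i) (curvature_deriv \<psi> \<epsilon> U) (pos m \<tau> (\<tau> i) p)"
proof -
  have zb: "pos m \<tau> (\<tau> i) p \<in> grass_bundle d"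
    by (rule transported_bundle[OF flow_transported(1)[OF node_in_unit] p]) (use i in simp)
  have U: "U = flow_upto d \<psi> \<epsilon> V0 \<tau> i (\<tau> i)"
    unfolding U_def amcf_def by (rule flow_upto_stable[OF sub]) (use i in auto)
  have T: "flow_traj d \<psi> \<epsilon> V0 \<tau> m (\<tau> i) p = flow_traj d \<psi> \<epsilon> V0 \<tau> i (\<tau> i) p"
    by (rule flow_traj_stable[OF sub]) (use i in auto)
  have Tt: "flow_traj d \<psi> \<epsilon> V0 \<tau> m t p = flow_traj d \<psi> \<epsilon> V0 \<tau> (Suc i) t p"
    by (rule flow_traj_stable[OF sub]) (use i t in auto)
  show "pos m \<tau> t p = step_map (t - \<tau> i) (approx_mean_curvature \<psi> \<epsilon> U) (curvature_deriv \<psi> \<epsilon> U) (pos m \<tau> (\<tau> i) p)"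
    "lnj m \<tau> t p = lnj m \<tau> (\<tau> i) p + step_ln_jac d (t - \<tau> i) (curvature_deriv \<psi> \<epsilon> U) (pos m \<tau> (\<tau> i) p)"
    using t step_zero[OF zb] by (cases "t = \<tau> i"; simp add: Tt T U Let_def)+
qed

lemma traj_zero: "pos m \<tau> 0 p = p" "lnj m \<tau> 0 p = 0"
proof -
  have "flow_traj d \<psi> \<epsilon> V0 \<tau> m 0 p = flow_traj d \<psi> \<epsilon> V0 \<tau> 0 0 p"
    by (rule flow_traj_stable[OF sub]) (use sub in \<open>auto simp: subdivision_def\<close>)
  then show "pos m \<tau> 0 p = p" "lnj m \<tau> 0 p = 0" by simp_all
qed

lemma well_defined: "flow_well_defined d \<psi> \<epsilon> M V0 m \<tau>"
  unfolding flow_well_defined_def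
proof (intro conjI allI impI ballI)
  fix i t assume i: "i < m" and t: "t \<in> {\<tau> i..\<tau> (Suc i)}"
  have s: "0 \<le> t - \<tau> i" "t - \<tau> i \<le> \<delta>" using t mesh[rule_format, OF i] by auto
  show "C1_diffeo (euler_step \<psi> \<epsilon> (t - \<tau> i) (flow m \<tau> (\<tau> i)))"
    unfolding euler_step_eq
    by (rule C1_diffeo_step[OF field[OF flow_transported(3)[OF node_in_unit]] s(1) half[OF s]]) (use i in simp)
next
  fix t :: real assume t: "t \<in> {0..1}"
  note m = flow_transported(3)[OF t]
  have s: "sets (flow m \<tau> t) = sets (bundle_algebra d)" using m by (simp add: mass_le_def)
  have "fst \<in> borel_measurable (flow m \<tau> t)" by (intro bundle_measurable[OF s] continuous_intros)
  then have "emeasure (weight (flow m \<tau> t)) UNIV = emeasure (flow m \<tau> t) (space (flow m \<tau> t))"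
    unfolding weight_def by (subst emeasure_distr) auto
  then show "emeasure (weight (flow m \<tau> t)) UNIV \<le> ennreal (M + 1)" using m by (simp add: mass_le_def)
qed

end

end

section \<open>Comparison of two flows\<close>

lemma subdivision_interval:
  assumes \<tau>: "subdivision m \<tau>" and t: "0 < t" "t \<le> 1"
  shows "\<exists>i<m. \<tau> i < t \<and> t \<le> \<tau> (Suc i)"
proof -
  have m: "\<tau> 0 = 0" "\<tau> m = 1" using \<tau> by (auto simp: subdivision_def)
  have "\<exists>i<k. \<tau> i < t \<and> t \<le> \<tau> (Suc i)" if "t \<le> \<tau> k" for k
    using that
  proof (induction k)
    case (Suc k)
    show ?case
    proof (cases "t \<le> \<tau> k")
      case True
      then obtain i where "i < k" "\<tau> i < t \<and> t \<le> \<tau> (Suc i)" using Suc by auto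
      then show ?thesis using less_SucI by blast
    next
      case False
      then have "\<tau> k < t \<and> t \<le> \<tau> (Suc k)" using Suc(2) by simp
      then show ?thesis by blast
    qed
  qed (use t m in simp)
  from this[of m] show ?thesis using m t by simp
qed

text \<open>Induction on the number of nodes of both grids below \<open>t\<close>. From the last
  such node \<open>a\<close> up to \<open>t\<close> neither grid has a node in between, so both
  flows use fixed fields there and \<open>step\<close> applies. \<open>P t r\<close> stands for "the
  distance at time t is at most r"; this avoids introducing a supremum over trajectories as a
  function of time.\<close>

lemma two_grid_gronwall:
  fixes P :: "real \<Rightarrow> real \<Rightarrow> bool"
  assumes \<tau>1: "subdivision m1 \<tau>1" and \<tau>2: "subdivision m2 \<tau>2" and RQ: "0 \<le> R" "0 \<le> Q"
    and zero: "P 0 0" and mono: "\<And>t r r'. P t r \<Longrightarrow> r \<le> r' \<Longrightarrow> P t r'"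
    and step: "\<And>a b i j r. i < m1 \<Longrightarrow> j < m2 \<Longrightarrow> \<tau>1 i \<le> a \<Longrightarrow> \<tau>2 j \<le> a \<Longrightarrow> a \<le> b \<Longrightarrow> b \<le> \<tau>1 (Suc i) \<Longrightarrow>
      b \<le> \<tau>2 (Suc j) \<Longrightarrow> 0 \<le> r \<Longrightarrow> P a r \<Longrightarrow> P b (r + (b - a) * (R * r + Q))"
  shows "t \<in> {0..1} \<Longrightarrow> P t (t * Q * exp (R * t))"
proof -
  define D where "D = \<tau>1 ` {..m1} \<union> \<tau>2 ` {..m2}"
  have D: "finite D" "0 \<in> D" using \<tau>1 by (auto simp: D_def subdivision_def intro: image_eqI[of _ _ 0])
  have D0: "0 \<le> x" if "x \<in> D" for x
    using that subdivision_mono[OF \<tau>1, of 0] subdivision_mono[OF \<tau>2, of 0] \<tau>1 \<tau>2 by (auto simp: D_def subdivision_def)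
  show "P t (t * Q * exp (R * t))" if "t \<in> {0..1}"
    using that
  proof (induction "card {x \<in> D. x < t}" arbitrary: t rule: less_induct)
    case less
    show ?case
    proof (cases "t = 0")
      case True
      then show ?thesis using zero by simp
    next
      case False
      then have t: "0 < t" "t \<le> 1" using less(2) by auto
      define a where "a = Max {x \<in> D. x < t}"
      have fin: "finite {x \<in> D. x < t}" using D by simp
      have "a \<in> {x \<in> D. x < t}" unfolding a_def using fin D(2) t by (intro Max_in) auto
      then have a: "a \<in> D" "a < t" "0 \<le> a" using D0 by auto
      have le: "x \<le> a" if "x \<in> D" "x < t" for x unfolding a_def using fin that by (intro Max_ge) auto
      have "{x \<in> D. x < a} \<subset> {x \<in> D. x < t}" using a by auto
      then have "card {x \<in> D. x < a} < card {x \<in> D. x < t}" by (rule psubset_card_mono[OF fin])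
      from less(1)[OF this] have IH: "P a (a * Q * exp (R * a))" using a t by simp
      obtain i where i: "i < m1" "\<tau>1 i < t" "t \<le> \<tau>1 (Suc i)" using subdivision_interval[OF \<tau>1 t] by blast
      obtain j where j: "j < m2" "\<tau>2 j < t" "t \<le> \<tau>2 (Suc j)" using subdivision_interval[OF \<tau>2 t] by blast
      have "\<tau>1 i \<le> a" "\<tau>2 j \<le> a" using i j by (auto intro!: le simp: D_def)
      moreover define r where "r = a * Q * exp (R * a)"
      have r0: "0 \<le> r" using a RQ by (simp add: r_def)
      ultimately have P: "P t (r + (t - a) * (R * r + Q))"
        using step[OF i(1) j(1) _ _ _ i(3) j(3) r0] IH a by (simp add: r_def)
      \<comment> \<open>Here 1 + x <= exp x turns one explicit step into the exponential; the source
        term \<open>Q\<close> over the interval is enlarged by exp(R t) to match the claimed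
        form.\<close>
      have "r * (1 + R * (t - a)) \<le> r * exp (R * (t - a))" using r0 by (intro mult_left_mono exp_ge_add_one_self)
      also have "r * exp (R * (t - a)) = a * Q * exp (R * t)"
        unfolding r_def mult.assoc exp_add[symmetric] by (simp add: algebra_simps)
      finally have "r + (t - a) * (R * r) \<le> a * Q * exp (R * t)" by (simp add: algebra_simps)
      moreover have "(t - a) * Q * 1 \<le> (t - a) * Q * exp (R * t)"
        using a t RQ by (intro mult_left_mono) auto
      ultimately have "r + (t - a) * (R * r + Q) \<le> t * Q * exp (R * t)" by (simp add: algebra_simps)
      with P show ?thesis by (rule mono)
    qed
  qed
qed

lemma bundle_dist_triangle: "bundle_dist p r \<le> bundle_dist p q + bundle_dist q r"
  unfolding bundle_dist_def
  using norm_triangle_ineq[of "fst p - fst q" "fst q - fst r"] norm_triangle_ineq[of "snd p - snd q" "snd q - snd r"] by simp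

lemma bundle_dist_commute: "bundle_dist p q = bundle_dist q p"
  by (simp add: bundle_dist_def norm_minus_commute)

text \<open>The 14 is 2 + 12: one part from the difference of the smoothed variations, one from the
  difference of the smoothed weights times the bounded quotient. Both are of order \<kappa>^(n+5)
  once divided by \<epsilon>, and the outer convolution adds
  \<open>\<kappa>\<^sup>2\<close>.\<close>

definition curvature_lip :: "nat \<Rightarrow> real \<Rightarrow> real \<Rightarrow> real \<Rightarrow> real" where
  "curvature_lip n C m \<kappa> = 14 * (1 + C * unit_ball_vol (real n)) * C\<^sup>2 * m\<^sup>2 * \<kappa> ^ (n + 7)"

context euler_flow
begin

abbreviation close :: "((real^'n) \<times> 'n endo \<Rightarrow> (real^'n) \<times> 'n endo) \<Rightarrow> ((real^'n) \<times> 'n endo \<Rightarrow> real) \<Rightarrow>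
    ((real^'n) \<times> 'n endo \<Rightarrow> (real^'n) \<times> 'n endo) \<Rightarrow> ((real^'n) \<times> 'n endo \<Rightarrow> real) \<Rightarrow> real \<Rightarrow> bool" where
  "close Z l Y k r \<equiv> \<forall>p\<in>grass_bundle d. bundle_dist (Z p) (Y p) + \<bar>l p - k p\<bar> \<le> r"

lemma curvature_close:
  assumes V: "transported d V0 V Z l" "mass_le d (M + 1) V" and W: "transported d V0 W Y k" "mass_le d (M + 1) W"
    and r: "close Z l Y k r" "0 \<le> r"
  shows "norm (approx_mean_curvature \<psi> \<epsilon> V x - approx_mean_curvature \<psi> \<epsilon> W x) \<le> curvature_lip CARD('n) C (M + 1) \<kappa> * r"
    and "norm (curvature_deriv \<psi> \<epsilon> V x - curvature_deriv \<psi> \<epsilon> W x) \<le> curvature_lip CARD('n) C (M + 1) \<kappa> * r"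
proof -
  let ?n = "CARD('n)" and ?m = "M + 1" and ?\<omega> = "unit_ball_vol (real CARD('n))"
  interpret cV: curvature \<psi> \<epsilon> C \<kappa> d ?m V by (rule curvatureI[OF V(2)])
  interpret cW: curvature \<psi> \<epsilon> C \<kappa> d ?m W by (rule curvatureI[OF W(2)])
  \<comment> \<open>\<open>b1\<close> and \<open>b2\<close> must dominate both supremum and
    Lipschitz constant of the integrands, the kernel and its projected gradient. The 3 comes from
    \<open>bound\<close>; in \<open>b2\<close> the Lipschitz constant of the gradient is the larger
    one.\<close>
  define b1 where "b1 = 3 * C * \<kappa> ^ (?n + 2)"
  define b2 where "b2 = C * \<kappa> ^ (?n + 4)"
  have b: "0 \<le> b1" "0 \<le> b2" using C0 \<kappa>0 by (auto simp: b1_def b2_def)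
  have g2: "C * \<kappa> ^ (?n + 2) \<le> b2" unfolding b2_def using C0 \<kappa>1 by (intro mult_left_mono power_increasing) auto
  have g1: "C * \<kappa> ^ (?n + 2) \<le> b1" unfolding b1_def using C0 \<kappa>0 by simp
  have rr: "bundle_dist (Z p) (Y p) + \<bar>l p - k p\<bar> \<le> r" if "p \<in> grass_bundle d" for p using r that by blast
  note cb = coupling_bound[OF sets_V0 _ V W _ _ _ _ rr r(2)]
  have fb: "norm (fst p - fst q) \<le> bundle_dist p q" for p q :: "(real^'n) \<times> 'n endo" by (simp add: bundle_dist_def)
  have w: "\<bar>smoothed_weight \<psi> \<epsilon> V y - smoothed_weight \<psi> \<epsilon> W y\<bar> \<le> 2 * ?m * b1 * r" for y
    unfolding cV.smoothed_weight_eq cW.smoothed_weight_eq real_norm_def[symmetric]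
  proof (rule cb[OF cV.m0 cV.continuous_bundle(1) b(1)])
    fix p q :: "(real^'n) \<times> 'n endo"
    show "norm (kernel \<psi> \<epsilon> (fst p - y)) \<le> b1" using bound[of "fst p - y"] nonneg[of "fst p - y"] by (simp add: b1_def)
    have "norm (kernel \<psi> \<epsilon> (fst p - y) - kernel \<psi> \<epsilon> (fst q - y)) \<le> C * \<kappa> ^ (?n + 2) * norm (fst p - fst q)"
      using lipschitz[of "fst p - y" "fst q - y"] by simp
    also have "\<dots> \<le> b1 * bundle_dist p q" using g1 fb b by (intro mult_mono) auto
    finally show "norm (kernel \<psi> \<epsilon> (fst p - y) - kernel \<psi> \<epsilon> (fst q - y)) \<le> b1 * bundle_dist p q" .
  qed
  have v: "norm (smoothed_variation \<psi> \<epsilon> V y - smoothed_variation \<psi> \<epsilon> W y) \<le> 2 * ?m * b2 * r" for y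
    unfolding cV.smoothed_variation_eq cW.smoothed_variation_eq
  proof (rule cb[OF cV.m0 cV.continuous_bundle(2) b(2)])
    let ?g = "gradient (kernel \<psi> \<epsilon>)"
    fix p q :: "(real^'n) \<times> 'n endo" assume p: "p \<in> grass_bundle d"
    have S: "snd p \<in> grassmannian d" using p by (auto simp: grass_bundle_def)
    show "norm (blinfun_apply (snd p) (?g (fst p - y))) \<le> b2"
      by (rule cV.grass_apply_le[OF S order_trans[OF gradient_bound g2]])
    have "blinfun_apply (snd p) (?g (fst p - y)) - blinfun_apply (snd q) (?g (fst q - y))
        = blinfun_apply (snd p) (?g (fst p - y) - ?g (fst q - y)) + blinfun_apply (snd p - snd q) (?g (fst q - y))"
      by (simp add: blinfun.diff_left blinfun.diff_right)
    also have "norm \<dots> \<le> norm (?g (fst p - y) - ?g (fst q - y)) + norm (snd p - snd q) * norm (?g (fst q - y))"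
      by (intro order_trans[OF norm_triangle_ineq] add_mono grassmannian_contract(1)[OF S] norm_blinfun)
    also have "\<dots> \<le> b2 * norm (fst p - fst q) + norm (snd p - snd q) * b2"
      using gradient_lipschitz[of "fst p - y" "fst q - y"] order_trans[OF gradient_bound g2]
      by (intro add_mono mult_left_mono) (auto simp: b2_def)
    finally show "norm (blinfun_apply (snd p) (?g (fst p - y)) - blinfun_apply (snd q) (?g (fst q - y))) \<le> b2 * bundle_dist p q"
      by (simp add: bundle_dist_def distrib_left mult.commute)
  qed
  let ?K = "(1 + C * ?\<omega>) * \<kappa>\<^sup>2 * (2 * ?m * b2 * r * \<kappa> + 2 * ?m * b1 * r * \<kappa> * (2 * C * ?m * \<kappa>\<^sup>2))"
  have "?K \<le> curvature_lip ?n C ?m \<kappa> * r"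
  proof -
    define q where "q = \<kappa> ^ (?n + 5) * r"
    have q0: "0 \<le> q" using \<kappa>0 r(2) by (simp add: q_def)
    have e1: "2 * ?m * b2 * r * \<kappa> = 2 * (C * ?m) * q"
      by (simp add: q_def b2_def power_add numeral_eq_Suc)
    have e2: "2 * ?m * b1 * r * \<kappa> * (2 * C * ?m * \<kappa>\<^sup>2) = 12 * (C * ?m)\<^sup>2 * q"
      by (simp add: q_def b1_def power_add numeral_eq_Suc)
    have "C * ?m \<le> (C * ?m)\<^sup>2"
      using mult_mono[OF C1 cV.m1] C0 cV.m0 mult_left_mono[of 1 "C * ?m" "C * ?m"] by (simp add: power2_eq_square)
    then have "2 * (C * ?m) * q + 12 * (C * ?m)\<^sup>2 * q \<le> 14 * (C * ?m)\<^sup>2 * q"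
      using mult_right_mono[OF _ q0, of "C * ?m" "(C * ?m)\<^sup>2"] by linarith
    then have "?K \<le> (1 + C * ?\<omega>) * \<kappa>\<^sup>2 * (14 * (C * ?m)\<^sup>2 * q)"
      unfolding e1 e2 using C0 by (intro mult_left_mono) auto
    also have "\<dots> = curvature_lip ?n C ?m \<kappa> * r"
      by (simp add: curvature_lip_def q_def power_add power_mult_distrib numeral_eq_Suc)
    finally show ?thesis .
  qed
  then show "norm (approx_mean_curvature \<psi> \<epsilon> V x - approx_mean_curvature \<psi> \<epsilon> W x) \<le> curvature_lip ?n C ?m \<kappa> * r"
    "norm (curvature_deriv \<psi> \<epsilon> V x - curvature_deriv \<psi> \<epsilon> W x) \<le> curvature_lip ?n C ?m \<kappa> * r"
    using cV.curvature_diff[OF W(2) w v] by (auto intro: order_trans)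
qed

text \<open>How far a trajectory has moved since its last node. This measures the error of
  evaluating the field there; 4 is 1 for the position plus 3 for the plane, and \<open>N\<close>
  accounts for the logarithm of the Jacobian.\<close>

lemma traj_displacement:
  assumes \<tau>: "subdivision m \<tau>" "\<forall>i<m. \<tau> (Suc i) - \<tau> i \<le> \<delta>"
    and i: "i < m" and t: "t \<in> {\<tau> i..\<tau> (Suc i)}" and p: "p \<in> grass_bundle d"
  shows "bundle_dist (pos m \<tau> t p) (pos m \<tau> (\<tau> i) p) + \<bar>lnj m \<tau> t p - lnj m \<tau> (\<tau> i) p\<bar> \<le> (4 + N) * (\<delta> * H)"
proof -
  have s: "0 \<le> t - \<tau> i" "t - \<tau> i \<le> \<delta>" using t \<tau>(2)[rule_format, OF i] by auto
  have ti: "\<tau> i \<in> {0..1}" using node_in_unit[OF \<tau>, of i] i by simp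
  note V = flow_transported[OF \<tau> ti]
  have F: "field_bounds H L (approx_mean_curvature \<psi> \<epsilon> (amcf d \<psi> \<epsilon> V0 m \<tau> (\<tau> i))) (curvature_deriv \<psi> \<epsilon> (amcf d \<psi> \<epsilon> V0 m \<tau> (\<tau> i)))"
    by (rule field[OF V(3)])
  define q where "q = pos m \<tau> (\<tau> i) p"
  have "q \<in> grass_bundle d" unfolding q_def by (rule transported_bundle[OF V(1) p])
  then have S: "snd q \<in> grassmannian d" by (auto simp: grass_bundle_def)
  note st = traj_step[OF \<tau> i t p, folded q_def]
  have "norm ((t - \<tau> i) *\<^sub>R approx_mean_curvature \<psi> \<epsilon> (amcf d \<psi> \<epsilon> V0 m \<tau> (\<tau> i)) (fst q)) \<le> \<delta> * H"
    using s field_boundsD(2)[OF F, of "fst q"] \<delta>0 by (auto intro!: mult_mono)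
  moreover have "(3 + jac_const d) * (\<delta> * H) \<le> (3 + N) * (\<delta> * H)"
    using N6 \<delta>0 H0 by (intro mult_right_mono) auto
  moreover have "(4 + N) * (\<delta> * H) = \<delta> * H + (3 + N) * (\<delta> * H)" by (simp add: algebra_simps)
  ultimately show ?thesis
    unfolding q_def[symmetric] st bundle_dist_def step_map_def step_ln_jac_def
    using tangent_displacement[OF S field_boundsD(3)[OF F] s small[OF \<delta>0 order_refl], of "fst q"] by simp
qed

text \<open>The growth rate of the distance of trajectories. Position contributes
  \<open>curvature_lip\<close> and \<open>H\<close> once; plane and Jacobian contribute
  \<open>curvature_lip\<close> and \<open>L\<close> with the factor 2 + n and \<open>H\<close> with
  6 + n, as in \<open>tangent_pair_step\<close>. The coefficient of \<open>L\<close> is rounded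
  up.\<close>

definition G :: real where
  "G = (3 + real CARD('n)) * (curvature_lip CARD('n) C (M + 1) \<kappa> + L) + (7 + real CARD('n)) * H"

text \<open>The source term per unit of \<delta>. The first summand is the rate \<open>G\<close>
  applied to the displacement of both flows since their nodes, the second is the second-order error
  of both Euler steps.\<close>

definition q :: real where
  "q = 2 * G * (4 + N) * H + 2 * (36 + 4 * N + 2 * real CARD('n)) * H\<^sup>2"

lemma nonneg_consts: "0 \<le> curvature_lip CARD('n) C (M + 1) \<kappa>" "0 \<le> L" "0 \<le> G" "0 \<le> q"
proof -
  show 1: "0 \<le> curvature_lip CARD('n) C (M + 1) \<kappa>" "0 \<le> L"
    using C0 \<kappa>0 M1 by (auto simp: curvature_lip_def L_eq field_lip_def)
  then show 2: "0 \<le> G" using H0 by (simp add: G_def)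
  show "0 \<le> q" using 2 H0 N6 by (simp add: q_def)
qed

text \<open>On this interval each flow uses the field of its own last node, so fields and footpoints
  are compared at the nodes, at distance at most r'. Positions and planes then advance from their
  values at time \<open>a\<close>.\<close>

lemma pair_step:
  assumes \<tau>1: "subdivision m1 \<tau>1" "\<forall>i<m1. \<tau>1 (Suc i) - \<tau>1 i \<le> \<delta>"
    and \<tau>2: "subdivision m2 \<tau>2" "\<forall>i<m2. \<tau>2 (Suc i) - \<tau>2 i \<le> \<delta>"
    and i: "i < m1" "\<tau>1 i \<le> a" "b \<le> \<tau>1 (Suc i)" and j: "j < m2" "\<tau>2 j \<le> a" "b \<le> \<tau>2 (Suc j)"
    and ab: "a \<le> b" and r: "0 \<le> r" and close: "close (pos m1 \<tau>1 a) (lnj m1 \<tau>1 a) (pos m2 \<tau>2 a) (lnj m2 \<tau>2 a) r"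
  shows "close (pos m1 \<tau>1 b) (lnj m1 \<tau>1 b) (pos m2 \<tau>2 b) (lnj m2 \<tau>2 b) (r + (b - a) * (G * r + \<delta> * q))"
proof -
  let ?K = "curvature_lip CARD('n) C (M + 1) \<kappa>"
  define r' where "r' = r + 2 * ((4 + N) * (\<delta> * H))"
  have r': "0 \<le> r'" "r \<le> r'" using r N6 \<delta>0 H0 by (auto simp: r'_def)
  have ai: "a \<in> {\<tau>1 i..\<tau>1 (Suc i)}" "b \<in> {\<tau>1 i..\<tau>1 (Suc i)}" and aj: "a \<in> {\<tau>2 j..\<tau>2 (Suc j)}" "b \<in> {\<tau>2 j..\<tau>2 (Suc j)}"
    using i j ab by auto
  \<comment> \<open>The two nodes are different times; passing through the common time
    \<open>a\<close> costs one displacement for each flow.\<close>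
  have base: "close (pos m1 \<tau>1 (\<tau>1 i)) (lnj m1 \<tau>1 (\<tau>1 i)) (pos m2 \<tau>2 (\<tau>2 j)) (lnj m2 \<tau>2 (\<tau>2 j)) r'"
  proof
    fix p :: "(real^'n) \<times> 'n endo" assume p: "p \<in> grass_bundle d"
    have "bundle_dist (pos m1 \<tau>1 (\<tau>1 i) p) (pos m2 \<tau>2 (\<tau>2 j) p) \<le> bundle_dist (pos m1 \<tau>1 a p) (pos m1 \<tau>1 (\<tau>1 i) p)
       + bundle_dist (pos m1 \<tau>1 a p) (pos m2 \<tau>2 a p) + bundle_dist (pos m2 \<tau>2 a p) (pos m2 \<tau>2 (\<tau>2 j) p)"
      using bundle_dist_triangle[of "pos m1 \<tau>1 (\<tau>1 i) p" "pos m2 \<tau>2 (\<tau>2 j) p" "pos m1 \<tau>1 a p"]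
        bundle_dist_triangle[of "pos m1 \<tau>1 a p" "pos m2 \<tau>2 (\<tau>2 j) p" "pos m2 \<tau>2 a p"]
        bundle_dist_commute[of "pos m1 \<tau>1 (\<tau>1 i) p" "pos m1 \<tau>1 a p"] by linarith
    then show "bundle_dist (pos m1 \<tau>1 (\<tau>1 i) p) (pos m2 \<tau>2 (\<tau>2 j) p) + \<bar>lnj m1 \<tau>1 (\<tau>1 i) p - lnj m2 \<tau>2 (\<tau>2 j) p\<bar> \<le> r'"
      using traj_displacement[OF \<tau>1 i(1) ai(1) p] traj_displacement[OF \<tau>2 j(1) aj(1) p] bspec[OF close p]
      unfolding r'_def by linarith
  qed
  have ti: "\<tau>1 i \<in> {0..1}" "\<tau>2 j \<in> {0..1}" using node_in_unit[OF \<tau>1, of i] node_in_unit[OF \<tau>2, of j] i j by auto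
  define U where "U = amcf d \<psi> \<epsilon> V0 m1 \<tau>1 (\<tau>1 i)"
  define W where "W = amcf d \<psi> \<epsilon> V0 m2 \<tau>2 (\<tau>2 j)"
  note U = flow_transported[OF \<tau>1 ti(1), folded U_def] and W = flow_transported[OF \<tau>2 ti(2), folded W_def]
  note FU = field[OF U(3)] and FW = field[OF W(3)]
  note cc = curvature_close[OF U(1,3) W(1,3) base r'(1)]
  show ?thesis
  proof
    fix p :: "(real^'n) \<times> 'n endo" assume p: "p \<in> grass_bundle d"
    define x where "x = pos m1 \<tau>1 (\<tau>1 i) p"
    define y where "y = pos m2 \<tau>2 (\<tau>2 j) p"
    have "x \<in> grass_bundle d" "y \<in> grass_bundle d"
      unfolding x_def y_def by (rule transported_bundle[OF U(1) p] transported_bundle[OF W(1) p])+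
    then have S: "snd x \<in> grassmannian d" "snd y \<in> grassmannian d" by (auto simp: grass_bundle_def)
    let ?hU = "approx_mean_curvature \<psi> \<epsilon> U" and ?hW = "approx_mean_curvature \<psi> \<epsilon> W"
    let ?BU = "curvature_deriv \<psi> \<epsilon> U" and ?BW = "curvature_deriv \<psi> \<epsilon> W"
    have xy: "norm (fst x - fst y) \<le> r'"
      using bspec[OF base p] unfolding x_def[symmetric] y_def[symmetric] bundle_dist_def
      using norm_ge_zero[of "snd x - snd y"] by linarith
    have dh: "norm (?hU (fst x) - ?hW (fst y)) \<le> ?K * r' + H * r'"
    proof -
      have "norm (?hU (fst x) - ?hW (fst y)) \<le> norm (?hU (fst x) - ?hW (fst x)) + norm (?hW (fst x) - ?hW (fst y))"
        using norm_triangle_ineq[of "?hU (fst x) - ?hW (fst x)" "?hW (fst x) - ?hW (fst y)"] by simp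
      also have "\<dots> \<le> ?K * r' + H * r'"
        by (intro add_mono cc(1) order_trans[OF field_lipschitz[OF FW]] mult_left_mono xy H0)
      finally show ?thesis .
    qed
    have dB: "norm (?BU (fst x) - ?BW (fst y)) \<le> ?K * r' + L * r'"
    proof -
      have "norm (?BU (fst x) - ?BW (fst y)) \<le> norm (?BU (fst x) - ?BW (fst x)) + norm (?BW (fst x) - ?BW (fst y))"
        using norm_triangle_ineq[of "?BU (fst x) - ?BW (fst x)" "?BW (fst x) - ?BW (fst y)"] by simp
      also have "\<dots> \<le> ?K * r' + L * r'"
        by (intro add_mono cc(2) order_trans[OF field_boundsD(4)[OF FW]] mult_left_mono xy nonneg_consts)
      finally show ?thesis .
    qed
    define s where "s = b - a"
    have s0: "0 \<le> s" using ab by (simp add: s_def)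
    define t1 where "t1 = a - \<tau>1 i"
    define t2 where "t2 = a - \<tau>2 j"
    have bt: "b - \<tau>1 i = t1 + s" "b - \<tau>2 j = t2 + s" by (auto simp: t1_def t2_def s_def)
    have tt: "0 \<le> t1" "0 \<le> t2" "t1 + s \<le> \<delta>" "t2 + s \<le> \<delta>"
      unfolding bt[symmetric] using i j \<tau>1(2)[rule_format, OF i(1)] \<tau>2(2)[rule_format, OF j(1)] by (auto simp: t1_def t2_def)
    note e1 = traj_step[OF \<tau>1 i(1) ai(1) p, folded U_def x_def t1_def] traj_step[OF \<tau>1 i(1) ai(2) p, folded U_def x_def, unfolded bt]
    note e2 = traj_step[OF \<tau>2 j(1) aj(1) p, folded W_def y_def t2_def] traj_step[OF \<tau>2 j(1) aj(2) p, folded W_def y_def, unfolded bt]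
    define n where "n = real CARD('n)"
    define c where "c = 36 + 4 * jac_const d + 2 * n"
    define D where "D = norm (snd (pos m1 \<tau>1 a p) - snd (pos m2 \<tau>2 a p))"
    have ca: "norm (fst (pos m1 \<tau>1 a p) - fst (pos m2 \<tau>2 a p)) + D + \<bar>lnj m1 \<tau>1 a p - lnj m2 \<tau>2 a p\<bar> \<le> r"
      using bspec[OF close p] by (simp add: bundle_dist_def D_def)
    then have Dr: "D \<le> r'" using r' norm_ge_zero[of "fst (pos m1 \<tau>1 a p) - fst (pos m2 \<tau>2 a p)"] by linarith
    have X: "norm (fst (pos m1 \<tau>1 b p) - fst (pos m2 \<tau>2 b p)) \<le> norm (fst (pos m1 \<tau>1 a p) - fst (pos m2 \<tau>2 a p)) + s * (?K * r' + H * r')"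
    proof -
      have "fst (pos m1 \<tau>1 b p) - fst (pos m2 \<tau>2 b p) = (fst (pos m1 \<tau>1 a p) - fst (pos m2 \<tau>2 a p)) + s *\<^sub>R (?hU (fst x) - ?hW (fst y))"
        unfolding e1 e2 step_map_def by (simp add: scaleR_add_left scaleR_diff_right)
      also have "norm \<dots> \<le> norm (fst (pos m1 \<tau>1 a p) - fst (pos m2 \<tau>2 a p)) + s * norm (?hU (fst x) - ?hW (fst y))"
        using s0 by (intro order_trans[OF norm_triangle_ineq]) simp
      also have "\<dots> \<le> norm (fst (pos m1 \<tau>1 a p) - fst (pos m2 \<tau>2 a p)) + s * (?K * r' + H * r')"
        using dh s0 by (intro add_left_mono mult_left_mono) auto
      finally show ?thesis .
    qed
    have T: "norm (snd (pos m1 \<tau>1 b p) - snd (pos m2 \<tau>2 b p)) + \<bar>lnj m1 \<tau>1 b p - lnj m2 \<tau>2 b p\<bar>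
        \<le> D + \<bar>lnj m1 \<tau>1 a p - lnj m2 \<tau>2 a p\<bar> +
          s * ((2 + n) * norm (?BU (fst x) - ?BW (fst y)) + (6 + n) * H * D + 2 * c * (\<delta> * H\<^sup>2))"
      \<comment> \<open>The matrices are the derivatives at the node positions \<open>fst x\<close>
        and \<open>fst y\<close>, whereas \<open>D\<close> is measured at the current time
        \<open>a\<close>.\<close>
      using tangent_pair_step[OF S field_boundsD(3)[OF FU, of "fst x"] field_boundsD(3)[OF FW, of "fst y"] tt(1,2) s0 tt(3,4)
          small2[OF \<delta>0 order_refl], of "lnj m1 \<tau>1 (\<tau>1 i) p" "lnj m2 \<tau>2 (\<tau>2 j) p"]
      unfolding D_def e1 e2 step_map_def step_ln_jac_def snd_conv n_def c_def .
    have n0: "0 \<le> n" by (simp add: n_def)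
    have "(2 + n) * norm (?BU (fst x) - ?BW (fst y)) + (6 + n) * H * D + 2 * c * (\<delta> * H\<^sup>2)
        \<le> (2 + n) * (?K * r' + L * r') + (6 + n) * H * r' + 2 * (36 + 4 * N + 2 * n) * (\<delta> * H\<^sup>2)"
      using dB Dr n0 H0 N6 \<delta>0 by (intro add_mono mult_left_mono mult_right_mono) (auto simp: c_def)
    then have T': "norm (snd (pos m1 \<tau>1 b p) - snd (pos m2 \<tau>2 b p)) + \<bar>lnj m1 \<tau>1 b p - lnj m2 \<tau>2 b p\<bar>
        \<le> D + \<bar>lnj m1 \<tau>1 a p - lnj m2 \<tau>2 a p\<bar> +
          s * ((2 + n) * (?K * r' + L * r') + (6 + n) * H * r' + 2 * (36 + 4 * N + 2 * n) * (\<delta> * H\<^sup>2))"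
      using T mult_left_mono[OF _ s0] by (meson add_left_mono order_trans)
    \<comment> \<open>By definition of \<open>q\<close>, the surplus of G r' over G r is exactly the
      first summand of \<delta> q; the leftover \<open>L * r'\<close> comes from the rounding in
      \<open>G\<close>.\<close>
    have "(?K * r' + H * r') + ((2 + n) * (?K * r' + L * r') + (6 + n) * H * r' + 2 * (36 + 4 * N + 2 * n) * (\<delta> * H\<^sup>2)) \<le> G * r + \<delta> * q"
    proof -
      have "G * r + \<delta> * q = G * r' + 2 * (36 + 4 * N + 2 * n) * (\<delta> * H\<^sup>2)"
        by (simp add: q_def r'_def n_def algebra_simps power2_eq_square)
      moreover have "G * r' = (?K * r' + H * r') + (2 + n) * (?K * r' + L * r') + (6 + n) * H * r' + L * r'"
        by (simp add: G_def n_def algebra_simps)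
      moreover have "0 \<le> L * r'" using nonneg_consts(2) r' by simp
      ultimately show ?thesis by linarith
    qed
    from mult_left_mono[OF this s0]
    have "s * (?K * r' + H * r') + s * ((2 + n) * (?K * r' + L * r') + (6 + n) * H * r' + 2 * (36 + 4 * N + 2 * n) * (\<delta> * H\<^sup>2)) \<le> s * (G * r + \<delta> * q)"
      by (simp only: distrib_left)
    then show "bundle_dist (pos m1 \<tau>1 b p) (pos m2 \<tau>2 b p) + \<bar>lnj m1 \<tau>1 b p - lnj m2 \<tau>2 b p\<bar> \<le> r + (b - a) * (G * r + \<delta> * q)"
      unfolding bundle_dist_def s_def[symmetric] using X T' ca by linarith
  qed
qed

text \<open>Gronwall bounds the distance of trajectories. A test function of the bounded Lipschitz
  distance is an admissible integrand for the coupling with constant 1, which adds the factor 2 (M +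
  1).\<close>

lemma flow_dist:
  assumes \<tau>1: "subdivision m1 \<tau>1" "\<forall>i<m1. \<tau>1 (Suc i) - \<tau>1 i \<le> \<delta>"
    and \<tau>2: "subdivision m2 \<tau>2" "\<forall>i<m2. \<tau>2 (Suc i) - \<tau>2 i \<le> \<delta>"
    and t: "t \<in> {0..1}"
  shows "varifold_dist d (amcf d \<psi> \<epsilon> V0 m1 \<tau>1 t) (amcf d \<psi> \<epsilon> V0 m2 \<tau>2 t) \<le> 2 * (M + 1) * (t * (\<delta> * q) * exp (G * t))"
proof -
  have q0: "0 \<le> \<delta> * q" using \<delta>0 nonneg_consts by simp
  have close: "close (pos m1 \<tau>1 t) (lnj m1 \<tau>1 t) (pos m2 \<tau>2 t) (lnj m2 \<tau>2 t) (t * (\<delta> * q) * exp (G * t))"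
  proof (rule two_grid_gronwall[OF \<tau>1(1) \<tau>2(1) nonneg_consts(3) q0, where
        P = "\<lambda>t r. close (pos m1 \<tau>1 t) (lnj m1 \<tau>1 t) (pos m2 \<tau>2 t) (lnj m2 \<tau>2 t) r"])
    show "close (pos m1 \<tau>1 0) (lnj m1 \<tau>1 0) (pos m2 \<tau>2 0) (lnj m2 \<tau>2 0) 0"
      by (simp add: traj_zero[OF \<tau>1] traj_zero[OF \<tau>2] bundle_dist_def)
  next
    fix u r r'
    assume "close (pos m1 \<tau>1 u) (lnj m1 \<tau>1 u) (pos m2 \<tau>2 u) (lnj m2 \<tau>2 u) r" "r \<le> r'"
    then show "close (pos m1 \<tau>1 u) (lnj m1 \<tau>1 u) (pos m2 \<tau>2 u) (lnj m2 \<tau>2 u) r'"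
      using order_trans by blast
  next
    fix a b i j r
    assume "i < m1" "j < m2" "\<tau>1 i \<le> a" "\<tau>2 j \<le> a" "a \<le> b" "b \<le> \<tau>1 (Suc i)" "b \<le> \<tau>2 (Suc j)" "0 \<le> r"
      "close (pos m1 \<tau>1 a) (lnj m1 \<tau>1 a) (pos m2 \<tau>2 a) (lnj m2 \<tau>2 a) r"
    then show "close (pos m1 \<tau>1 b) (lnj m1 \<tau>1 b) (pos m2 \<tau>2 b) (lnj m2 \<tau>2 b) (r + (b - a) * (G * r + \<delta> * q))"
      by (intro pair_step[OF \<tau>1 \<tau>2, of i a b j r])
  qed (rule t)
  have r0: "0 \<le> t * (\<delta> * q) * exp (G * t)" using t q0 by simp
  note V = flow_transported[OF \<tau>1 t] and W = flow_transported[OF \<tau>2 t]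
  have c: "bundle_dist (pos m1 \<tau>1 t p) (pos m2 \<tau>2 t p) + \<bar>lnj m1 \<tau>1 t p - lnj m2 \<tau>2 t p\<bar> \<le> t * (\<delta> * q) * exp (G * t)"
    if "p \<in> grass_bundle d" for p using close that by blast
  show ?thesis
    unfolding varifold_dist_def bl_dist_def
  proof (rule cSUP_least)
    have d0: "0 \<le> bundle_dist p q" for p q :: "(real^'n) \<times> 'n endo" by (simp add: bundle_dist_def)
    have "(\<lambda>_. 0) \<in> {\<phi>. continuous_on (grass_bundle d) \<phi> \<and> (\<forall>x\<in>grass_bundle d. 0 \<le> \<phi> x \<and> \<phi> x \<le> (1::real)) \<and>
        (\<forall>x\<in>grass_bundle d. \<forall>y\<in>grass_bundle d. \<bar>\<phi> x - \<phi> y\<bar> \<le> bundle_dist x (y :: (real^'n) \<times> 'n endo))}"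
      using d0 by simp
    then show "{\<phi>. continuous_on (grass_bundle d) \<phi> \<and> (\<forall>x\<in>grass_bundle d. 0 \<le> \<phi> x \<and> \<phi> x \<le> (1::real)) \<and>
        (\<forall>x\<in>grass_bundle d. \<forall>y\<in>grass_bundle d. \<bar>\<phi> x - \<phi> y\<bar> \<le> bundle_dist x (y :: (real^'n) \<times> 'n endo))} \<noteq> {}" by blast
    fix \<phi> :: "(real^'n) \<times> 'n endo \<Rightarrow> real"
    assume "\<phi> \<in> {\<phi>. continuous_on (grass_bundle d) \<phi> \<and> (\<forall>x\<in>grass_bundle d. 0 \<le> \<phi> x \<and> \<phi> x \<le> 1) \<and>
        (\<forall>x\<in>grass_bundle d. \<forall>y\<in>grass_bundle d. \<bar>\<phi> x - \<phi> y\<bar> \<le> bundle_dist x y)}"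
    then have \<phi>: "continuous_on (grass_bundle d) \<phi>" "\<And>x. x \<in> grass_bundle d \<Longrightarrow> 0 \<le> \<phi> x \<and> \<phi> x \<le> 1"
      "\<And>x y. x \<in> grass_bundle d \<Longrightarrow> y \<in> grass_bundle d \<Longrightarrow> \<bar>\<phi> x - \<phi> y\<bar> \<le> bundle_dist x y" by auto
    have "norm (integral\<^sup>L (amcf d \<psi> \<epsilon> V0 m1 \<tau>1 t) \<phi> - integral\<^sup>L (amcf d \<psi> \<epsilon> V0 m2 \<tau>2 t) \<phi>)
        \<le> 2 * (M + 1) * 1 * (t * (\<delta> * q) * exp (G * t))"
      by (rule coupling_bound[OF sets_V0 _ V(1,3) W(1,3) \<phi>(1) _ _ _ c r0]) (use \<phi> M1 in auto)
    then show "\<bar>integral\<^sup>L (amcf d \<psi> \<epsilon> V0 m1 \<tau>1 t) \<phi> - integral\<^sup>L (amcf d \<psi> \<epsilon> V0 m2 \<tau>2 t) \<phi>\<bar>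
        \<le> 2 * (M + 1) * (t * (\<delta> * q) * exp (G * t))" by simp
  qed
qed

end

section \<open>Choice of the constants and conclusion\<close>

lemma mesh_ge:
  assumes "i < m"
  shows "\<tau> (Suc i) - \<tau> i \<le> mesh m \<tau>"
  unfolding mesh_def using assms by (intro Max_ge) auto

lemma subdivision_mesh_nonneg:
  assumes "subdivision m \<tau>"
  shows "0 \<le> mesh m \<tau>"
proof -
  have "0 < m" using assms by (cases m) (auto simp: subdivision_def)
  then have "\<tau> 0 < \<tau> (Suc 0)" using assms unfolding subdivision_def by blast
  then show ?thesis using mesh_ge[OF \<open>0 < m\<close>, of \<tau>] by simp
qed

lemma powi_neg:
  assumes "0 < (\<epsilon>::real)"
  shows "\<epsilon> powi (- int n - 11) = (1 / \<epsilon>) ^ (n + 11)" "\<epsilon> powi (- int n - 7) = (1 / \<epsilon>) ^ (n + 7)"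
proof -
  have *: "\<epsilon> powi (- int k) = (1 / \<epsilon>) ^ k" for k
    by (simp add: power_int_minus power_one_over inverse_eq_divide)
  have "- int n - 11 = - int (n + 11)" "- int n - 7 = - int (n + 7)" by auto
  then show "\<epsilon> powi (- int n - 11) = (1 / \<epsilon>) ^ (n + 11)" "\<epsilon> powi (- int n - 7) = (1 / \<epsilon>) ^ (n + 7)"
    using *[of "n + 11"] *[of "n + 7"] by simp_all
qed

lemma varifold_mass_le:
  assumes "varifold d V" "emeasure (weight V) UNIV \<le> ennreal M"
  shows "mass_le d M V"
proof -
  have s: "sets V = sets (bundle_algebra d)" using assms(1) by (simp add: varifold_def)
  have "fst \<in> borel_measurable V" by (intro bundle_measurable[OF s] continuous_intros)
  then have "emeasure (weight V) UNIV = emeasure V (space V)"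
    unfolding weight_def by (subst emeasure_distr) auto
  then show ?thesis using assms(2) s by (simp add: mass_le_def)
qed

text \<open>Since \<mu> and \<kappa> are at least 1, the top powers in \<open>G\<close> are those of
  \<open>curvature_lip\<close>, collected in \<open>P\<close>. The leading part of \<open>q\<close>
  is G H, of order P \<mu> \<kappa>^4, and it dominates the square of \<open>H\<close>, which is of
  order \<mu>^2 \<kappa>^8.\<close>

lemma (in euler_flow) constants_le:
  fixes K0 L0 H0 :: real
  defines "n \<equiv> real CARD('n)" and "\<mu> \<equiv> M + 1" and "\<omega> \<equiv> unit_ball_vol (real CARD('n))"
  defines "K0 \<equiv> 14 * (1 + C * \<omega>) * C\<^sup>2" and "L0 \<equiv> 4 * \<omega> * C\<^sup>2" and "H0 \<equiv> 2 * C * (1 + C * \<omega>)"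
  defines "G0 \<equiv> (3 + n) * (K0 + L0) + (7 + n) * H0"
  shows "G \<le> G0 * \<mu>\<^sup>2 * \<kappa> ^ (CARD('n) + 7)"
    and "q \<le> (2 * G0 * (4 + N) * H0 + 2 * (36 + 4 * N + 2 * n) * H0\<^sup>2) * \<mu> ^ 3 * \<kappa> ^ (CARD('n) + 11)"
proof -
  let ?n = "CARD('n)"
  have \<mu>: "1 \<le> \<mu>" using M1 by (simp add: \<mu>_def)
  have c0: "0 \<le> \<omega>" "0 \<le> K0" "0 \<le> L0" "0 \<le> H0" "0 \<le> n" using C0 by (auto simp: \<omega>_def K0_def L0_def H0_def n_def)
  then have G00: "0 \<le> G0" by (simp add: G0_def)
  define P where "P = \<mu>\<^sup>2 * \<kappa> ^ (?n + 7)"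
  have \<mu>2: "\<mu> \<le> \<mu>\<^sup>2" using \<mu> by (simp add: power2_eq_square)
  have He: "H = H0 * (\<mu> * \<kappa> ^ 4)" by (simp add: H_eq field_size_def H0_def \<mu>_def \<omega>_def)
  have pw: "\<mu> * \<kappa> ^ k \<le> P" if "k \<le> ?n + 7" for k
    unfolding P_def using \<mu> \<mu>2 \<kappa>1 that by (intro mult_mono power_increasing) auto
  have "curvature_lip ?n C (M + 1) \<kappa> = K0 * P" by (simp add: curvature_lip_def K0_def P_def \<mu>_def \<omega>_def)
  moreover have "L \<le> L0 * P"
    using mult_left_mono[OF pw[of "?n + 6"] c0(3)] by (simp add: L_eq field_lip_def L0_def \<mu>_def \<omega>_def mult.assoc)
  moreover have "H \<le> H0 * P" unfolding He by (rule mult_left_mono[OF pw c0(4)]) simp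
  ultimately have "G \<le> (3 + n) * (K0 * P + L0 * P) + (7 + n) * (H0 * P)"
    unfolding G_def n_def[symmetric] using c0 by (intro add_mono mult_left_mono) auto
  also have "\<dots> = G0 * P" by (simp add: G0_def algebra_simps)
  finally have GP: "G \<le> G0 * P" .
  then show "G \<le> G0 * \<mu>\<^sup>2 * \<kappa> ^ (?n + 7)" by (simp add: P_def mult.assoc)
  define R where "R = \<mu> ^ 3 * \<kappa> ^ (?n + 11)"
  have PR: "P * (\<mu> * \<kappa> ^ 4) = R" by (simp add: P_def R_def power_add numeral_eq_Suc)
  have a: "2 * G * (4 + N) * H \<le> 2 * G0 * (4 + N) * H0 * R"
  proof -
    have "2 * G * (4 + N) * H \<le> 2 * (G0 * P) * (4 + N) * H"
      using GP N6 by (intro mult_right_mono mult_left_mono) (auto simp: He intro!: mult_nonneg_nonneg c0 order_trans[OF _ \<mu>] \<kappa>0)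
    also have "\<dots> = 2 * G0 * (4 + N) * H0 * (P * (\<mu> * \<kappa> ^ 4))" by (simp add: He)
    finally show ?thesis by (simp add: PR)
  qed
  have "(\<mu> * \<kappa> ^ 4)\<^sup>2 = \<mu>\<^sup>2 * \<kappa> ^ 8" by (simp add: power_mult_distrib flip: power_mult)
  also have "\<dots> \<le> \<mu> ^ 3 * \<kappa> ^ (?n + 11)" using \<mu> \<kappa>1 by (intro mult_mono power_increasing) auto
  finally have "H\<^sup>2 \<le> H0\<^sup>2 * R" unfolding He R_def by (simp add: power_mult_distrib[of H0] mult_left_mono)
  then have "2 * (36 + 4 * N + 2 * n) * H\<^sup>2 \<le> 2 * (36 + 4 * N + 2 * n) * (H0\<^sup>2 * R)"
    using N6 c0 by (intro mult_left_mono) auto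
  with a have "q \<le> (2 * G0 * (4 + N) * H0 + 2 * (36 + 4 * N + 2 * n) * H0\<^sup>2) * R"
    unfolding q_def n_def[symmetric] by (simp add: distrib_right mult.assoc)
  then show "q \<le> (2 * G0 * (4 + N) * H0 + 2 * (36 + 4 * N + 2 * n) * H0\<^sup>2) * \<mu> ^ 3 * \<kappa> ^ (?n + 11)"
    by (simp add: R_def mult.assoc)
qed

text \<open>Both requirements reduce to the step-size condition, because \<delta> H^2 (M + 1) equals
  \<open>H0\<^sup>2\<close> \<delta> (M + 1)^3 \<kappa>^8. The linear condition has smaller powers
  and follows from \<open>H0\<close>, M + 1 and \<kappa> being at least 1.\<close>

lemma step_condition_small:
  fixes C \<epsilon> M \<delta> N H0 :: real
  assumes \<epsilon>: "0 < \<epsilon>" "\<epsilon> < 1" and M: "1 \<le> M" and N: "6 \<le> N" and H0: "1 \<le> H0" and \<delta>: "0 \<le> \<delta>"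
    and sc: "2 * N * H0\<^sup>2 * \<delta> \<le> (M + 1) powi (-3) * \<epsilon> ^ 8"
  defines "H \<equiv> H0 * (M + 1) * (1 / \<epsilon>) ^ 4"
  shows "N * (2 * (\<delta> * H)) \<le> 1" "N * (\<delta> * H\<^sup>2) * (M + 1) \<le> 1"
proof -
  define \<kappa> where "\<kappa> = 1 / \<epsilon>"
  define \<mu> where "\<mu> = M + 1"
  have \<kappa>: "1 \<le> \<kappa>" "\<kappa> * \<epsilon> = 1" using \<epsilon> by (auto simp: \<kappa>_def)
  have \<mu>: "1 \<le> \<mu>" using M by (simp add: \<mu>_def)
  have "\<mu> powi (-3) = inverse (\<mu> ^ 3)" by (simp add: power_int_minus)
  then have "2 * N * H0\<^sup>2 * \<delta> * (\<mu> ^ 3 * \<kappa> ^ 8) \<le> (inverse (\<mu> ^ 3) * \<epsilon> ^ 8) * (\<mu> ^ 3 * \<kappa> ^ 8)"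
    using sc \<mu> \<kappa> by (intro mult_right_mono) (auto simp: \<mu>_def)
  also have "\<dots> = (inverse (\<mu> ^ 3) * \<mu> ^ 3) * (\<kappa> * \<epsilon>) ^ 8" by (simp only: power_mult_distrib mult_ac)
  also have "\<dots> = 1" using \<mu> \<kappa> by simp
  finally have main: "2 * N * H0\<^sup>2 * \<delta> * (\<mu> ^ 3 * \<kappa> ^ 8) \<le> 1" .
  have "H0 * (\<mu> * \<kappa> ^ 4) \<le> H0\<^sup>2 * (\<mu> ^ 3 * \<kappa> ^ 8)"
    using H0 \<mu> \<kappa> power_increasing[of 1 2 H0] power_increasing[of 1 3 \<mu>]
    by (intro mult_mono power_increasing) auto
  then have "2 * N * \<delta> * (H0 * (\<mu> * \<kappa> ^ 4)) \<le> 2 * N * \<delta> * (H0\<^sup>2 * (\<mu> ^ 3 * \<kappa> ^ 8))"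
    using N \<delta> by (intro mult_left_mono) auto
  with main show "N * (2 * (\<delta> * H)) \<le> 1"
    unfolding H_def \<mu>_def[symmetric] \<kappa>_def[symmetric] by (simp only: mult_ac)
  have "N * (\<delta> * H\<^sup>2) * \<mu> = N * H0\<^sup>2 * \<delta> * (\<mu> ^ 3 * \<kappa> ^ 8)"
    unfolding H_def \<mu>_def[symmetric] \<kappa>_def[symmetric] by (simp add: power_mult_distrib numeral_eq_Suc)
  moreover have "0 \<le> N * H0\<^sup>2 * \<delta> * (\<mu> ^ 3 * \<kappa> ^ 8)" using N \<delta> \<mu> \<kappa> by simp
  ultimately show "N * (\<delta> * H\<^sup>2) * (M + 1) \<le> 1" using main unfolding \<mu>_def[symmetric] by linarith
qed

theorem proposition3p13:
  fixes \<psi> :: "real^'n::finite \<Rightarrow> real"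
  assumes "CARD('n) \<ge> 2" and "admissible_cutoff \<psi>"
  shows "\<exists>c3 c5 c7 :: real. c3 > 0 \<and> c5 > 0 \<and> c7 > 0 \<and>
    (\<forall>(d::nat) (\<epsilon>::real) (M::real) (V0 :: ((real^'n) \<times> 'n endo) measure).
       1 \<le> d \<and> d \<le> CARD('n) \<and> 0 < \<epsilon> \<and> \<epsilon> < 1 \<and> 1 \<le> M \<and>
       varifold d V0 \<and> emeasure (weight V0) UNIV \<le> ennreal M \<longrightarrow>
       (\<forall>m \<tau>. subdivision m \<tau> \<and> step_condition c3 M \<epsilon> m \<tau> \<longrightarrow>
          flow_well_defined d \<psi> \<epsilon> M V0 m \<tau>) \<and>
       (\<forall>m1 \<tau>1 m2 \<tau>2.
          subdivision m1 \<tau>1 \<and> step_condition c3 M \<epsilon> m1 \<tau>1 \<and>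
          subdivision m2 \<tau>2 \<and> step_condition c3 M \<epsilon> m2 \<tau>2 \<longrightarrow>
          (\<forall>t\<in>{0..1}.
             varifold_dist d (amcf d \<psi> \<epsilon> V0 m1 \<tau>1 t) (amcf d \<psi> \<epsilon> V0 m2 \<tau>2 t)
             \<le> c7 * (M + 1) ^ 5 * t * max (mesh m1 \<tau>1) (mesh m2 \<tau>2)
                * \<epsilon> powi (- int CARD('n) - 11)
                * exp (c5 * (M + 1)\<^sup>2 * t * \<epsilon> powi (- int CARD('n) - 7)))))"
proof -
  let ?n = "CARD('n)"
  \<comment> \<open>\<open>C\<close> is obtained before \<epsilon>, d, M and the varifold are
    introduced, so the constants built from it depend only on the cutoff and the dimension.\<close>
  obtain C where C: "\<And>\<epsilon>. 0 < \<epsilon> \<Longrightarrow> \<epsilon> < 1 \<Longrightarrow> mollifier (kernel \<psi> \<epsilon>) C (1 / \<epsilon>)"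
    using kernel_mollifier[OF assms(2)] by blast
  have C1: "1 \<le> C" using mollifier.C1[OF C[of "1/2"]] by simp
  define \<omega> where "\<omega> = unit_ball_vol (real ?n)"
  define N where "N = jac_const ?n"
  define H0 where "H0 = 2 * C * (1 + C * \<omega>)"
  define G0 where "G0 = (3 + real ?n) * (14 * (1 + C * \<omega>) * C\<^sup>2 + 4 * \<omega> * C\<^sup>2) + (7 + real ?n) * H0"
  define q0 where "q0 = 2 * G0 * (4 + N) * H0 + 2 * (36 + 4 * N + 2 * real ?n) * H0\<^sup>2"
  have \<omega>: "0 \<le> \<omega>" by (simp add: \<omega>_def)
  have N: "6 \<le> N" unfolding N_def by (rule jac_const_ge)
  have H0: "1 \<le> H0"
  proof -
    have "1 * 1 \<le> (2 * C) * (1 + C * \<omega>)" using C1 \<omega> by (intro mult_mono) auto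
    then show ?thesis by (simp add: H0_def)
  qed
  have G0: "0 < G0"
    unfolding G0_def using H0 C1 \<omega> by (intro add_nonneg_pos mult_pos_pos) auto
  have q0: "0 < q0"
    unfolding q0_def using H0 G0 N by (intro add_nonneg_pos mult_pos_pos) auto
  have ef: "euler_flow \<psi> \<epsilon> C (1 / \<epsilon>) d M \<delta> (field_size ?n C (M + 1) (1 / \<epsilon>)) (field_lip ?n C (M + 1) (1 / \<epsilon>)) N V0"
    if "d \<le> ?n" "0 < \<epsilon>" "\<epsilon> < 1" "1 \<le> M" "varifold d V0" "emeasure (weight V0) UNIV \<le> ennreal M" "0 \<le> \<delta>"
      "2 * N * H0\<^sup>2 * \<delta> \<le> (M + 1) powi (-3) * \<epsilon> ^ 8"
    for d \<epsilon> M \<delta> and V0 :: "((real^'n) \<times> 'n endo) measure"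
  proof -
    have H: "field_size ?n C (M + 1) (1 / \<epsilon>) = H0 * (M + 1) * (1 / \<epsilon>) ^ 4"
      by (simp add: field_size_def H0_def \<omega>_def)
    show ?thesis
      unfolding euler_flow_def euler_flow_axioms_def
      using C[OF that(2,3)] that varifold_mass_le[OF that(5,6)] step_condition_small[OF that(2,3,4) N H0 that(7,8)]
      by (simp only: H N_def simp_thms)
  qed
  show ?thesis
  \<comment> \<open>c3 is the constant of \<open>step_condition_small\<close>, c5 bounds the growth
    rate, and the 2 in c7 is the factor of the coupling.\<close>
  proof (rule exI[of _ "2 * N * H0\<^sup>2"], rule exI[of _ G0], rule exI[of _ "2 * q0"], intro conjI allI impI ballI)
    show "0 < 2 * N * H0\<^sup>2" "0 < G0" "0 < 2 * q0" using N H0 G0 q0 by auto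
  next
    fix d \<epsilon> M m \<tau> and V0 :: "((real^'n) \<times> 'n endo) measure"
    assume a: "1 \<le> d \<and> d \<le> ?n \<and> 0 < \<epsilon> \<and> \<epsilon> < 1 \<and> 1 \<le> M \<and> varifold d V0 \<and> emeasure (weight V0) UNIV \<le> ennreal M"
      and t: "subdivision m \<tau> \<and> step_condition (2 * N * H0\<^sup>2) M \<epsilon> m \<tau>"
    interpret euler_flow \<psi> \<epsilon> C "1 / \<epsilon>" d M "mesh m \<tau>" "field_size ?n C (M + 1) (1 / \<epsilon>)" "field_lip ?n C (M + 1) (1 / \<epsilon>)" N V0
      by (rule ef) (use a t subdivision_mesh_nonneg[of m \<tau>] in \<open>auto simp: step_condition_def\<close>)
    show "flow_well_defined d \<psi> \<epsilon> M V0 m \<tau>"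
      by (rule well_defined) (use t mesh_ge in auto)
  next
    fix d \<epsilon> M m1 \<tau>1 m2 \<tau>2 t and V0 :: "((real^'n) \<times> 'n endo) measure"
    assume a: "1 \<le> d \<and> d \<le> ?n \<and> 0 < \<epsilon> \<and> \<epsilon> < 1 \<and> 1 \<le> M \<and> varifold d V0 \<and> emeasure (weight V0) UNIV \<le> ennreal M"
      and ts: "subdivision m1 \<tau>1 \<and> step_condition (2 * N * H0\<^sup>2) M \<epsilon> m1 \<tau>1 \<and>
        subdivision m2 \<tau>2 \<and> step_condition (2 * N * H0\<^sup>2) M \<epsilon> m2 \<tau>2"
      and t: "t \<in> {0..(1::real)}"
    \<comment> \<open>The larger mesh inherits the step-size condition, so a single instance of
      \<open>euler_flow\<close> covers both grids.\<close>
    define \<delta> where "\<delta> = max (mesh m1 \<tau>1) (mesh m2 \<tau>2)"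
    have \<delta>: "0 \<le> \<delta>" "2 * N * H0\<^sup>2 * \<delta> \<le> (M + 1) powi (-3) * \<epsilon> ^ 8"
      using ts subdivision_mesh_nonneg[of m1 \<tau>1] by (auto simp: \<delta>_def step_condition_def max_def)
    interpret euler_flow \<psi> \<epsilon> C "1 / \<epsilon>" d M \<delta> "field_size ?n C (M + 1) (1 / \<epsilon>)" "field_lip ?n C (M + 1) (1 / \<epsilon>)" N V0
      by (rule ef) (use a \<delta> in auto)
    define \<mu> where "\<mu> = M + 1"
    define \<kappa> where "\<kappa> = 1 / \<epsilon>"
    have \<mu>: "1 \<le> \<mu>" and \<kappa>: "1 \<le> \<kappa>" using a by (auto simp: \<mu>_def \<kappa>_def)
    have Gq: "G \<le> G0 * \<mu>\<^sup>2 * \<kappa> ^ (?n + 7)" "q \<le> q0 * \<mu> ^ 3 * \<kappa> ^ (?n + 11)"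
      using constants_le unfolding G0_def q0_def H0_def \<omega>_def \<mu>_def \<kappa>_def by blast+
    have sub: "subdivision m1 \<tau>1" "\<forall>i<m1. \<tau>1 (Suc i) - \<tau>1 i \<le> \<delta>" "subdivision m2 \<tau>2" "\<forall>i<m2. \<tau>2 (Suc i) - \<tau>2 i \<le> \<delta>"
      using ts mesh_ge[of _ m1 \<tau>1] mesh_ge[of _ m2 \<tau>2] by (auto simp: \<delta>_def le_max_iff_disj)
    have "varifold_dist d (amcf d \<psi> \<epsilon> V0 m1 \<tau>1 t) (amcf d \<psi> \<epsilon> V0 m2 \<tau>2 t) \<le> 2 * \<mu> * (t * (\<delta> * q) * exp (G * t))"
      using flow_dist[OF sub t] by (simp add: \<mu>_def)
    also have "\<dots> \<le> 2 * \<mu> * (t * (\<delta> * (q0 * \<mu> ^ 3 * \<kappa> ^ (?n + 11))) * exp (G0 * \<mu>\<^sup>2 * \<kappa> ^ (?n + 7) * t))"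
      using Gq t \<delta>(1) \<mu> \<kappa> q0 nonneg_consts(4)
      by (intro mult_left_mono mult_mono) (auto intro: mult_right_mono)
    also have "\<dots> = (2 * q0 * t * \<delta> * \<kappa> ^ (?n + 11) * exp (G0 * \<mu>\<^sup>2 * \<kappa> ^ (?n + 7) * t)) * \<mu> ^ 4"
      by (simp add: numeral_eq_Suc)
    \<comment> \<open>The source term gives three powers of \<mu> and the coupling one more; since
      \<mu> is at least 1, the fourth power is below the fifth.\<close>
    also have "\<dots> \<le> (2 * q0 * t * \<delta> * \<kappa> ^ (?n + 11) * exp (G0 * \<mu>\<^sup>2 * \<kappa> ^ (?n + 7) * t)) * \<mu> ^ 5"
      using t \<delta>(1) \<mu> \<kappa> q0 by (intro mult_left_mono power_increasing) auto
    also have "\<dots> = 2 * q0 * (M + 1) ^ 5 * t * max (mesh m1 \<tau>1) (mesh m2 \<tau>2) * \<epsilon> powi (- int ?n - 11)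
        * exp (G0 * (M + 1)\<^sup>2 * t * \<epsilon> powi (- int ?n - 7))"
      using a powi_neg[of \<epsilon> ?n] by (simp add: \<mu>_def \<kappa>_def \<delta>_def mult_ac)
    finally show "varifold_dist d (amcf d \<psi> \<epsilon> V0 m1 \<tau>1 t) (amcf d \<psi> \<epsilon> V0 m2 \<tau>2 t) \<le>
        2 * q0 * (M + 1) ^ 5 * t * max (mesh m1 \<tau>1) (mesh m2 \<tau>2) * \<epsilon> powi (- int ?n - 11)
        * exp (G0 * (M + 1)\<^sup>2 * t * \<epsilon> powi (- int ?n - 7))" .
  qed
qed
end
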